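(* Let $n>1$ and $\lambda\ge1$. The family $\{(M_{s_1},\ldots,M_{s_n})|_{\mathbb P^{11}_{\boldsymbol p}(\mathbb A^{(\lambda)}(\mathbb D^n))}:\boldsymbol p\vdash n\}$ consists of mutually unitarily inequivalent $\Gamma_n$-contractions.
   Context: $\mathfrak S_n$ acts on $\mathbb C^n$ by permuting coordinates; $s_1,\dots,s_n$ are the elementary symmetric polynomials and $\Gamma_n=\boldsymbol s(\overline{\mathbb D}^n)$ is the closed symmetrized polydisc; a $\Gamma_n$-contraction is a commuting tuple having $\Gamma_n$ as a spectral set. The irreducible representations of $\mathfrak S_n$ (up to equivalence) are indexed by partitions $\boldsymbol p\vdash n$; for each, fix a unitary matrix realization $(\pi_{\boldsymbol p}^{ij})$ and set $(\mathbb P^{ij}_{\boldsymbol p}f)(z)=\frac{\deg\pi_{\boldsymbol p}}{n!}\sum_{\sigma\in\mathfrak S_n}\pi_{\boldsymbol p}^{ji}(\sigma^{-1})f(\sigma^{-1}\cdot z)$. For $\lambda>1$, $\mathbb A^{(\lambda)}(\mathbb D^n)$ is the weighted Bergman space with kernel $\prod_i(1-z_i\bar w_i)^{-\lambda}$ (holomorphic functions in $L^2$ of $\big(\frac{\lambda-1}{\pi}\big)^n\prod_i(1-|z_i|^2)^{\lambda-2}dV$), and $\mathbb A^{(1)}(\mathbb D^n)=H^2(\mathbb D^n)$. *)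

theory Defs
  imports "HOL-Analysis.Analysis" "HOL-Combinatorics.Permutations"
begin

definition polydisc :: "(complex^'n::finite) set" where
  "polydisc = {z. \<forall>i. norm (z$i) < 1}"

definition cpolydisc :: "(complex^'n::finite) set" where
  "cpolydisc = {z. \<forall>i. norm (z$i) \<le> 1}"

definition esym :: "nat \<Rightarrow> complex^'n::finite \<Rightarrow> complex" where
  "esym k z = (\<Sum>S\<in>{S::'n set. card S = k}. \<Prod>i\<in>S. z$i)"

definition symm_map :: "complex^'n::finite \<Rightarrow> nat \<Rightarrow> complex" where
  "symm_map z = (\<lambda>k. if k \<in> {1..CARD('n)} then esym k z else 0)"

definition gamma_set :: "'n::finite itself \<Rightarrow> (nat \<Rightarrow> complex) set" where
  "gamma_set _ = (symm_map :: complex^'n \<Rightarrow> _) ` cpolydisc"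

definition act :: "('n::finite \<Rightarrow> 'n) \<Rightarrow> complex^'n \<Rightarrow> complex^'n" where
  "act \<sigma> z = (\<chi> i. z $ (inv \<sigma> i))"

definition holo_on :: "(complex^'n::finite \<Rightarrow> complex) \<Rightarrow> (complex^'n) set \<Rightarrow> bool" where
  "holo_on f S \<longleftrightarrow> (\<forall>z\<in>S. \<exists>c::complex^'n.
      (f has_derivative (\<lambda>h. \<Sum>i\<in>UNIV. c$i * h$i)) (at z))"

text \<open>Squared norm in A^(lam)(D^n): weighted Bergman norm for lam > 1,
  Hardy space H^2(D^n) norm for lam = 1.\<close>
definition bergman_nrm2 :: "real \<Rightarrow> (complex^'n::finite \<Rightarrow> complex) \<Rightarrow> ennreal" where
  "bergman_nrm2 lam f =
    (if lam = 1 then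
       (SUP r\<in>{0..<1::real}.
          ennreal (1 / (2*pi) ^ CARD('n)) *
          (\<integral>\<^sup>+ \<theta>. indicator (cbox (0::real^'n) (\<chi> i. 2*pi)) \<theta> *
              ennreal ((cmod (f (\<chi> i. complex_of_real r * cis (\<theta>$i))))\<^sup>2) \<partial>lborel))
     else
       ennreal (((lam - 1) / pi) ^ CARD('n)) *
       (\<integral>\<^sup>+ z. indicator polydisc z *
           ennreal ((cmod (f z))\<^sup>2 * (\<Prod>i\<in>UNIV. (1 - (cmod (z$i))\<^sup>2) powr (lam - 2))) \<partial>lborel))"

definition A_space :: "real \<Rightarrow> (complex^'n::finite \<Rightarrow> complex) set" where
  "A_space lam = {f. holo_on f polydisc \<and> (\<forall>z. z \<notin> polydisc \<longrightarrow> f z = 0)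
                     \<and> bergman_nrm2 lam f < \<infinity>}"

definition bnorm :: "real \<Rightarrow> (complex^'n::finite \<Rightarrow> complex) \<Rightarrow> real" where
  "bnorm lam f = sqrt (enn2real (bergman_nrm2 lam f))"

definition mult_tuple :: "nat \<Rightarrow> (complex^'n::finite \<Rightarrow> complex) \<Rightarrow> (complex^'n \<Rightarrow> complex)" where
  "mult_tuple k f = (\<lambda>z. esym k z * f z)"

text \<open>Matrices of degree d are functions nat => nat => complex, entries indexed by 0..d-1.\<close>
definition is_rep :: "nat \<Rightarrow> (('n::finite \<Rightarrow> 'n) \<Rightarrow> nat \<Rightarrow> nat \<Rightarrow> complex) \<Rightarrow> bool" where
  "is_rep d \<rho> \<longleftrightarrow> d \<ge> 1 \<and>
     (\<forall>i<d. \<forall>j<d. \<rho> id i j = (if i = j then 1 else 0)) \<and>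
     (\<forall>\<sigma> \<tau>. \<sigma> permutes (UNIV::'n set) \<longrightarrow> \<tau> permutes (UNIV::'n set) \<longrightarrow>
        (\<forall>i<d. \<forall>j<d. \<rho> (\<sigma> \<circ> \<tau>) i j = (\<Sum>k<d. \<rho> \<sigma> i k * \<rho> \<tau> k j)))"

definition unitary_rep :: "nat \<Rightarrow> (('n::finite \<Rightarrow> 'n) \<Rightarrow> nat \<Rightarrow> nat \<Rightarrow> complex) \<Rightarrow> bool" where
  "unitary_rep d \<rho> \<longleftrightarrow> is_rep d \<rho> \<and>
     (\<forall>\<sigma>. \<sigma> permutes (UNIV::'n set) \<longrightarrow>
        (\<forall>i<d. \<forall>j<d. \<rho> (inv \<sigma>) i j = cnj (\<rho> \<sigma> j i)))"

definition cvecs :: "nat \<Rightarrow> (nat \<Rightarrow> complex) set" where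
  "cvecs d = {v. \<forall>k. k \<ge> d \<longrightarrow> v k = 0}"

definition mat_vec :: "nat \<Rightarrow> (nat \<Rightarrow> nat \<Rightarrow> complex) \<Rightarrow> (nat \<Rightarrow> complex) \<Rightarrow> (nat \<Rightarrow> complex)" where
  "mat_vec d A v = (\<lambda>i. if i < d then (\<Sum>k<d. A i k * v k) else 0)"

definition csubspace_of :: "nat \<Rightarrow> (nat \<Rightarrow> complex) set \<Rightarrow> bool" where
  "csubspace_of d V \<longleftrightarrow> V \<subseteq> cvecs d \<and> (\<lambda>_. 0) \<in> V \<and>
     (\<forall>v\<in>V. \<forall>w\<in>V. (\<lambda>k. v k + w k) \<in> V) \<and> (\<forall>a. \<forall>v\<in>V. (\<lambda>k. a * v k) \<in> V)"

definition irreducible_rep :: "nat \<Rightarrow> (('n::finite \<Rightarrow> 'n) \<Rightarrow> nat \<Rightarrow> nat \<Rightarrow> complex) \<Rightarrow> bool" where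
  "irreducible_rep d \<rho> \<longleftrightarrow> is_rep d \<rho> \<and>
     (\<forall>V. csubspace_of d V \<longrightarrow>
        (\<forall>\<sigma>. \<sigma> permutes (UNIV::'n set) \<longrightarrow> (\<forall>v\<in>V. mat_vec d (\<rho> \<sigma>) v \<in> V)) \<longrightarrow>
        V = {\<lambda>_. 0} \<or> V = cvecs d)"

definition rep_equiv :: "nat \<Rightarrow> (('n::finite \<Rightarrow> 'n) \<Rightarrow> nat \<Rightarrow> nat \<Rightarrow> complex) \<Rightarrow>
                         nat \<Rightarrow> (('n \<Rightarrow> 'n) \<Rightarrow> nat \<Rightarrow> nat \<Rightarrow> complex) \<Rightarrow> bool" where
  "rep_equiv d \<rho> d' \<rho>' \<longleftrightarrow> d = d' \<and>
     (\<exists>A B. (\<forall>i<d. \<forall>j<d. (\<Sum>k<d. A i k * B k j) = (if i = j then 1 else 0)) \<and>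
            (\<forall>i<d. \<forall>j<d. (\<Sum>k<d. B i k * A k j) = (if i = j then 1 else 0)) \<and>
            (\<forall>\<sigma>. \<sigma> permutes (UNIV::'n set) \<longrightarrow>
               (\<forall>i<d. \<forall>j<d. (\<Sum>k<d. A i k * \<rho> \<sigma> k j) = (\<Sum>k<d. \<rho>' \<sigma> i k * A k j))))"

definition partitions :: "nat \<Rightarrow> nat list set" where
  "partitions n = {p. sorted_wrt (\<ge>) p \<and> (\<forall>x\<in>set p. x > 0) \<and> sum_list p = n}"

text \<open>The projection P^{11} associated with a representation (index 1 = entry 0).\<close>
definition P11 :: "nat \<Rightarrow> (('n::finite \<Rightarrow> 'n) \<Rightarrow> nat \<Rightarrow> nat \<Rightarrow> complex) \<Rightarrow>
                   (complex^'n \<Rightarrow> complex) \<Rightarrow> (complex^'n \<Rightarrow> complex)" where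
  "P11 d \<rho> f = (\<lambda>z. of_nat d / of_nat (fact CARD('n)) *
      (\<Sum>\<sigma>\<in>{\<sigma>. \<sigma> permutes (UNIV::'n set)}. \<rho> (inv \<sigma>) 0 0 * f (act (inv \<sigma>) z)))"

text \<open>Polynomials in variables w_1..w_n as finitely supported coefficient functions on multi-indices.\<close>
definition mpolys :: "nat \<Rightarrow> ((nat \<Rightarrow> nat) \<Rightarrow> complex) set" where
  "mpolys n = {c. finite {\<alpha>. c \<alpha> \<noteq> 0} \<and>
                 (\<forall>\<alpha>. c \<alpha> \<noteq> 0 \<longrightarrow> (\<forall>k. k \<notin> {1..n} \<longrightarrow> \<alpha> k = 0))}"

definition mpoly_eval :: "nat \<Rightarrow> ((nat \<Rightarrow> nat) \<Rightarrow> complex) \<Rightarrow> (nat \<Rightarrow> complex) \<Rightarrow> complex" where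
  "mpoly_eval n c w = (\<Sum>\<alpha>\<in>{\<alpha>. c \<alpha> \<noteq> 0}. c \<alpha> * (\<Prod>k=1..n. w k ^ \<alpha> k))"

definition op_monom :: "nat \<Rightarrow> (nat \<Rightarrow> ('x \<Rightarrow> complex) \<Rightarrow> ('x \<Rightarrow> complex)) \<Rightarrow> (nat \<Rightarrow> nat)
                        \<Rightarrow> ('x \<Rightarrow> complex) \<Rightarrow> ('x \<Rightarrow> complex)" where
  "op_monom n T \<alpha> = foldr (\<lambda>k g. (T k ^^ \<alpha> k) \<circ> g) [1..<n+1] id"

definition op_poly :: "nat \<Rightarrow> (nat \<Rightarrow> ('x \<Rightarrow> complex) \<Rightarrow> ('x \<Rightarrow> complex)) \<Rightarrow> ((nat \<Rightarrow> nat) \<Rightarrow> complex)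
                       \<Rightarrow> ('x \<Rightarrow> complex) \<Rightarrow> ('x \<Rightarrow> complex)" where
  "op_poly n T c f = (\<lambda>x. \<Sum>\<alpha>\<in>{\<alpha>. c \<alpha> \<noteq> 0}. c \<alpha> * op_monom n T \<alpha> f x)"

text \<open>Linear operator on a (concrete) space H of functions, closed under the operations.\<close>
definition lin_op_on :: "('x \<Rightarrow> complex) set \<Rightarrow> (('x \<Rightarrow> complex) \<Rightarrow> ('y \<Rightarrow> complex)) \<Rightarrow> bool" where
  "lin_op_on H L \<longleftrightarrow>
     (\<forall>f\<in>H. \<forall>g\<in>H. L (\<lambda>x. f x + g x) = (\<lambda>y. L f y + L g y)) \<and>
     (\<forall>a. \<forall>f\<in>H. L (\<lambda>x. a * f x) = (\<lambda>y. a * L f y))"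

definition gamma_contraction :: "nat \<Rightarrow> (nat \<Rightarrow> complex) set \<Rightarrow> ('x \<Rightarrow> complex) set \<Rightarrow>
      (('x \<Rightarrow> complex) \<Rightarrow> real) \<Rightarrow> (nat \<Rightarrow> ('x \<Rightarrow> complex) \<Rightarrow> ('x \<Rightarrow> complex)) \<Rightarrow> bool" where
  "gamma_contraction n K H N T \<longleftrightarrow>
     (\<forall>k\<in>{1..n}. lin_op_on H (T k) \<and> (\<forall>f\<in>H. T k f \<in> H)) \<and>
     (\<forall>j\<in>{1..n}. \<forall>k\<in>{1..n}. \<forall>f\<in>H. T j (T k f) = T k (T j f)) \<and>
     (\<forall>c\<in>mpolys n. \<forall>f\<in>H.
        N (op_poly n T c f) \<le> (SUP w\<in>K. cmod (mpoly_eval n c w)) * N f)"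

definition unitarily_equiv :: "nat \<Rightarrow> ('x \<Rightarrow> complex) set \<Rightarrow> (('x \<Rightarrow> complex) \<Rightarrow> real) \<Rightarrow>
      (nat \<Rightarrow> ('x \<Rightarrow> complex) \<Rightarrow> ('x \<Rightarrow> complex)) \<Rightarrow>
      ('y \<Rightarrow> complex) set \<Rightarrow> (('y \<Rightarrow> complex) \<Rightarrow> real) \<Rightarrow>
      (nat \<Rightarrow> ('y \<Rightarrow> complex) \<Rightarrow> ('y \<Rightarrow> complex)) \<Rightarrow> bool" where
  "unitarily_equiv n H N T H' N' T' \<longleftrightarrow>
     (\<exists>U. bij_betw U H H' \<and> lin_op_on H U \<and> (\<forall>f\<in>H. N' (U f) = N f) \<and>
          (\<forall>k\<in>{1..n}. \<forall>f\<in>H. U (T k f) = T' k (U f)))"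

end

theory Submission
  imports Defs "HOL-Complex_Analysis.Complex_Analysis" "HOL-Combinatorics.Multiset_Permutations"
begin

text \<open>
  Multiplication by powers of \<open>s\<^sub>n = z\<^sub>1 \<cdots> z\<^sub>n\<close> shifts Taylor exponents, and consecutive monomial weights have
  ratio tending to \<open>1\<close>, so a unitary \<open>U\<close> intertwining the two tuples is also isometric for the Hardy norm,
  whatever \<open>\<lambda>\<close> is. On the Hardy space put \<open>T = P\<^sub>q U P\<^sub>p\<close>. Both \<open>T\<close> and its adjoint commute with
  multiplication by all symmetric polynomials. Testing this on orbit sums of monomials whose exponents run
  off to infinity shows that \<open>T\<close> preserves the span of each orbit of monomials, and that on an orbit with
  distinct exponents it is a fixed linear combination of coordinate permutations. By Schur orthogonality
  such a combination is annihilated by \<open>P\<^sub>q\<close> on the left and \<open>P\<^sub>p\<close> on the right when the representations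
  are inequivalent. As \<open>P\<^sub>p\<close> and \<open>P\<^sub>q\<close> are self-adjoint, this forces \<open>P\<^sub>p z\<^sup>\<alpha> = 0\<close>, which is false for
  distinct exponents. The \<open>\<Gamma>\<^sub>n\<close>-contraction property is the pointwise bound of a polynomial in the
  \<open>s\<^sub>i\<close> by its supremum over \<open>\<Gamma>\<^sub>n\<close>.
\<close>

section \<open>Matrices commuting with orbit sums\<close>

text \<open>Commuting with symmetric multipliers does not by itself tie an operator to orbits:
  multiplication by s_1 commutes with all of them and raises degrees. Its Hardy adjoint does not
  commute with them, and only the two relations together exclude such operators. This is the reason
  for passing to the Hardy norm: there the monomials are orthonormal, so the adjoint has the plain
  conjugate transpose as its coefficient matrix, without ratios of weights, and one set of
  hypotheses can be imposed on a matrix and on its transpose.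

  The unitary U is defined only on the range of P_p, which in general does not contain the
  monomials; the compression T can be evaluated on them. Orbits with distinct exponents are used
  because there the n! permuted monomials are linearly independent. Each coefficient then belongs to
  exactly one permutation, and widely spaced auxiliary exponents transport it from one member of the
  orbit to another.\<close>

abbreviation Perms :: "('n::finite \<Rightarrow> 'n) set" where
  "Perms \<equiv> {\<sigma>. \<sigma> permutes (UNIV::'n set)}"

lemma finite_Perms [simp]: "finite (Perms :: ('n::finite \<Rightarrow> 'n) set)"
  by (rule finite_permutations) simp

lemma id_in_Perms [simp]: "id \<in> Perms"
  by (simp add: permutes_id)

lemma Perms_comp: "\<sigma> \<in> Perms \<Longrightarrow> \<tau> \<in> Perms \<Longrightarrow> \<sigma> \<circ> \<tau> \<in> Perms"
  by (simp add: permutes_compose)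

lemma Perms_inv: "\<sigma> \<in> Perms \<Longrightarrow> inv \<sigma> \<in> Perms"
  by (simp add: permutes_inv)

lemma Perms_bij: "\<sigma> \<in> Perms \<Longrightarrow> bij \<sigma>"
  by (simp add: permutes_bij)

text \<open>Think of \<open>v \<gamma> \<alpha>\<close> as the coefficient of \<open>z\<^sup>\<gamma>\<close> in the image of \<open>z\<^sup>\<alpha>\<close>: then \<open>comm\<close> says that the operator
  commutes with multiplication by the orbit sum of \<open>z\<^sup>\<beta>\<close>.\<close>
locale shift_matrix =
  fixes v :: "('n::finite \<Rightarrow> nat) \<Rightarrow> ('n \<Rightarrow> nat) \<Rightarrow> complex"
  assumes comm: "(\<Sum>\<sigma>\<in>Perms. if \<forall>i. \<beta> (\<sigma> i) \<le> \<gamma> i then v (\<lambda>i. \<gamma> i - \<beta> (\<sigma> i)) \<alpha> else 0)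
                 = (\<Sum>\<sigma>\<in>Perms. v \<gamma> (\<lambda>i. \<alpha> i + \<beta> (\<sigma> i)))"
    and dec: "0 < e \<Longrightarrow> finite {\<gamma>. e < cmod (v \<gamma> \<alpha>)}"
begin

text \<open>For constant \<open>\<beta>\<close> all terms of each sum in \<open>comm\<close> agree:
  the test function is n! times z_1 ... z_n, and multiplication by that product translates exponents
  by the all-one vector.\<close>

lemma shift_one: "v (\<lambda>i. \<gamma> i + 1) (\<lambda>i. \<alpha> i + 1) = v \<gamma> \<alpha>"
proof -
  have "of_nat (card (Perms::('n \<Rightarrow> 'n) set)) * v \<gamma> \<alpha>
      = of_nat (card (Perms::('n \<Rightarrow> 'n) set)) * v (\<lambda>i. \<gamma> i + 1) (\<lambda>i. \<alpha> i + 1)"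
    using comm[of "\<lambda>_. 1" "\<lambda>i. \<gamma> i + 1" \<alpha>] by simp
  moreover have "card (Perms::('n \<Rightarrow> 'n) set) \<noteq> 0"
    using id_in_Perms finite_Perms by (metis card_0_eq empty_iff)
  ultimately show ?thesis by simp
qed

text \<open>The image of s_n z^\<alpha> is s_n times the image of z^\<alpha>, hence divisible by
  every coordinate; accordingly the condition under the left sum of \<open>comm\<close> fails in
  every term.\<close>

lemma zero_one:
  assumes "\<gamma> i = 0" shows "v \<gamma> (\<lambda>i. \<alpha> i + 1) = 0"
proof -
  have "\<not> (\<forall>i. 1 \<le> \<gamma> i)" using assms by (metis not_one_le_zero)
  then have "(\<Sum>\<sigma>\<in>(Perms::('n \<Rightarrow> 'n) set). v \<gamma> (\<lambda>i. \<alpha> i + 1)) = 0"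
    unfolding comm[of "\<lambda>_. 1" \<gamma> \<alpha>, symmetric] by (intro sum.neutral ballI if_not_P)
  then have "of_nat (card (Perms::('n \<Rightarrow> 'n) set)) * v \<gamma> (\<lambda>i. \<alpha> i + 1) = 0"
    by simp
  moreover have "card (Perms::('n \<Rightarrow> 'n) set) \<noteq> 0"
    using id_in_Perms finite_Perms by (metis card_0_eq empty_iff)
  ultimately show ?thesis by simp
qed

text \<open>Removing factors s_n from source and image simultaneously shows that the smallest
  exponent cannot drop.\<close>

lemma zero_below:
  assumes "\<gamma> i < t" "\<And>j. t \<le> \<alpha> j" shows "v \<gamma> \<alpha> = 0"
  using assms
proof (induction t arbitrary: \<gamma> \<alpha>)
  case (Suc t)
  have a: "\<alpha> = (\<lambda>i. (\<alpha> i - 1) + 1)" using Suc.prems(2) by (metis Suc_le_D add.commute diff_Suc_1 plus_1_eq_Suc)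
  show ?case
  proof (cases "\<exists>j. \<gamma> j = 0")
    case True
    then show ?thesis using zero_one a by metis
  next
    case False
    then have g: "\<gamma> = (\<lambda>i. (\<gamma> i - 1) + 1)" by (metis Suc_eq_plus1 Suc_pred' neq0_conv)
    have "t \<le> \<alpha> j - 1" for j using Suc.prems(2)[of j] by simp
    moreover have "\<gamma> i - 1 < t" using Suc.prems(1) False by (metis Suc_pred' less_Suc_eq_0_disj less_imp_diff_less not_gr_zero One_nat_def less_Suc_eq not_less_eq)
    ultimately have "v (\<lambda>i. \<gamma> i - 1) (\<lambda>i. \<alpha> i - 1) = 0"
      by (intro Suc.IH)
    then show ?thesis using shift_one[of "\<lambda>i. \<gamma> i - 1" "\<lambda>i. \<alpha> i - 1"] a g by simp
  qed
qed simp

end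

text \<open>The transpose stands for the Hardy adjoint. Its complex conjugation may be left out
  because the assumptions of \<open>shift_matrix\<close> are stable under conjugation.\<close>

locale orbit_matrix = shift_matrix v + adj: shift_matrix "\<lambda>a b. v b a"
  for v :: "('n::finite \<Rightarrow> nat) \<Rightarrow> ('n \<Rightarrow> nat) \<Rightarrow> complex"
begin

text \<open>With \<open>A = {i. t \<le> \<gamma> i}\<close>, commutation is tested on \<open>\<beta> = L\<close> off \<open>A\<close> and \<open>0\<close> on \<open>A\<close>. As \<open>L\<close> grows, all terms
  except those with \<open>\<beta> \<circ> \<sigma> = \<beta>\<close> decay, while the other side vanishes by comparing smallest exponents.\<close>
lemma card_ge_le:
  assumes "v \<gamma> \<alpha> \<noteq> 0" shows "card {i. t \<le> \<gamma> i} \<le> card {i. t \<le> \<alpha> i}"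
proof (rule ccontr)
  define A where "A = {i. t \<le> \<gamma> i}"
  assume "\<not> ?thesis"
  then have less: "card {i. t \<le> \<alpha> i} < card A" by (simp add: A_def)
  \<comment> \<open>\<open>e\<close> is a decay threshold: outside a finite set of exponents the
    entries of column \<open>\<alpha>\<close> have modulus at most \<open>e\<close>, and
    \<open>L\<close> is chosen beyond that set.\<close>
  have "cmod (v \<gamma> \<alpha>) \<le> of_nat (card (Perms::('n\<Rightarrow>'n) set)) * e" if "e > 0" for e
  proof -
    define F where "F = {\<delta>. e < cmod (v \<delta> \<alpha>)}"
    have "finite F" using dec that by (simp add: F_def)
    then obtain L where L: "t \<le> L" "\<And>\<delta> i. \<delta> \<in> F \<Longrightarrow> \<delta> i < L"
    proof -
      have "finite ((\<lambda>(\<delta>,i). \<delta> i) ` (F \<times> (UNIV::'n set)))" using \<open>finite F\<close> by (intro finite_imageI finite_cartesian_product finite)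
      then obtain m where "\<forall>x\<in>(\<lambda>(\<delta>,i). \<delta> i) ` (F \<times> (UNIV::'n set)). x \<le> m"
        using finite_nat_set_iff_bounded_le by meson
      then show ?thesis using that[of "max t (Suc m)"] by (fastforce simp: less_Suc_eq_le le_max_iff_disj less_max_iff_disj)
    qed
    define \<beta> where "\<beta> i = (if i \<in> A then 0 else L)" for i
    define u where "u \<sigma> = (if \<forall>i. \<beta> (\<sigma> i) \<le> \<gamma> i + \<beta> i then v (\<lambda>i. \<gamma> i + \<beta> i - \<beta> (\<sigma> i)) \<alpha> else 0)" for \<sigma>
    \<comment> \<open>Since \<open>A\<close> has more elements than {i. t \<le> \<alpha> i}, some
      index has \<open>\<sigma> i \<in> A\<close> and \<open>\<alpha> i < t\<close>. There
      \<open>\<beta> (\<sigma> i) = 0\<close>, so the source has an exponent below \<open>t\<close>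
      while the target has none; this is excluded by \<open>zero_below\<close> for the
      transpose.\<close>
    have r0: "v (\<lambda>i. \<gamma> i + \<beta> i) (\<lambda>i. \<alpha> i + \<beta> (\<sigma> i)) = 0" if s: "\<sigma> \<in> Perms" for \<sigma>
    proof -
      have "card (\<sigma> -` A) = card A"
        using s by (metis Perms_bij bij_is_inj bij_is_surj card_vimage_inj top_greatest)
      then have "\<not> \<sigma> -` A \<subseteq> {i. t \<le> \<alpha> i}" using less card_mono[of "{i. t \<le> \<alpha> i}" "\<sigma> -` A"] by auto
      then obtain i where "\<sigma> i \<in> A" "\<not> t \<le> \<alpha> i" by blast
      then show ?thesis using L(1)
        by (intro adj.zero_below[of _ i t]) (auto simp: \<beta>_def A_def)
    qed
    have sum0: "(\<Sum>\<sigma>\<in>Perms. u \<sigma>) = 0"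
      using comm[of \<beta> "\<lambda>i. \<gamma> i + \<beta> i" \<alpha>] r0 unfolding u_def by simp
    define S where "S = {\<sigma>\<in>Perms. \<forall>i. \<beta> (\<sigma> i) = \<beta> i}"
    have uS: "u \<sigma> = v \<gamma> \<alpha>" if "\<sigma> \<in> S" for \<sigma>
      using that by (simp add: u_def S_def)
    have unS: "cmod (u \<sigma>) \<le> e" if "\<sigma> \<in> Perms - S" for \<sigma>
    proof -
      \<comment> \<open>A permutation outside \<open>S\<close> sends some index off \<open>A\<close>
        into \<open>A\<close>; at that index the argument of \<open>v\<close> has exponent
        \<open>\<gamma> i + L\<close>, beyond all of \<open>F\<close>.\<close>
      have "\<exists>i. i \<notin> A \<and> \<sigma> i \<in> A"
      proof (rule ccontr)
        assume "\<nexists>i. i \<notin> A \<and> \<sigma> i \<in> A"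
        then have sub: "\<sigma> -` A \<subseteq> A" by auto
        have "card (\<sigma> -` A) = card A"
          using that by (metis DiffD1 Perms_bij bij_is_inj bij_is_surj card_vimage_inj top_greatest)
        then have "\<sigma> -` A = A" using sub by (simp add: card_subset_eq)
        then have "\<forall>i. \<beta> (\<sigma> i) = \<beta> i" by (auto simp: \<beta>_def)
        then show False using that by (simp add: S_def)
      qed
      then obtain i where i: "i \<notin> A" "\<sigma> i \<in> A" by auto
      then have "(\<lambda>i. \<gamma> i + \<beta> i - \<beta> (\<sigma> i)) \<notin> F" using L(2)[of "\<lambda>i. \<gamma> i + \<beta> i - \<beta> (\<sigma> i)" i] by (auto simp: \<beta>_def)
      then show ?thesis using \<open>e > 0\<close> by (auto simp: u_def F_def)
    qed
    have fS: "finite S" "S \<subseteq> Perms" "id \<in> S" by (auto simp: S_def)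
    have "0 = (\<Sum>\<sigma>\<in>S. u \<sigma>) + (\<Sum>\<sigma>\<in>Perms - S. u \<sigma>)"
      using sum0 sum.subset_diff[OF fS(2) finite_Perms, of u] by (simp add: add.commute)
    then have "of_nat (card S) * v \<gamma> \<alpha> = - (\<Sum>\<sigma>\<in>Perms - S. u \<sigma>)"
      using uS by (simp add: eq_neg_iff_add_eq_0)
    then have "real (card S) * cmod (v \<gamma> \<alpha>) = cmod (\<Sum>\<sigma>\<in>Perms - S. u \<sigma>)"
      by (metis norm_minus_cancel norm_mult norm_of_nat)
    also have "\<dots> \<le> real (card (Perms - S)) * e"
      using unS by (intro order_trans[OF norm_sum] sum_bounded_above) auto
    also have "\<dots> \<le> real (card (Perms::('n\<Rightarrow>'n) set)) * e"
      using \<open>e > 0\<close> by (intro mult_right_mono) (auto intro: card_mono)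
    finally have "real (card S) * cmod (v \<gamma> \<alpha>) \<le> real (card (Perms::('n\<Rightarrow>'n) set)) * e" .
    moreover have "1 * cmod (v \<gamma> \<alpha>) \<le> real (card S) * cmod (v \<gamma> \<alpha>)"
      using fS by (intro mult_right_mono) (auto simp: Suc_le_eq card_gt_0_iff)
    ultimately show ?thesis by simp
  qed
  note * = this
  \<comment> \<open>The choice e = |v \<gamma> \<alpha>| / (2 n!) turns the bound into |v \<gamma>
    \<alpha>| \<le> |v \<gamma> \<alpha>| / 2.\<close>
  have "cmod (v \<gamma> \<alpha>) > 0" using assms by simp
  moreover have c: "card (Perms::('n\<Rightarrow>'n) set) > 0" using id_in_Perms finite_Perms by (metis card_gt_0_iff empty_iff)
  ultimately have "cmod (v \<gamma> \<alpha>) / (2 * real (card (Perms::('n\<Rightarrow>'n) set))) > 0" by simp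
  note ** = *[OF this]
  have "False" if "x \<le> N * (x / (2 * N))" "x > 0" "N > 0" for x N :: real
    using that by (simp add: field_simps)
  from this[OF **] show False using c \<open>cmod (v \<gamma> \<alpha>) > 0\<close> by linarith
qed

end

sublocale orbit_matrix \<subseteq> flip: orbit_matrix "\<lambda>a b. v b a"
  by unfold_locales

context orbit_matrix
begin

text \<open>The matrix and its transpose give opposite inequalities between the sizes of superlevel
  sets, so these agree for every \<open>t\<close>. Their successive differences count how often each
  value occurs, and equal multisets of exponents differ by a permutation.\<close>

lemma support:
  assumes "v \<gamma> \<alpha> \<noteq> 0" obtains \<sigma> where "\<sigma> \<in> Perms" "\<gamma> = \<alpha> \<circ> \<sigma>"
proof -
  have eq: "card {i. t \<le> \<gamma> i} = card {i. t \<le> \<alpha> i}" for t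
    using card_ge_le[OF assms, of t] flip.card_ge_le[of \<gamma> \<alpha> t] assms by simp
  have split: "card {i. t \<le> f i} = card {i. f i = t} + card {i. Suc t \<le> f i}" for t and f :: "'n \<Rightarrow> nat"
  proof -
    have "{i. t \<le> f i} = {i. f i = t} \<union> {i. Suc t \<le> f i}" by auto
    moreover have "card ({i. f i = t} \<union> {i. Suc t \<le> f i}) = card {i. f i = t} + card {i. Suc t \<le> f i}"
      by (rule card_Un_disjoint) auto
    ultimately show ?thesis by simp
  qed
  have "card {i. \<gamma> i = t} = card {i. \<alpha> i = t}" for t
    using split[of t \<gamma>] split[of t \<alpha>] eq by simp
  then have "image_mset \<gamma> (mset_set UNIV) = image_mset \<alpha> (mset_set UNIV)"
    by (intro multiset_eqI) (simp add: count_image_mset' vimage_def Collect_conj_eq eq_commute)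
  then obtain p where "p permutes (UNIV::'n set)" "\<forall>x\<in>UNIV. \<gamma> x = \<alpha> (p x)"
    using image_mset_eq_implies_permutes[of UNIV \<gamma> \<alpha>] by auto
  then show ?thesis using that[of p] by (simp add: fun_eq_iff)
qed

text \<open>Gaps above \<open>K\<close> allow a permutation to be recovered from the permuted
  \<open>\<beta>\<close> even if each entry is known only up to an error \<open>K\<close>.\<close>

definition spaced :: "nat \<Rightarrow> ('n \<Rightarrow> nat) \<Rightarrow> bool" where
  "spaced K \<beta> \<longleftrightarrow> (\<forall>i j. i \<noteq> j \<longrightarrow> \<bar>int (\<beta> i) - int (\<beta> j)\<bar> > int K)"

lemma spaced_perm_eq:
  assumes "spaced K \<beta>" "\<And>i. \<bar>int (\<beta> (\<pi> i)) - int (\<beta> (\<sigma> i))\<bar> \<le> int K"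
  shows "\<pi> = \<sigma>"
  using assms unfolding spaced_def by (metis ext not_less)

text \<open>Adding a spaced \<open>\<beta>\<close> isolates one coefficient. At the exponent
  (\<alpha> + \<beta>) \<circ> \<sigma> each side of \<open>comm\<close> reduces to a single term,
  because \<open>support\<close> confines nonzero entries to orbits and the gaps of
  \<open>\<beta>\<close> then determine the permutation.\<close>

lemma coeff_shift:
  assumes inj: "inj \<alpha>" and K: "\<And>i. \<alpha> i \<le> K" and sp: "spaced K \<beta>" and s: "\<sigma> \<in> Perms"
  shows "v (\<lambda>i. \<alpha> (\<sigma> i) + \<beta> (\<sigma> i)) (\<lambda>i. \<alpha> i + \<beta> i) = v (\<alpha> \<circ> \<sigma>) \<alpha>"
proof -
  let ?g = "\<lambda>i. \<alpha> (\<sigma> i) + \<beta> (\<sigma> i)"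
  let ?u = "\<lambda>\<pi>. if \<forall>i. \<beta> (\<pi> i) \<le> ?g i then v (\<lambda>i. ?g i - \<beta> (\<pi> i)) \<alpha> else 0"
  have "(\<Sum>\<pi>\<in>Perms. ?u \<pi>) = (\<Sum>\<pi>\<in>{\<sigma>}. ?u \<pi>)"
  proof (rule sum.mono_neutral_right)
    show "\<forall>\<pi>\<in>Perms - {\<sigma>}. ?u \<pi> = 0"
    proof (intro ballI, rule ccontr)
      fix \<pi> assume p: "\<pi> \<in> Perms - {\<sigma>}" "?u \<pi> \<noteq> 0"
      then have le: "\<forall>i. \<beta> (\<pi> i) \<le> ?g i" and nz: "v (\<lambda>i. ?g i - \<beta> (\<pi> i)) \<alpha> \<noteq> 0" by (auto split: if_splits)
      from nz obtain \<kappa> where k: "(\<lambda>i. ?g i - \<beta> (\<pi> i)) = \<alpha> \<circ> \<kappa>" by (rule support)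
      have "\<bar>int (\<beta> (\<pi> i)) - int (\<beta> (\<sigma> i))\<bar> \<le> int K" for i
      proof -
        have "?g i - \<beta> (\<pi> i) = \<alpha> (\<kappa> i)" using k by (metis comp_apply)
        then show ?thesis using le[rule_format, of i] K[of "\<sigma> i"] K[of "\<kappa> i"] by linarith
      qed
      then have "\<pi> = \<sigma>" by (rule spaced_perm_eq[OF sp])
      then show False using p by simp
    qed
  qed (use s in auto)
  moreover have "?u \<sigma> = v (\<alpha> \<circ> \<sigma>) \<alpha>" by (simp add: comp_def)
  moreover have "(\<Sum>\<pi>\<in>Perms. v ?g (\<lambda>i. \<alpha> i + \<beta> (\<pi> i))) = (\<Sum>\<pi>\<in>{id}. v ?g (\<lambda>i. \<alpha> i + \<beta> (\<pi> i)))"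
  proof (rule sum.mono_neutral_right)
    show "\<forall>\<pi>\<in>Perms - {id}. v ?g (\<lambda>i. \<alpha> i + \<beta> (\<pi> i)) = 0"
    proof (intro ballI, rule ccontr)
      fix \<pi> assume p: "\<pi> \<in> Perms - {id}" "v ?g (\<lambda>i. \<alpha> i + \<beta> (\<pi> i)) \<noteq> 0"
      \<comment> \<open>The large parts give \<open>\<pi> \<circ> \<kappa> = \<sigma>\<close>. Then
        the small parts agree as well,
        \<open>\<alpha> \<circ> \<sigma> = \<alpha> \<circ> \<kappa>\<close>, and injectivity of
        \<open>\<alpha>\<close> leaves only \<open>\<pi> = id\<close>.\<close>
      from p(2) obtain \<kappa> where k: "\<kappa> \<in> Perms" "?g = (\<lambda>i. \<alpha> i + \<beta> (\<pi> i)) \<circ> \<kappa>" by (rule support)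
      have e: "\<alpha> (\<sigma> i) + \<beta> (\<sigma> i) = \<alpha> (\<kappa> i) + \<beta> (\<pi> (\<kappa> i))" for i using fun_cong[OF k(2), of i] by simp
      have "\<bar>int (\<beta> ((\<pi> \<circ> \<kappa>) i)) - int (\<beta> (\<sigma> i))\<bar> \<le> int K" for i
        using e[of i] K[of "\<sigma> i"] K[of "\<kappa> i"] by (simp add: comp_def)
      then have ps: "\<pi> \<circ> \<kappa> = \<sigma>" by (rule spaced_perm_eq[OF sp])
      then have "\<alpha> (\<sigma> i) = \<alpha> (\<kappa> i)" for i using e[of i] by (simp add: comp_def fun_eq_iff)
      then have "\<sigma> = \<kappa>" using inj by (auto simp: inj_eq)
      then have "\<pi> \<circ> \<kappa> = id \<circ> \<kappa>" using ps by simp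
      then have "\<pi> = id" using k(1) by (metis Perms_bij bij_is_surj comp_assoc comp_id surj_iff)
      then show False using p by simp
    qed
  qed auto
  ultimately show ?thesis using comm[of \<beta> ?g \<alpha>] by simp
qed

text \<open>Two members of an orbit become equal after adding suitable widely spaced exponents.\<close>
lemma coeff_const:
  assumes inj: "inj \<alpha>" and t: "\<tau> \<in> Perms" and s: "\<sigma> \<in> Perms"
  shows "v (\<alpha> \<circ> \<tau> \<circ> \<sigma>) (\<alpha> \<circ> \<tau>) = v (\<alpha> \<circ> \<sigma>) \<alpha>"
proof -
  obtain K where K: "\<And>i. \<alpha> i \<le> K" by (metis finite_nat_set_iff_bounded_le finite UNIV_I image_eqI finite_imageI)
  obtain h :: "'n \<Rightarrow> nat" where h: "inj h"
    using finite_imp_inj_to_nat_seg[of "UNIV::'n set"] by auto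
  \<comment> \<open>\<open>\<beta>'\<close> is made to satisfy \<alpha> \<circ> \<tau> + \<beta>' =
    \<alpha> + \<beta>. It differs from \<open>\<beta>\<close> by at most \<open>K\<close> at each
    index, so gaps above 3 K in \<open>\<beta>\<close> leave gaps above \<open>K\<close> in
    \<open>\<beta>'\<close>. The factor \<open>h i + 1\<close> is at least 1, which keeps
    \<open>\<beta>\<close> above \<open>K\<close> and the natural subtraction exact.\<close>
  define \<beta> where "\<beta> i = (3 * K + 1) * (h i + 1)" for i
  define \<beta>' where "\<beta>' i = \<beta> i + \<alpha> i - \<alpha> (\<tau> i)" for i
  have b0: "\<beta> i \<ge> K" for i by (simp add: \<beta>_def)
  have b: "\<beta>' i + \<alpha> (\<tau> i) = \<beta> i + \<alpha> i" for i using b0[of i] K[of "\<tau> i"] by (simp add: \<beta>'_def)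
  have d: "\<bar>int (\<beta> i) - int (\<beta> j)\<bar> > 3 * int K" if "i \<noteq> j" for i j
  proof -
    have "int (\<beta> i) - int (\<beta> j) = (3 * int K + 1) * (int (h i) - int (h j))"
      by (simp add: \<beta>_def algebra_simps)
    then have "\<bar>int (\<beta> i) - int (\<beta> j)\<bar> = (3 * int K + 1) * \<bar>int (h i) - int (h j)\<bar>"
      by (simp add: abs_mult)
    moreover have "\<bar>int (h i) - int (h j)\<bar> \<ge> 1" using injD[OF h, of i j] that by linarith
    moreover have "(3 * int K + 1) * 1 \<le> (3 * int K + 1) * \<bar>int (h i) - int (h j)\<bar>"
      using calculation(2) by (intro mult_left_mono) auto
    ultimately have "3 * int K + 1 \<le> \<bar>int (\<beta> i) - int (\<beta> j)\<bar>" by (simp only: mult_1_right)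
    then show ?thesis by linarith
  qed
  have sp: "spaced K \<beta>" using d unfolding spaced_def by (metis (no_types, opaque_lifting) le_less_trans mult_le_cancel_right1 not_less of_nat_less_0_iff one_le_numeral order_less_le_trans linorder_le_less_linear)
  have sp': "spaced K \<beta>'" unfolding spaced_def
  proof (intro allI impI)
    fix i j :: 'n assume "i \<noteq> j"
    from d[OF this] b[of i] b[of j] K[of i] K[of j] K[of "\<tau> i"] K[of "\<tau> j"]
    show "int K < \<bar>int (\<beta>' i) - int (\<beta>' j)\<bar>" by linarith
  qed
  have inj': "inj (\<alpha> \<circ> \<tau>)" using inj t by (metis Perms_bij bij_is_inj inj_compose)
  have "v (\<alpha> \<circ> \<tau> \<circ> \<sigma>) (\<alpha> \<circ> \<tau>) = v (\<lambda>i. (\<alpha> \<circ> \<tau>) (\<sigma> i) + \<beta>' (\<sigma> i)) (\<lambda>i. (\<alpha> \<circ> \<tau>) i + \<beta>' i)"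
    using coeff_shift[OF inj' _ sp' s] K by simp
  also have "\<dots> = v (\<lambda>i. \<alpha> (\<sigma> i) + \<beta> (\<sigma> i)) (\<lambda>i. \<alpha> i + \<beta> i)"
    using b by (simp add: add.commute)
  also have "\<dots> = v (\<alpha> \<circ> \<sigma>) \<alpha>" using coeff_shift[OF inj K sp s] .
  finally show ?thesis .
qed

end

section \<open>Schur orthogonality and the projections\<close>

lemma bij_betw_Perms_inv: "bij_betw inv (Perms :: ('n::finite \<Rightarrow> 'n) set) Perms"
  by (rule bij_betw_byWitness[where f' = inv]) (auto simp: Perms_inv permutes_inv_inv permutes_inv)

lemma bij_betw_Perms_left: "\<sigma> \<in> Perms \<Longrightarrow> bij_betw (\<lambda>\<tau>. \<sigma> \<circ> \<tau>) (Perms :: ('n::finite \<Rightarrow> 'n) set) Perms"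
  by (rule bij_betw_byWitness[where f' = "\<lambda>\<tau>. inv \<sigma> \<circ> \<tau>"])
     (auto simp: permutes_compose permutes_inv permutes_inv_o comp_assoc[symmetric])

lemma bij_betw_Perms_right: "\<sigma> \<in> Perms \<Longrightarrow> bij_betw (\<lambda>\<tau>. \<tau> \<circ> \<sigma>) (Perms :: ('n::finite \<Rightarrow> 'n) set) Perms"
  by (rule bij_betw_byWitness[where f' = "\<lambda>\<tau>. \<tau> \<circ> inv \<sigma>"])
     (auto simp: permutes_compose permutes_inv permutes_inv_o comp_assoc)

lemma rep_comp:
  assumes "is_rep d \<rho>" "\<sigma> \<in> Perms" "\<tau> \<in> Perms" "i < d" "j < d"
  shows "\<rho> (\<sigma> \<circ> \<tau>) i j = (\<Sum>k<d. \<rho> \<sigma> i k * \<rho> \<tau> k j)"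
  using assms by (simp add: is_rep_def)

lemma sum_unit: "j < d \<Longrightarrow> (\<Sum>k<(d::nat). f k * (if k = j then 1 else 0 :: complex)) = f j"
  by (subst sum.remove[of _ j]) auto

text \<open>Schur's lemma: kernel and range of \<open>A\<close> are invariant, so one nonzero entry
  forces a trivial kernel and a full range. Then \<open>A\<close> is invertible and would be an
  equivalence of the two representations.\<close>

lemma schur_zero:
  fixes \<rho> \<rho>' :: "('n::finite \<Rightarrow> 'n) \<Rightarrow> nat \<Rightarrow> nat \<Rightarrow> complex"
  assumes irr: "irreducible_rep d \<rho>" and irr': "irreducible_rep d' \<rho>'"
    and ne: "\<not> rep_equiv d \<rho> d' \<rho>'"
    and tw: "\<And>\<sigma> i j. \<sigma> \<in> Perms \<Longrightarrow> i < d' \<Longrightarrow> j < d \<Longrightarrow>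
       (\<Sum>k<d. A i k * \<rho> \<sigma> k j) = (\<Sum>k<d'. \<rho>' \<sigma> i k * A k j)"
    and ij: "i < d'" "j < d"
  shows "A i j = 0"
proof (rule ccontr)
  assume nz: "A i j \<noteq> 0"
  define e where "e j = (\<lambda>k. if k = j then 1 else 0 :: complex)" for j :: nat
  define T where "T v = (\<lambda>i. if i < d' then \<Sum>k<d. A i k * v k else 0)" for v :: "nat \<Rightarrow> complex"
  have e: "e j \<in> cvecs d" if "j < d" for j d using that by (auto simp: e_def cvecs_def)
  have Te: "T (e j) i = A i j" if "i < d'" "j < d" for i j
    using that sum_unit[of j d "A i"] by (simp add: T_def e_def)
  have T0: "T (\<lambda>_. 0) = (\<lambda>_. 0)" by (auto simp: T_def)
  have Tadd: "T (\<lambda>k. v k + w k) = (\<lambda>k. T v k + T w k)" for v w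
    by (auto simp: T_def algebra_simps sum.distrib)
  have Tscale: "T (\<lambda>k. a * v k) = (\<lambda>k. a * T v k)" for a v
    by (auto simp: T_def algebra_simps sum_distrib_left)
  have Tin: "T v \<in> cvecs d'" for v by (auto simp: T_def cvecs_def)
  have Trho: "T (mat_vec d (\<rho> \<sigma>) v) = mat_vec d' (\<rho>' \<sigma>) (T v)" if s: "\<sigma> \<in> Perms" for \<sigma> v
  proof
    fix i
    show "T (mat_vec d (\<rho> \<sigma>) v) i = mat_vec d' (\<rho>' \<sigma>) (T v) i"
    proof (cases "i < d'")
      case True
      have "(\<Sum>k<d. A i k * (\<Sum>m<d. \<rho> \<sigma> k m * v m)) = (\<Sum>m<d. (\<Sum>k<d. A i k * \<rho> \<sigma> k m) * v m)"
        by (simp add: sum_distrib_left sum_distrib_right mult.assoc) (rule sum.swap)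
      also have "\<dots> = (\<Sum>m<d. (\<Sum>k<d'. \<rho>' \<sigma> i k * A k m) * v m)"
        using tw[OF s True] by simp
      also have "\<dots> = (\<Sum>k<d'. \<rho>' \<sigma> i k * (\<Sum>m<d. A k m * v m))"
        by (simp add: sum_distrib_left sum_distrib_right mult.assoc) (rule sum.swap)
      finally show ?thesis using True by (simp add: T_def mat_vec_def)
    qed (simp add: T_def mat_vec_def)
  qed
  have mv_in: "mat_vec d M v \<in> cvecs d" for d M v by (auto simp: mat_vec_def cvecs_def)
  have mv0: "mat_vec d M (\<lambda>_. 0) = (\<lambda>_. 0)" for d M by (auto simp: mat_vec_def)
  define V where "V = {v \<in> cvecs d. T v = (\<lambda>_. 0)}"
  have "csubspace_of d V"
    unfolding csubspace_of_def V_def by (auto simp: Tadd Tscale T0) (auto simp: cvecs_def)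
  moreover have "\<forall>\<sigma>. \<sigma> permutes (UNIV::'n set) \<longrightarrow> (\<forall>v\<in>V. mat_vec d (\<rho> \<sigma>) v \<in> V)"
    by (auto simp: V_def mv_in Trho mv0)
  ultimately have "V = {\<lambda>_. 0} \<or> V = cvecs d" using irr unfolding irreducible_rep_def by blast
  moreover have "V \<noteq> cvecs d"
  proof
    assume "V = cvecs d"
    then have "T (e j) = (\<lambda>_. 0)" using e[OF ij(2)] by (auto simp: V_def)
    then show False using Te[OF ij] nz by simp
  qed
  ultimately have V: "V = {\<lambda>_. 0}" by blast
  define W where "W = T ` cvecs d"
  have "csubspace_of d' W"
    unfolding csubspace_of_def W_def
  proof (intro conjI ballI allI)
    show "T ` cvecs d \<subseteq> cvecs d'" using Tin by blast
    show "(\<lambda>_. 0) \<in> T ` cvecs d" by (rule image_eqI[where x = "\<lambda>_. 0"]) (simp_all add: T0 cvecs_def)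
    fix v w a assume "v \<in> T ` cvecs d" "w \<in> T ` cvecs d"
    then obtain x y where xy: "v = T x" "w = T y" "x \<in> cvecs d" "y \<in> cvecs d" by blast
    show "(\<lambda>k. v k + w k) \<in> T ` cvecs d"
      by (rule image_eqI[where x = "\<lambda>k. x k + y k"]) (use xy Tadd in \<open>auto simp: cvecs_def\<close>)
  next
    fix v a assume "v \<in> T ` cvecs d"
    then obtain x where xy: "v = T x" "x \<in> cvecs d" by blast
    show "(\<lambda>k. a * v k) \<in> T ` cvecs d"
      by (rule image_eqI[where x = "\<lambda>k. a * x k"]) (use xy Tscale in \<open>auto simp: cvecs_def\<close>)
  qed
  moreover have "\<forall>\<sigma>. \<sigma> permutes (UNIV::'n set) \<longrightarrow> (\<forall>v\<in>W. mat_vec d' (\<rho>' \<sigma>) v \<in> W)"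
    by (auto simp: W_def mv_in Trho[symmetric])
  ultimately have "W = {\<lambda>_. 0} \<or> W = cvecs d'" using irr' unfolding irreducible_rep_def by blast
  moreover have "W \<noteq> {\<lambda>_. 0}"
    using e[OF ij(2)] Te[OF ij] nz unfolding W_def by (metis imageI singletonD)
  ultimately have W: "W = cvecs d'" by blast
  have "\<forall>m. \<exists>b. m < d' \<longrightarrow> b \<in> cvecs d \<and> T b = e m"
    using e W unfolding W_def by (metis (no_types, lifting) imageE)
  then obtain b where b: "\<And>m. m < d' \<Longrightarrow> b m \<in> cvecs d \<and> T (b m) = e m" by metis
  define B where "B k m = b m k" for k m
  have AB: "(\<Sum>k<d. A i k * B k m) = (if i = m then 1 else 0)" if "i < d'" "m < d'" for i m
    using b[OF that(2)] that by (auto simp: T_def e_def B_def dest: fun_cong[where x = i])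
  have BA: "(\<Sum>k<d'. B i k * A k m) = (if i = m then 1 else 0)" if im: "i < d" "m < d" for i m
  proof -
    \<comment> \<open>\<open>x\<close> is column \<open>m\<close> of B A - I. From A B = I it
      follows that A B A = A, which puts \<open>x\<close> into the trivial kernel.\<close>
    define x where "x i = (if i < d then (\<Sum>k<d'. B i k * A k m) - e m i else 0)" for i
    have "T x i = 0" for i
    proof (cases "i < d'")
      case True
      have "(\<Sum>k<d. A i k * (\<Sum>l<d'. B k l * A l m)) = (\<Sum>l<d'. (\<Sum>k<d. A i k * B k l) * A l m)"
        by (simp add: sum_distrib_left sum_distrib_right mult.assoc) (rule sum.swap)
      also have "\<dots> = (\<Sum>l<d'. (if i = l then 1 else 0) * A l m)" using AB True by simp
      also have "\<dots> = A i m" using True by (simp add: if_distrib[where f = "\<lambda>x. x * _"] cong: if_cong)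
      finally have 1: "(\<Sum>k<d. A i k * (\<Sum>l<d'. B k l * A l m)) = A i m" .
      have "T x i = (\<Sum>k<d. A i k * (\<Sum>l<d'. B k l * A l m)) - (\<Sum>k<d. A i k * e m k)"
        using True by (simp add: T_def x_def algebra_simps sum_subtractf)
      then show ?thesis using 1 Te[OF True im(2)] True by (simp add: T_def)
    qed (simp add: T_def)
    then have "x \<in> V" by (auto simp: V_def x_def cvecs_def)
    then have "x i = 0" using V by simp
    then show ?thesis using im by (simp add: x_def e_def)
  qed
  \<comment> \<open>The traces of A B and B A coincide, hence so do the degrees.\<close>
  have "(of_nat d' :: complex) = (\<Sum>i<d'. \<Sum>k<d. A i k * B k i)" using AB by simp
  also have "\<dots> = (\<Sum>k<d. \<Sum>i<d'. B k i * A i k)" by (subst sum.swap) (simp add: mult.commute)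
  also have "\<dots> = of_nat d" using BA by simp
  finally have "d' = d" by simp
  then have "rep_equiv d \<rho> d' \<rho>'"
    unfolding rep_equiv_def using AB BA tw by blast
  then show False using ne by blast
qed

text \<open>The matrix \<open>A\<close> is the sum over the group of \<rho>'(\<tau>) E
  \<rho>(\<tau>^-1), where E is the matrix unit at (i, l). Summing over the group makes it an
  intertwiner, and Schur's lemma kills it.\<close>

lemma schur_orthogonality:
  fixes \<rho> \<rho>' :: "('n::finite \<Rightarrow> 'n) \<Rightarrow> nat \<Rightarrow> nat \<Rightarrow> complex"
  assumes irr: "irreducible_rep d \<rho>" and irr': "irreducible_rep d' \<rho>'"
    and ne: "\<not> rep_equiv d \<rho> d' \<rho>'"
    and ij: "i < d'" "j < d'" "k < d" "l < d"
  shows "(\<Sum>\<tau>\<in>Perms. \<rho>' \<tau> j i * \<rho> (inv \<tau>) l k) = 0"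
proof -
  define A where "A j k = (\<Sum>\<tau>\<in>Perms. \<rho>' \<tau> j i * \<rho> (inv \<tau>) l k)" for j k
  have rep: "is_rep d \<rho>" "is_rep d' \<rho>'" using irr irr' by (auto simp: irreducible_rep_def)
  have "A j k = 0"
  proof (rule schur_zero[OF irr irr' ne _ ij(2,3)])
    fix \<sigma> :: "'n \<Rightarrow> 'n" and j m assume s: "\<sigma> \<in> Perms" and jm: "j < d'" "m < d"
    have "(\<Sum>k<d. A j k * \<rho> \<sigma> k m) = (\<Sum>\<tau>\<in>Perms. \<rho>' \<tau> j i * (\<Sum>k<d. \<rho> (inv \<tau>) l k * \<rho> \<sigma> k m))"
      by (simp add: A_def sum_distrib_left sum_distrib_right mult.assoc) (rule sum.swap)
    also have "\<dots> = (\<Sum>\<tau>\<in>Perms. \<rho>' \<tau> j i * \<rho> (inv \<tau> \<circ> \<sigma>) l m)"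
      by (intro sum.cong refl) (use rep_comp[OF rep(1) Perms_inv s ij(4) jm(2)] in simp)
    \<comment> \<open>The substitution \<tau> \<mapsto> \<sigma> \<circ> \<tau> moves
      \<open>\<sigma>\<close> from the right factor to the left one.\<close>
    also have "\<dots> = (\<Sum>\<tau>\<in>Perms. \<rho>' (\<sigma> \<circ> \<tau>) j i * \<rho> (inv (\<sigma> \<circ> \<tau>) \<circ> \<sigma>) l m)"
      by (rule sum.reindex_bij_betw[OF bij_betw_Perms_left[OF s], symmetric])
    also have "\<dots> = (\<Sum>\<tau>\<in>Perms. \<rho>' (\<sigma> \<circ> \<tau>) j i * \<rho> (inv \<tau>) l m)"
    proof (intro sum.cong refl)
      fix \<tau> :: "'n \<Rightarrow> 'n" assume "\<tau> \<in> Perms"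
      then have "inv (\<sigma> \<circ> \<tau>) \<circ> \<sigma> = inv \<tau>"
        using s by (simp add: o_inv_distrib Perms_bij comp_assoc permutes_inv_o)
      then show "\<rho>' (\<sigma> \<circ> \<tau>) j i * \<rho> (inv (\<sigma> \<circ> \<tau>) \<circ> \<sigma>) l m = \<rho>' (\<sigma> \<circ> \<tau>) j i * \<rho> (inv \<tau>) l m" by simp
    qed
    also have "\<dots> = (\<Sum>\<tau>\<in>Perms. (\<Sum>k<d'. \<rho>' \<sigma> j k * \<rho>' \<tau> k i) * \<rho> (inv \<tau>) l m)"
      by (intro sum.cong refl) (use rep_comp[OF rep(2) s _ jm(1) ij(1)] in simp)
    also have "\<dots> = (\<Sum>k<d'. \<rho>' \<sigma> j k * A k m)"
      by (simp add: A_def sum_distrib_left sum_distrib_right mult.assoc) (rule sum.swap)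
    finally show "(\<Sum>k<d. A j k * \<rho> \<sigma> k m) = (\<Sum>k<d'. \<rho>' \<sigma> j k * A k m)" .
  qed
  then show ?thesis by (simp add: A_def)
qed

section \<open>The coordinate action and compositions of two projections\<close>

lemma act_act: "\<sigma> \<in> Perms \<Longrightarrow> \<tau> \<in> Perms \<Longrightarrow> act \<sigma> (act \<tau> z) = act (\<sigma> \<circ> \<tau>) z"
  by (simp add: act_def o_inv_distrib Perms_bij)

lemma act_id [simp]: "act id z = z"
  by (simp add: act_def)

lemma P11_eq:
  "P11 d \<rho> f = (\<lambda>z. of_nat d / of_nat (fact CARD('n)) * (\<Sum>\<tau>\<in>Perms. \<rho> \<tau> 0 0 * f (act \<tau> (z :: complex^'n::finite))))"
  unfolding P11_def
  by (intro ext arg_cong2[where f = "(*)"] refl, rule sum.reindex_bij_betw[OF bij_betw_Perms_inv])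

text \<open>A coordinate permutation stands between the projections because the operator to be
  annihilated is a combination of such permutations. After collecting the coefficient of
  \<open>g (act \<mu> z)\<close>, the entry of \<open>\<rho>\<close> at
  \<open>\<mu> \<circ> inv (\<sigma> \<circ> \<tau>)\<close> expands into entries of
  \<open>\<rho> (inv \<tau>)\<close>, and Schur orthogonality applies to the sum over
  \<open>\<tau>\<close>.\<close>

lemma P11_cross:
  fixes \<rho> \<rho>' :: "('n::finite \<Rightarrow> 'n) \<Rightarrow> nat \<Rightarrow> nat \<Rightarrow> complex"
  assumes irr: "irreducible_rep d \<rho>" and irr': "irreducible_rep d' \<rho>'"
    and ne: "\<not> rep_equiv d \<rho> d' \<rho>'" and s: "\<sigma> \<in> Perms"
  shows "P11 d' \<rho>' (\<lambda>z. P11 d \<rho> g (act \<sigma> z)) z = 0"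
proof -
  define c :: complex where "c = of_nat d / of_nat (fact CARD('n))"
  define c' :: complex where "c' = of_nat d' / of_nat (fact CARD('n))"
  have rep: "is_rep d \<rho>" "is_rep d' \<rho>'" and d: "0 < d" "0 < d'"
    using irr irr' by (auto simp: irreducible_rep_def is_rep_def)
  have key: "(\<Sum>\<tau>\<in>Perms. \<rho>' \<tau> 0 0 * \<rho> (\<mu> \<circ> inv (\<sigma> \<circ> \<tau>)) 0 0) = 0" if m: "\<mu> \<in> Perms" for \<mu>
  proof -
    have "\<rho> (\<mu> \<circ> inv (\<sigma> \<circ> \<tau>)) 0 0 = (\<Sum>l<d. \<Sum>k<d. \<rho> \<mu> 0 l * (\<rho> (inv \<tau>) l k * \<rho> (inv \<sigma>) k 0))"
      if t: "\<tau> \<in> Perms" for \<tau>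
    proof -
      have "inv (\<sigma> \<circ> \<tau>) = inv \<tau> \<circ> inv \<sigma>" using s t by (simp add: o_inv_distrib Perms_bij)
      then show ?thesis
        using rep_comp[OF rep(1) m Perms_comp[OF Perms_inv[OF t] Perms_inv[OF s]] d(1) d(1)]
          rep_comp[OF rep(1) Perms_inv[OF t] Perms_inv[OF s] _ d(1)]
        by (simp add: sum_distrib_left)
    qed
    then have "(\<Sum>\<tau>\<in>Perms. \<rho>' \<tau> 0 0 * \<rho> (\<mu> \<circ> inv (\<sigma> \<circ> \<tau>)) 0 0)
      = (\<Sum>\<tau>\<in>Perms. \<Sum>l<d. \<Sum>k<d. \<rho> \<mu> 0 l * \<rho> (inv \<sigma>) k 0 * (\<rho>' \<tau> 0 0 * \<rho> (inv \<tau>) l k))"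
      by (simp add: sum_distrib_left ac_simps)
    also have "\<dots> = (\<Sum>l<d. \<Sum>\<tau>\<in>Perms. \<Sum>k<d. \<rho> \<mu> 0 l * \<rho> (inv \<sigma>) k 0 * (\<rho>' \<tau> 0 0 * \<rho> (inv \<tau>) l k))"
      by (rule sum.swap)
    also have "\<dots> = (\<Sum>l<d. \<Sum>k<d. \<Sum>\<tau>\<in>Perms. \<rho> \<mu> 0 l * \<rho> (inv \<sigma>) k 0 * (\<rho>' \<tau> 0 0 * \<rho> (inv \<tau>) l k))"
      by (intro sum.cong refl) (rule sum.swap)
    also have "\<dots> = (\<Sum>l<d. \<Sum>k<d. \<rho> \<mu> 0 l * \<rho> (inv \<sigma>) k 0 * (\<Sum>\<tau>\<in>Perms. \<rho>' \<tau> 0 0 * \<rho> (inv \<tau>) l k))"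
      by (simp add: sum_distrib_left)
    also have "\<dots> = 0"
      using schur_orthogonality[OF irr irr' ne d(2) d(2)] by simp
    finally show ?thesis .
  qed
  have "P11 d' \<rho>' (\<lambda>z. P11 d \<rho> g (act \<sigma> z)) z
      = c' * (\<Sum>\<tau>\<in>Perms. \<rho>' \<tau> 0 0 * (c * (\<Sum>\<kappa>\<in>Perms. \<rho> \<kappa> 0 0 * g (act \<kappa> (act \<sigma> (act \<tau> z))))))"
    unfolding P11_eq c_def c'_def by simp
  also have "(\<Sum>\<tau>\<in>Perms. \<rho>' \<tau> 0 0 * (c * (\<Sum>\<kappa>\<in>Perms. \<rho> \<kappa> 0 0 * g (act \<kappa> (act \<sigma> (act \<tau> z))))))
     = (\<Sum>\<tau>\<in>Perms. \<rho>' \<tau> 0 0 * (c * (\<Sum>\<mu>\<in>Perms. \<rho> (\<mu> \<circ> inv (\<sigma> \<circ> \<tau>)) 0 0 * g (act \<mu> z))))"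
  proof (rule sum.cong[OF refl])
    fix \<tau> :: "'n \<Rightarrow> 'n" assume t: "\<tau> \<in> Perms"
    have st: "\<sigma> \<circ> \<tau> \<in> Perms" using s t by (rule Perms_comp)
    have "(\<Sum>\<mu>\<in>Perms. \<rho> (\<mu> \<circ> inv (\<sigma> \<circ> \<tau>)) 0 0 * g (act \<mu> z))
       = (\<Sum>\<kappa>\<in>Perms. \<rho> (\<kappa> \<circ> (\<sigma> \<circ> \<tau>) \<circ> inv (\<sigma> \<circ> \<tau>)) 0 0 * g (act (\<kappa> \<circ> (\<sigma> \<circ> \<tau>)) z))"
      by (rule sum.reindex_bij_betw[OF bij_betw_Perms_right[OF st], symmetric])
    also have "\<dots> = (\<Sum>\<kappa>\<in>Perms. \<rho> \<kappa> 0 0 * g (act \<kappa> (act \<sigma> (act \<tau> z))))"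
    proof (intro sum.cong refl)
      fix \<kappa> :: "'n \<Rightarrow> 'n" assume k: "\<kappa> \<in> Perms"
      have "\<kappa> \<circ> (\<sigma> \<circ> \<tau>) \<circ> inv (\<sigma> \<circ> \<tau>) = \<kappa>" using st
        by (simp only: comp_assoc[of \<kappa>] permutes_inv_o(1)[of "\<sigma> \<circ> \<tau>" UNIV] mem_Collect_eq comp_id)
      then show "\<rho> (\<kappa> \<circ> (\<sigma> \<circ> \<tau>) \<circ> inv (\<sigma> \<circ> \<tau>)) 0 0 * g (act (\<kappa> \<circ> (\<sigma> \<circ> \<tau>)) z)
          = \<rho> \<kappa> 0 0 * g (act \<kappa> (act \<sigma> (act \<tau> z)))"
        using act_act[OF s t] act_act[OF k st] by simp
    qed
    finally show "\<rho>' \<tau> 0 0 * (c * (\<Sum>\<kappa>\<in>Perms. \<rho> \<kappa> 0 0 * g (act \<kappa> (act \<sigma> (act \<tau> z)))))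
       = \<rho>' \<tau> 0 0 * (c * (\<Sum>\<mu>\<in>Perms. \<rho> (\<mu> \<circ> inv (\<sigma> \<circ> \<tau>)) 0 0 * g (act \<mu> z)))" by simp
  qed
  also have "\<dots> = (\<Sum>\<tau>\<in>Perms. \<Sum>\<mu>\<in>Perms. c * g (act \<mu> z) * (\<rho>' \<tau> 0 0 * \<rho> (\<mu> \<circ> inv (\<sigma> \<circ> \<tau>)) 0 0))"
    by (simp add: sum_distrib_left ac_simps)
  also have "\<dots> = (\<Sum>\<mu>\<in>Perms. \<Sum>\<tau>\<in>Perms. c * g (act \<mu> z) * (\<rho>' \<tau> 0 0 * \<rho> (\<mu> \<circ> inv (\<sigma> \<circ> \<tau>)) 0 0))"
    by (rule sum.swap)
  also have "\<dots> = (\<Sum>\<mu>\<in>Perms. c * g (act \<mu> z) * (\<Sum>\<tau>\<in>Perms. \<rho>' \<tau> 0 0 * \<rho> (\<mu> \<circ> inv (\<sigma> \<circ> \<tau>)) 0 0))"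
    by (simp add: sum_distrib_left)
  also have "\<dots> = 0" using key by simp
  finally show ?thesis by simp
qed

lemma unitary_rep_inv00:
  assumes "unitary_rep d \<rho>" "\<tau> \<in> Perms"
  shows "\<rho> (inv \<tau>) 0 0 = cnj (\<rho> \<tau> 0 0)"
  using assms by (auto simp: unitary_rep_def is_rep_def)

text \<open>Along the orbit of one point, \<open>P11\<close> becomes a matrix acting on functions of
  the permutation, and unitarity makes that matrix self-adjoint. The sum of |P F|^2 over the group
  is therefore the pairing of F with P (P F), which vanishes. The argument is finite and
  pointwise.\<close>

lemma P11_square_zero:
  fixes f :: "complex^'n::finite \<Rightarrow> complex"
  assumes uni: "unitary_rep d \<rho>" and zero: "\<And>z. P11 d \<rho> (P11 d \<rho> f) z = 0"
  shows "P11 d \<rho> f z = 0"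
proof -
  define c :: complex where "c = of_nat d / of_nat (fact CARD('n))"
  define P where "P F \<sigma> = c * (\<Sum>\<tau>\<in>Perms. \<rho> \<tau> 0 0 * F (\<tau> \<circ> \<sigma>))" for F :: "('n \<Rightarrow> 'n) \<Rightarrow> complex" and \<sigma>
  have cc: "cnj c = c" by (simp add: c_def)
  have Pact: "P11 d \<rho> h (act \<sigma> z) = P (\<lambda>\<sigma>. h (act \<sigma> z)) \<sigma>" if "\<sigma> \<in> Perms" for h \<sigma>
    unfolding P11_eq P_def c_def using that by (intro arg_cong2[where f = "(*)"] sum.cong refl) (simp add: act_act)
  have adj: "(\<Sum>\<sigma>\<in>Perms. P F \<sigma> * cnj (G \<sigma>)) = (\<Sum>\<sigma>\<in>Perms. F \<sigma> * cnj (P G \<sigma>))" for F G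
  proof -
    have "(\<Sum>\<sigma>\<in>Perms. P F \<sigma> * cnj (G \<sigma>)) = (\<Sum>\<tau>\<in>Perms. c * \<rho> \<tau> 0 0 * (\<Sum>\<sigma>\<in>Perms. F (\<tau> \<circ> \<sigma>) * cnj (G \<sigma>)))"
      by (simp add: P_def sum_distrib_left sum_distrib_right mult.assoc) (rule sum.swap)
    also have "\<dots> = (\<Sum>\<tau>\<in>Perms. c * \<rho> (inv \<tau>) 0 0 * (\<Sum>\<sigma>\<in>Perms. F (inv \<tau> \<circ> \<sigma>) * cnj (G \<sigma>)))"
      by (rule sum.reindex_bij_betw[OF bij_betw_Perms_inv, symmetric])
    also have "\<dots> = (\<Sum>\<tau>\<in>Perms. c * cnj (\<rho> \<tau> 0 0) * (\<Sum>\<sigma>\<in>Perms. F \<sigma> * cnj (G (\<tau> \<circ> \<sigma>))))"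
    proof (rule sum.cong[OF refl])
      fix \<tau> :: "'n \<Rightarrow> 'n" assume t: "\<tau> \<in> Perms"
      have 1: "\<rho> (inv \<tau>) 0 0 = cnj (\<rho> \<tau> 0 0)" by (rule unitary_rep_inv00[OF uni t])
      have "(\<Sum>\<sigma>\<in>Perms. F (inv \<tau> \<circ> \<sigma>) * cnj (G \<sigma>)) = (\<Sum>\<sigma>\<in>Perms. F (inv \<tau> \<circ> (\<tau> \<circ> \<sigma>)) * cnj (G (\<tau> \<circ> \<sigma>)))"
        by (rule sum.reindex_bij_betw[OF bij_betw_Perms_left[OF t], symmetric])
      also have "\<dots> = (\<Sum>\<sigma>\<in>Perms. F \<sigma> * cnj (G (\<tau> \<circ> \<sigma>)))"
        using t by (simp add: comp_assoc[symmetric] permutes_inv_o)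
      finally show "c * \<rho> (inv \<tau>) 0 0 * (\<Sum>\<sigma>\<in>Perms. F (inv \<tau> \<circ> \<sigma>) * cnj (G \<sigma>))
        = c * cnj (\<rho> \<tau> 0 0) * (\<Sum>\<sigma>\<in>Perms. F \<sigma> * cnj (G (\<tau> \<circ> \<sigma>)))" using 1 by simp
    qed
    also have "\<dots> = (\<Sum>\<sigma>\<in>Perms. F \<sigma> * cnj (P G \<sigma>))"
      by (simp add: P_def sum_distrib_left sum_distrib_right ac_simps cc) (rule sum.swap)
    finally show ?thesis .
  qed
  define F where "F \<sigma> = f (act \<sigma> z)" for \<sigma>
  have PF: "P11 d \<rho> f (act \<sigma> z) = P F \<sigma>" if "\<sigma> \<in> Perms" for \<sigma>
    using Pact[OF that, of f] by (simp add: F_def[abs_def])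
  have PPF: "P (P F) \<sigma> = 0" if s: "\<sigma> \<in> Perms" for \<sigma>
  proof -
    have "P (P F) \<sigma> = P (\<lambda>\<sigma>. P11 d \<rho> f (act \<sigma> z)) \<sigma>"
      using s Perms_comp unfolding P_def[of "P F"] P_def[of "\<lambda>\<sigma>. P11 d \<rho> f (act \<sigma> z)"]
      by (intro arg_cong2[where f = "(*)"] sum.cong refl) (simp add: PF permutes_compose)
    then show ?thesis using Pact[OF s, of "P11 d \<rho> f"] zero by simp
  qed
  have "(\<Sum>\<sigma>\<in>Perms. P F \<sigma> * cnj (P F \<sigma>)) = 0" unfolding adj using PPF by simp
  then have "(\<Sum>\<sigma>\<in>Perms. complex_of_real ((cmod (P F \<sigma>))\<^sup>2)) = 0" by (simp only: complex_norm_square)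
  then have "(\<Sum>\<sigma>\<in>Perms. (cmod (P F \<sigma>))\<^sup>2) = 0" by (metis of_real_eq_0_iff of_real_sum)
  then have "(cmod (P F id))\<^sup>2 = 0" by (subst (asm) sum_nonneg_eq_0_iff) (auto simp: permutes_id)
  then show ?thesis using PF[of id] by (simp add: permutes_id)
qed

section \<open>Orbit sums are polynomials in the elementary symmetric functions\<close>

lemma act_nth [simp]: "act \<sigma> z $ i = z $ (inv \<sigma> i)"
  by (simp add: act_def)

lemma esym_0: "esym 0 z = 1"
proof -
  have "{S::'n::finite set. card S = 0} = {{}}" by auto
  then show ?thesis by (simp add: esym_def)
qed

lemma esym_gt: "CARD('n::finite) < k \<Longrightarrow> esym k (z :: complex^'n) = 0"
proof -
  assume "CARD('n) < k"
  then have "{S::'n set. card S = k} = {}" using card_mono[of "UNIV::'n set"] by (auto simp: not_le[symmetric])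
  then show ?thesis by (simp add: esym_def)
qed

text \<open>These sums interpolate between power sums (\<open>k = 0\<close>) and multiples of elementary symmetric functions
  (\<open>a = 0\<close>); the recursion in \<open>a\<close> replaces Newton's identities.\<close>
definition pow_esym :: "nat \<Rightarrow> nat \<Rightarrow> complex^'n::finite \<Rightarrow> complex" where
  "pow_esym a k z = (\<Sum>i\<in>UNIV. \<Sum>A | card A = k \<and> i \<notin> A. z $ i ^ a * (\<Prod>j\<in>A. z $ j))"

text \<open>Double counting: a set of size \<open>k\<close> is met once for each of the n - k
  indices outside it.\<close>

lemma pow_esym_0: "pow_esym 0 k z = of_nat (CARD('n) - k) * esym k (z :: complex^'n::finite)"
proof -
  have "pow_esym 0 k z = (\<Sum>i\<in>UNIV. \<Sum>A | A \<in> {A. card A = k} \<and> i \<notin> A. (\<Prod>j\<in>A. z $ j))"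
    by (simp add: pow_esym_def)
  also have "\<dots> = (\<Sum>A\<in>{A. card A = k}. \<Sum>i | i \<in> UNIV \<and> i \<notin> A. \<Prod>j\<in>A. z $ j)"
    by (rule sum.swap_restrict) auto
  also have "\<dots> = (\<Sum>A\<in>{A. card A = k}. of_nat (CARD('n) - k) * (\<Prod>j\<in>A. z $ j))"
  proof (intro sum.cong refl)
    fix A :: "'n set" assume "A \<in> {A. card A = k}"
    moreover have "{i. i \<in> UNIV \<and> i \<notin> A} = UNIV - A" by auto
    ultimately show "(\<Sum>i | i \<in> UNIV \<and> i \<notin> A. \<Prod>j\<in>A. z $ j) = of_nat (CARD('n) - k) * (\<Prod>j\<in>A. z $ j)"
      by (simp add: card_Diff_subset)
  qed
  finally show ?thesis by (simp add: esym_def sum_distrib_left)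
qed

text \<open>The sets of size k + 1 are split according to whether they contain \<open>i\<close>; if
  they do, the factor z_i joins the power.\<close>

lemma pow_esym_Suc:
  "(\<Sum>i\<in>UNIV. z $ i ^ a) * esym (Suc k) z = pow_esym a (Suc k) z + pow_esym (Suc a) k (z :: complex^'n::finite)"
proof -
  let ?C = "\<lambda>k. {A :: 'n set. card A = k}"
  have "(\<Sum>i\<in>UNIV. z $ i ^ a) * esym (Suc k) z = (\<Sum>i\<in>UNIV. \<Sum>A\<in>?C (Suc k). z $ i ^ a * (\<Prod>j\<in>A. z $ j))"
    by (simp add: esym_def sum_product)
  also have "\<dots> = (\<Sum>i\<in>UNIV. (\<Sum>A | card A = Suc k \<and> i \<notin> A. z $ i ^ a * (\<Prod>j\<in>A. z $ j))
      + (\<Sum>A | card A = k \<and> i \<notin> A. z $ i ^ Suc a * (\<Prod>j\<in>A. z $ j)))"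
  proof (intro sum.cong refl)
    fix i :: 'n
    have "?C (Suc k) = {A. card A = Suc k \<and> i \<notin> A} \<union> {A. card A = Suc k \<and> i \<in> A}" by auto
    then have "(\<Sum>A\<in>?C (Suc k). z $ i ^ a * (\<Prod>j\<in>A. z $ j))
      = (\<Sum>A | card A = Suc k \<and> i \<notin> A. z $ i ^ a * (\<Prod>j\<in>A. z $ j))
      + (\<Sum>A | card A = Suc k \<and> i \<in> A. z $ i ^ a * (\<Prod>j\<in>A. z $ j))"
      by (simp only:) (rule sum.union_disjoint, auto)
    also have "(\<Sum>A | card A = Suc k \<and> i \<in> A. z $ i ^ a * (\<Prod>j\<in>A. z $ j))
      = (\<Sum>A | card A = k \<and> i \<notin> A. z $ i ^ Suc a * (\<Prod>j\<in>A. z $ j))"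
      by (rule sum.reindex_bij_witness[of _ "insert i" "\<lambda>A. A - {i}"])
         (auto simp: insert_absorb prod.remove[of _ i])
    finally show "(\<Sum>A\<in>?C (Suc k). z $ i ^ a * (\<Prod>j\<in>A. z $ j))
      = (\<Sum>A | card A = Suc k \<and> i \<notin> A. z $ i ^ a * (\<Prod>j\<in>A. z $ j))
      + (\<Sum>A | card A = k \<and> i \<notin> A. z $ i ^ Suc a * (\<Prod>j\<in>A. z $ j))" .
  qed
  finally show ?thesis by (simp add: pow_esym_def sum.distrib)
qed

text \<open>The augmented monomial symmetric function: variables are assigned injectively to the
  positions of \<open>as\<close>, and equal exponents produce repeated terms.\<close>

definition lists_sum :: "nat list \<Rightarrow> complex^'n::finite \<Rightarrow> complex" where
  "lists_sum as z = (\<Sum>xs | distinct xs \<and> length xs = length as. \<Prod>j<length as. z $ (xs ! j) ^ (as ! j))"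

lemma finite_distinct_lists: "finite {xs :: 'n::finite list. distinct xs \<and> length xs = k}"
  by (rule finite_subset[OF _ finite_lists_length_eq[of UNIV k]]) auto

text \<open>The index from the power sum is either new, which lengthens the list, or equals the
  index at one position, whose exponent then grows by \<open>a\<close>. Solved for the longer list,
  this reduces list sums to shorter ones.\<close>

lemma lists_sum_Cons:
  "(\<Sum>i\<in>UNIV. z $ i ^ a) * lists_sum as z
    = lists_sum (a # as) z + (\<Sum>j<length as. lists_sum (as[j := as ! j + a]) (z :: complex^'n::finite))"
proof -
  let ?D = "{xs :: 'n list. distinct xs \<and> length xs = length as}"
  let ?m = "\<lambda>as xs. \<Prod>j<length as. z $ (xs ! j) ^ (as ! j)"
  have "(\<Sum>i\<in>UNIV. z $ i ^ a) * lists_sum as z = (\<Sum>xs\<in>?D. \<Sum>i\<in>UNIV. z $ i ^ a * ?m as xs)"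
    by (simp add: lists_sum_def sum_product) (rule sum.swap)
  also have "\<dots> = (\<Sum>xs\<in>?D. (\<Sum>i\<in>- set xs. z $ i ^ a * ?m as xs) + (\<Sum>i\<in>set xs. z $ i ^ a * ?m as xs))"
    by (intro sum.cong refl) (metis (no_types, lifting) Compl_eq_Diff_UNIV finite sum.subset_diff top_greatest)
  also have "\<dots> = (\<Sum>xs\<in>?D. \<Sum>i\<in>- set xs. z $ i ^ a * ?m as xs) + (\<Sum>xs\<in>?D. \<Sum>i\<in>set xs. z $ i ^ a * ?m as xs)"
    by (rule sum.distrib)
  also have "(\<Sum>xs\<in>?D. \<Sum>i\<in>- set xs. z $ i ^ a * ?m as xs) = lists_sum (a # as) z"
  proof -
    have "(\<Sum>xs\<in>?D. \<Sum>i\<in>- set xs. z $ i ^ a * ?m as xs) = (\<Sum>(xs,i)\<in>Sigma ?D (\<lambda>xs. - set xs). z $ i ^ a * ?m as xs)"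
      by (rule sum.Sigma) (auto simp: finite_distinct_lists)
    also have "\<dots> = (\<Sum>ys | distinct ys \<and> length ys = length (a # as). ?m (a # as) ys)"
      by (rule sum.reindex_bij_witness[of _ "\<lambda>ys. (tl ys, hd ys)" "\<lambda>(xs, i). i # xs"])
         (auto simp: length_Suc_conv prod.lessThan_Suc_shift simp del: prod.lessThan_Suc)
    finally show ?thesis by (simp add: lists_sum_def)
  qed
  also have "(\<Sum>xs\<in>?D. \<Sum>i\<in>set xs. z $ i ^ a * ?m as xs) = (\<Sum>xs\<in>?D. \<Sum>j<length as. ?m (as[j := as ! j + a]) xs)"
  proof (intro sum.cong refl)
    fix xs assume xs: "xs \<in> ?D"
    then have "bij_betw ((!) xs) {..<length as} (set xs)" by (intro bij_betw_nth) auto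
    then have "(\<Sum>i\<in>set xs. z $ i ^ a * ?m as xs) = (\<Sum>j<length as. z $ (xs ! j) ^ a * ?m as xs)"
      by (rule sum.reindex_bij_betw[symmetric])
    also have "\<dots> = (\<Sum>j<length as. ?m (as[j := as ! j + a]) xs)"
    proof (intro sum.cong refl)
      fix j assume j: "j \<in> {..<length as}"
      have "?m (as[j := as ! j + a]) xs = z $ (xs ! j) ^ (as ! j + a) * (\<Prod>l\<in>{..<length as} - {j}. z $ (xs ! l) ^ (as ! l))"
        using j by (simp add: prod.remove[of _ j])
      also have "\<dots> = z $ (xs ! j) ^ a * ?m as xs"
        using j by (simp add: prod.remove[of _ j] power_add)
      finally show "z $ (xs ! j) ^ a * ?m as xs = ?m (as[j := as ! j + a]) xs" ..
    qed
    finally show "(\<Sum>i\<in>set xs. z $ i ^ a * ?m as xs) = (\<Sum>j<length as. ?m (as[j := as ! j + a]) xs)" .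
  qed
  also have "\<dots> = (\<Sum>j<length as. lists_sum (as[j := as ! j + a]) z)"
    by (simp add: lists_sum_def) (rule sum.swap)
  finally show ?thesis .
qed

definition orbit_sum :: "('n \<Rightarrow> nat) \<Rightarrow> complex^'n::finite \<Rightarrow> complex" where
  "orbit_sum \<beta> z = (\<Sum>\<sigma>\<in>Perms. \<Prod>i\<in>UNIV. z $ i ^ \<beta> (\<sigma> i))"

text \<open>Permutations correspond to rearrangements of a fixed enumeration \<open>xs0\<close> of
  all indices, and the exponents are read along \<open>xs0\<close>.\<close>

lemma orbit_sum_lists:
  obtains as where "\<And>z :: complex^'n::finite. orbit_sum \<beta> z = lists_sum as z"
proof -
  obtain xs0 :: "'n list" where x0: "set xs0 = UNIV" "distinct xs0" using finite_distinct_list[of "UNIV::'n set"] by auto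
  then have len: "length xs0 = CARD('n)" using distinct_card by force
  let ?D = "{xs :: 'n list. distinct xs \<and> length xs = CARD('n)}"
  have D: "?D = permutations_of_set UNIV"
    by (auto simp: permutations_of_set_def distinct_card[symmetric] intro: card_subset_eq)
       (metis UNIV_I card_subset_eq distinct_card finite top_greatest)
  have inj: "inj_on (\<lambda>\<sigma>. map \<sigma> xs0) (Perms :: ('n \<Rightarrow> 'n) set)"
    by (rule inj_onI) (use x0 in \<open>auto simp: map_eq_conv\<close>)
  have sub: "(\<lambda>\<sigma>. map \<sigma> xs0) ` Perms \<subseteq> ?D"
    using x0 by (auto simp: distinct_map len) (metis permutes_inj inj_on_subset top_greatest)
  have "card ((\<lambda>\<sigma>. map \<sigma> xs0) ` (Perms :: ('n \<Rightarrow> 'n) set)) = card ?D"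
    using card_permutations[of "UNIV::'n set" "CARD('n)"] by (simp add: card_image[OF inj] D)
  then have "(\<lambda>\<sigma>. map \<sigma> xs0) ` Perms = ?D"
    using sub by (intro card_subset_eq finite_distinct_lists)
  then have bij: "bij_betw (\<lambda>\<sigma>. map \<sigma> xs0) (Perms :: ('n \<Rightarrow> 'n) set) ?D"
    using inj by (simp add: bij_betw_def)
  have "orbit_sum \<beta> z = lists_sum (map \<beta> xs0) z" for z
  proof -
    \<comment> \<open>Inverting moves the permutation from the exponents to the variables, where
      \<open>lists_sum\<close> has it.\<close>
    have "orbit_sum \<beta> z = (\<Sum>\<sigma>\<in>Perms. \<Prod>i\<in>UNIV. z $ i ^ \<beta> (inv \<sigma> i))"
      unfolding orbit_sum_def by (rule sum.reindex_bij_betw[OF bij_betw_Perms_inv, symmetric])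
    also have "\<dots> = (\<Sum>\<sigma>\<in>Perms. \<Prod>j<CARD('n). z $ (map \<sigma> xs0 ! j) ^ (map \<beta> xs0 ! j))"
    proof (intro sum.cong refl)
      fix \<sigma> :: "'n \<Rightarrow> 'n" assume s: "\<sigma> \<in> Perms"
      have "(\<Prod>i\<in>UNIV. z $ i ^ \<beta> (inv \<sigma> i)) = (\<Prod>i\<in>UNIV. z $ (\<sigma> i) ^ \<beta> (inv \<sigma> (\<sigma> i)))"
        using s by (intro prod.reindex_bij_betw[symmetric] Perms_bij)
      also have "\<dots> = (\<Prod>i\<in>UNIV. z $ (\<sigma> i) ^ \<beta> i)" using s by (simp add: permutes_inverses)
      also have "\<dots> = (\<Prod>j<CARD('n). z $ (\<sigma> (xs0 ! j)) ^ \<beta> (xs0 ! j))"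
        using x0 len by (intro prod.reindex_bij_betw[symmetric]) (metis bij_betw_nth)
      finally show "(\<Prod>i\<in>UNIV. z $ i ^ \<beta> (inv \<sigma> i)) = (\<Prod>j<CARD('n). z $ (map \<sigma> xs0 ! j) ^ (map \<beta> xs0 ! j))"
        using len by simp
    qed
    also have "\<dots> = (\<Sum>xs\<in>?D. \<Prod>j<CARD('n). z $ (xs ! j) ^ (map \<beta> xs0 ! j))"
      by (rule sum.reindex_bij_betw[OF bij])
    finally show ?thesis by (simp add: lists_sum_def len)
  qed
  then show ?thesis by (rule that)
qed

text \<open>A form of the fundamental theorem on symmetric polynomials, stated by closure:
  \<open>R\<close> will be the set of multipliers compatible with a given operator, which is an
  algebra known to contain the generators.\<close>

lemma symmetric_algebra:
  fixes R :: "(complex^'n::finite \<Rightarrow> complex) set"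
  assumes const: "\<And>c. (\<lambda>_. c) \<in> R"
    and add: "\<And>f g. f \<in> R \<Longrightarrow> g \<in> R \<Longrightarrow> (\<lambda>z. f z + g z) \<in> R"
    and mult: "\<And>f g. f \<in> R \<Longrightarrow> g \<in> R \<Longrightarrow> (\<lambda>z. f z * g z) \<in> R"
    and esym: "\<And>k. k \<in> {1..CARD('n)} \<Longrightarrow> esym k \<in> R"
  shows "orbit_sum \<beta> \<in> R"
proof -
  have diff: "(\<lambda>z. f z - g z) \<in> R" if "f \<in> R" "g \<in> R" for f g
    using add[OF that(1) mult[OF const[of "-1"] that(2)]] by simp
  have sum: "(\<lambda>z. \<Sum>j\<in>J. f j z) \<in> R" if "finite J" "\<And>j. j \<in> J \<Longrightarrow> f j \<in> R" for J :: "nat set" and f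
    using that by (induction J rule: finite_induct) (auto simp: const add)
  have es: "(\<lambda>z. esym k z) \<in> R" for k
  proof (cases "k \<in> {1..CARD('n)}")
    case False
    then have "k = 0 \<or> k > CARD('n)" by auto
    then show ?thesis using const by (auto simp: esym_0 esym_gt)
  qed (use esym in simp)
  have pe: "(\<lambda>z. pow_esym a k z) \<in> R" for a k
  \<comment> \<open>The recursion for \<open>Suc a\<close> at \<open>k\<close> refers to
    \<open>a\<close> at \<open>Suc k\<close>, hence the general \<open>k\<close>.\<close>
  proof (induction a arbitrary: k)
    case 0
    then show ?case by (simp add: pow_esym_0 mult const es)
  next
    case (Suc a)
    have "(\<lambda>z. pow_esym a 0 z * esym (Suc k) z - pow_esym a (Suc k) z) \<in> R"
      by (intro diff mult Suc.IH es)
    moreover have "pow_esym a 0 z = (\<Sum>i\<in>UNIV. z $ i ^ a)" for z :: "complex^'n"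
    proof -
      have "{A::'n set. card A = 0 \<and> i \<notin> A} = {{}}" for i by auto
      then show ?thesis by (simp add: pow_esym_def)
    qed
    ultimately show ?case by (simp add: pow_esym_Suc)
  qed
  have p: "(\<lambda>z. \<Sum>i\<in>UNIV. z $ i ^ a) \<in> R" for a
  proof -
    have "{A::'n set. card A = 0 \<and> i \<notin> A} = {{}}" for i by auto
    then have "pow_esym a 0 = (\<lambda>z :: complex^'n. \<Sum>i\<in>UNIV. z $ i ^ a)" by (auto simp: pow_esym_def)
    then show ?thesis using pe[of a 0] by simp
  qed
  have "(\<lambda>z. lists_sum as z) \<in> R" if "length as = k" for as k
    using that
  proof (induction k arbitrary: as)
    case 0
    then show ?case using const by (simp add: lists_sum_def)
  next
    case (Suc k)
    then obtain a bs where as: "as = a # bs" "length bs = k" by (auto simp: length_Suc_conv)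
    \<comment> \<open>All list sums here have one entry fewer than \<open>as\<close>, so induction
      on the length suffices although the exponents grow.\<close>
    have "(\<lambda>z. (\<Sum>i\<in>UNIV. z $ i ^ a) * lists_sum bs z - (\<Sum>j<length bs. lists_sum (bs[j := bs ! j + a]) z)) \<in> R"
      by (intro diff mult p sum Suc.IH) (auto simp: as)
    then show ?case by (simp add: as lists_sum_Cons)
  qed
  moreover obtain as where "orbit_sum \<beta> = (\<lambda>z :: complex^'n. lists_sum as z)"
    using orbit_sum_lists[of \<beta>] by (metis ext)
  ultimately show ?thesis by metis
qed

section \<open>Taylor expansion on the polydisc\<close>

definition zpow :: "('n \<Rightarrow> nat) \<Rightarrow> complex^'n::finite \<Rightarrow> complex" where
  "zpow \<alpha> z = (\<Prod>i\<in>UNIV. z $ i ^ \<alpha> i)"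

text \<open>Cubes of exponents exhaust all exponents: sums of products factor over them, and each
  finite set lies in some cube, so unordered sums are limits over \<open>N\<close>.\<close>

definition exps :: "nat \<Rightarrow> ('n::finite \<Rightarrow> nat) set" where
  "exps N = {\<alpha>. \<forall>i. \<alpha> i < N}"

lemma exps_PiE: "exps N = PiE UNIV (\<lambda>_. {..<N})"
  by (auto simp: exps_def PiE_def Pi_def)

lemma finite_exps [simp]: "finite (exps N)"
  unfolding exps_PiE by (intro finite_PiE) auto

lemma exps_mono: "M \<le> N \<Longrightarrow> exps M \<subseteq> exps N"
  by (auto simp: exps_def intro: less_le_trans)

lemma finite_subset_exps:
  assumes "finite X" shows "\<exists>N. X \<subseteq> exps N"
proof -
  have "finite ((\<lambda>(\<alpha>,i). \<alpha> i) ` (X \<times> (UNIV::'a set)))"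
    using assms by (intro finite_imageI finite_cartesian_product finite)
  then obtain m where m: "\<forall>x\<in>(\<lambda>(\<alpha>,i). \<alpha> i) ` (X \<times> (UNIV::'a set)). x \<le> m"
    using finite_nat_set_iff_bounded_le by meson
  have "X \<subseteq> exps (Suc m)"
  proof
    fix \<alpha> assume "\<alpha> \<in> X"
    then have "\<alpha> i \<le> m" for i using m by force
    then show "\<alpha> \<in> exps (Suc m)" by (simp add: exps_def less_Suc_eq_le)
  qed
  then show ?thesis ..
qed

lemma exps_filterlim: "filterlim exps (finite_subsets_at_top (UNIV :: ('n::finite \<Rightarrow> nat) set)) sequentially"
  unfolding filterlim_finite_subsets_at_top
proof (intro allI impI)
  fix X :: "('n \<Rightarrow> nat) set" assume "finite X \<and> X \<subseteq> UNIV"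
  then obtain N where "X \<subseteq> exps N" using finite_subset_exps by blast
  then show "\<forall>\<^sub>F y in sequentially. finite (exps y) \<and> X \<subseteq> exps y \<and> exps y \<subseteq> UNIV"
    using exps_mono by (intro eventually_sequentiallyI[of N]) fastforce
qed

lemma has_sum_exps:
  fixes F :: "('n::finite \<Rightarrow> nat) \<Rightarrow> 'a::topological_comm_monoid_add"
  assumes "(F has_sum S) UNIV" shows "(\<lambda>N. \<Sum>\<alpha>\<in>exps N. F \<alpha>) \<longlonglongrightarrow> S"
  using assms exps_filterlim unfolding has_sum_def by (rule filterlim_compose)

lemma exps_bounded_summable:
  fixes F :: "('n::finite \<Rightarrow> nat) \<Rightarrow> real"
  assumes nn: "\<And>\<alpha>. 0 \<le> F \<alpha>" and bd: "\<And>N. (\<Sum>\<alpha>\<in>exps N. F \<alpha>) \<le> C"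
  shows "F summable_on UNIV"
proof (rule nonneg_bdd_above_summable_on)
  show "bdd_above (sum F ` {F. F \<subseteq> UNIV \<and> finite F})"
  proof (rule bdd_aboveI[of _ C])
    fix x assume "x \<in> sum F ` {F. F \<subseteq> UNIV \<and> finite F}"
    then obtain X where X: "x = sum F X" "finite X" by auto
    then obtain N where "X \<subseteq> exps N" using finite_subset_exps by blast
    then have "sum F X \<le> sum F (exps N)" using nn by (intro sum_mono2) auto
    then show "x \<le> C" using bd[of N] X by simp
  qed
qed (use nn in auto)

lemma sum_exps_prod: "(\<Sum>\<alpha>\<in>exps N. \<Prod>i\<in>UNIV. f i (\<alpha> i)) = (\<Prod>i\<in>(UNIV :: 'n::finite set). \<Sum>k<N. f i k :: 'a::comm_semiring_1)"
  unfolding exps_PiE by (subst prod_sum_PiE) auto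

lemma geometric_summable:
  fixes r :: "'n::finite \<Rightarrow> real"
  assumes "\<And>i. 0 \<le> r i" "\<And>i. r i < 1"
  shows "(\<lambda>\<alpha>. \<Prod>i\<in>UNIV. r i ^ \<alpha> i) summable_on UNIV"
proof (rule exps_bounded_summable)
  show "0 \<le> (\<Prod>i\<in>UNIV. r i ^ \<alpha> i)" for \<alpha> using assms by (intro prod_nonneg) auto
  show "(\<Sum>\<alpha>\<in>exps N. \<Prod>i\<in>UNIV. r i ^ \<alpha> i) \<le> (\<Prod>i\<in>UNIV. 1 / (1 - r i))" for N
    unfolding sum_exps_prod[of "\<lambda>i k. r i ^ k"]
  proof (intro prod_mono conjI)
    fix i
    show "0 \<le> (\<Sum>k<N. r i ^ k)" using assms by (intro sum_nonneg) auto
    have "(\<Sum>k<N. r i ^ k) \<le> (\<Sum>k. r i ^ k)" using assms by (intro sum_le_suminf) auto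
    also have "\<dots> = 1 / (1 - r i)" using assms by (intro suminf_geometric) (simp add: abs_less_iff)
    finally show "(\<Sum>k<N. r i ^ k) \<le> 1 / (1 - r i)" .
  qed
qed

lemma zpow_norm: "cmod (zpow \<alpha> z) = (\<Prod>i\<in>UNIV. cmod (z $ i) ^ \<alpha> i)"
  by (simp add: zpow_def prod_norm[symmetric] norm_power)

text \<open>Summation is unordered, so no enumeration of the exponents is chosen. The radius is a
  parameter because coefficients are first found on smaller polydiscs and compared
  afterwards.\<close>

definition taylor_on :: "real \<Rightarrow> (complex^'n::finite \<Rightarrow> complex) \<Rightarrow> (('n \<Rightarrow> nat) \<Rightarrow> complex) \<Rightarrow> bool" where
  "taylor_on R f a \<longleftrightarrow> (\<forall>z. (\<forall>i. cmod (z $ i) < R) \<longrightarrow> ((\<lambda>\<alpha>. a \<alpha> * zpow \<alpha> z) has_sum f z) UNIV)"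

section \<open>Cauchy's formula on circles and tori\<close>

definition wt :: "real \<Rightarrow> real" where
  "wt t = indicator {0..2*pi} t / (2*pi)"

text \<open>With \<zeta> = \<rho> * cis t this is \<zeta> / (\<zeta> - z), written as the value of a
  geometric series in z / \<zeta>. The density \<open>wt\<close> is normalised angle on one period
  and zero elsewhere, so circle integrals become Lebesgue integrals on the line.\<close>

definition kern :: "real \<Rightarrow> complex \<Rightarrow> real \<Rightarrow> complex" where
  "kern \<rho> z t = 1 / (1 - z * cis (-t) / complex_of_real \<rho>)"

lemma wt_nonneg [simp]: "0 \<le> wt t"
  by (simp add: wt_def)

lemma wt_measurable [measurable]: "wt \<in> borel_measurable borel"
  unfolding wt_def by measurable

lemma wt_integrable: "integrable lborel wt"
  unfolding wt_def by (intro integrable_divide) simp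

text \<open>In Cauchy's integral formula the substitution w = \<rho> * cis t has dw = i w dt, which
  changes h(w) / (w - z) dw into i times \<open>kern\<close> times h dt.\<close>

lemma cauchy_circle:
  assumes h: "h holomorphic_on ball 0 1" and r: "0 < \<rho>" "\<rho> < 1" and z: "cmod z < \<rho>"
  shows "(LINT t|lborel. complex_of_real (wt t) * kern \<rho> z t * h (\<rho> * cis t)) = h z"
proof -
  define g where "g t = kern \<rho> z t * h (\<rho> * cis t)" for t
  have ne: "1 - z * cis (-t) / complex_of_real \<rho> \<noteq> 0" for t
  proof
    assume "1 - z * cis (-t) / complex_of_real \<rho> = 0"
    then have "cmod (z * cis (-t) / complex_of_real \<rho>) = 1" by (metis eq_iff_diff_eq_0 norm_one)
    then show False using r z by (simp add: norm_mult norm_divide)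
  qed
  have hc: "continuous_on (ball 0 1) h" using h by (rule holomorphic_on_imp_continuous_on)
  have "continuous_on {0..2*pi} (\<lambda>t. h (\<rho> * cis t))"
    by (rule continuous_on_compose2[OF hc]) (use r in \<open>auto intro!: continuous_intros simp: norm_mult\<close>)
  then have cont: "continuous_on {0..2*pi} g"
    unfolding g_def kern_def using ne r by (intro continuous_intros) auto
  have "((\<lambda>w. h w / (w - z)) has_contour_integral (2 * of_real pi * \<i> * h z)) (circlepath 0 \<rho>)"
  proof (rule Cauchy_integral_circlepath)
    have "cball 0 \<rho> \<subseteq> ball (0::complex) 1" using r by auto
    then show "continuous_on (cball 0 \<rho>) h" using hc continuous_on_subset by blast
    have "ball 0 \<rho> \<subseteq> ball (0::complex) 1" using r by auto
    then show "h holomorphic_on ball 0 \<rho>" using h holomorphic_on_subset by blast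
    show "cmod (z - 0) < \<rho>" using z by simp
  qed
  then have "((\<lambda>t. h (0 + \<rho> * cis t) / (0 + \<rho> * cis t - z) * \<rho> * \<i> * cis t) has_integral (2 * of_real pi * \<i> * h z)) {0..2*pi}"
    unfolding circlepath_def by (subst (asm) has_contour_integral_part_circlepath_iff) auto
  moreover have "h (0 + \<rho> * cis t) / (0 + \<rho> * cis t - z) * \<rho> * \<i> * cis t = \<i> * g t" for t
  proof -
    have "\<rho> * cis t - z = \<rho> * cis t * (1 - z * cis (-t) / complex_of_real \<rho>)"
      using r by (simp add: algebra_simps cis_mult)
    moreover have "\<rho> * cis t \<noteq> 0" using r by simp
    ultimately show ?thesis using ne[of t] r
      by (simp add: g_def kern_def divide_simps) 
  qed
  ultimately have "((\<lambda>t. \<i> * g t) has_integral (2 * of_real pi * \<i> * h z)) {0..2*pi}" by simp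
  then have "((\<lambda>t. 1 / (2 * of_real pi * \<i>) * (\<i> * g t)) has_integral (1 / (2 * of_real pi * \<i>) * (2 * of_real pi * \<i> * h z))) {0..2*pi}"
    by (rule has_integral_mult_right)
  then have "((\<lambda>t. g t / (2 * of_real pi)) has_integral h z) {0..2*pi}" by simp
  then have "integral {0..2*pi} (\<lambda>t. g t / (2 * of_real pi)) = h z" by (rule integral_unique)
  moreover have "set_integrable lborel {0..2*pi} (\<lambda>t. g t / (2 * of_real pi))"
    by (intro borel_integrable_atLeastAtMost' continuous_intros cont) auto
  ultimately have "(LINT t:{0..2*pi}|lborel. g t / (2 * of_real pi)) = h z"
    by (simp add: set_borel_integral_eq_integral(2))
  then show ?thesis
    unfolding set_lebesgue_integral_def
    by (simp add: g_def wt_def scaleR_conv_of_real mult.assoc)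
qed

lemma kern_bound:
  assumes "0 < \<rho>" "cmod z < \<rho>" shows "cmod (kern \<rho> z t) \<le> 1 / (1 - cmod z / \<rho>)"
proof -
  have "1 - cmod z / \<rho> = cmod 1 - cmod (z * cis (-t) / complex_of_real \<rho>)"
    using assms by (simp add: norm_mult norm_divide)
  also have "\<dots> \<le> cmod (1 - z * cis (-t) / complex_of_real \<rho>)" by (rule norm_triangle_ineq2)
  finally have *: "1 - cmod z / \<rho> \<le> cmod (1 - z * cis (-t) / complex_of_real \<rho>)" .
  have "0 < 1 - cmod z / \<rho>" using assms by simp
  with * show ?thesis unfolding kern_def norm_divide norm_one
    by (intro divide_left_mono) (auto intro!: mult_pos_pos)
qed

lemma kern_measurable [measurable]: "kern \<rho> z \<in> borel_measurable borel"
proof -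
  have [measurable]: "(\<lambda>t. cis (-t)) \<in> borel_measurable borel"
    by (intro borel_measurable_continuous_onI continuous_intros)
  show ?thesis unfolding kern_def by measurable
qed

lemma vec_lambda_measurable [measurable (raw)]:
  fixes g :: "'n::finite \<Rightarrow> 'b \<Rightarrow> 'a::euclidean_space"
  assumes "\<And>i. g i \<in> borel_measurable M"
  shows "(\<lambda>x. \<chi> i. g i x) \<in> borel_measurable M"
proof (subst borel_measurable_euclidean_space, intro ballI)
  fix b :: "'a^'n" assume "b \<in> Basis"
  then obtain i c where b: "b = axis i c" "c \<in> Basis" by (auto simp: Basis_vec_def)
  have "(\<lambda>x. (\<chi> i. g i x) \<bullet> b) = (\<lambda>x. g i x \<bullet> c)" by (simp add: b inner_axis)
  then show "(\<lambda>x. (\<chi> i. g i x) \<bullet> b) \<in> borel_measurable M" using assms by simp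
qed

lemma open_polydisc: "open (polydisc :: (complex^'n::finite) set)"
proof -
  have eq: "polydisc = (\<Inter>i. {z :: complex^'n. cmod (z $ i) < 1})" by (auto simp: polydisc_def)
  show ?thesis unfolding eq by (intro open_INT ballI open_Collect_less continuous_intros) auto
qed

lemma holo_continuous: "holo_on f polydisc \<Longrightarrow> continuous_on polydisc f"
  unfolding holo_on_def by (blast intro: continuous_at_imp_continuous_on has_derivative_continuous)

lemma holo_measurable:
  assumes "holo_on f polydisc" "\<And>z. z \<notin> polydisc \<Longrightarrow> f z = 0"
  shows "f \<in> borel_measurable borel"
proof -
  have "(\<lambda>z. indicator polydisc z *\<^sub>R f z) \<in> borel_measurable borel"
    by (intro borel_measurable_continuous_on_indicator holo_continuous assms(1)) (simp add: open_polydisc)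
  moreover have "(\<lambda>z. indicator polydisc z *\<^sub>R f z) = f" using assms(2) by (auto simp: indicator_def)
  ultimately show ?thesis by simp
qed

lemma holo_bounded:
  fixes f :: "complex^'n::finite \<Rightarrow> complex"
  assumes "holo_on f polydisc" "r < 1"
  obtains M where "0 \<le> M" "\<And>z. (\<And>i. cmod (z $ i) \<le> r) \<Longrightarrow> cmod (f z) \<le> M"
proof -
  let ?K = "{z :: complex^'n. \<forall>i. cmod (z $ i) \<le> r}"
  have "?K = (\<Inter>i. {z. cmod (z $ i) \<le> r})" by auto
  moreover have "closed {z :: complex^'n. cmod (z $ i) \<le> r}" for i
    by (intro closed_Collect_le continuous_intros)
  ultimately have "closed ?K" by (auto intro!: closed_INT)
  moreover have "bounded ?K"
  proof (rule boundedI)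
    fix z assume z: "z \<in> ?K"
    have "norm z \<le> (\<Sum>i\<in>UNIV. norm (z $ i))" by (simp add: norm_vec_def L2_set_le_sum)
    also have "\<dots> \<le> (\<Sum>i\<in>(UNIV::'n set). r)" using z by (intro sum_mono) auto
    finally show "norm z \<le> (\<Sum>i\<in>(UNIV::'n set). r)" .
  qed
  ultimately have "compact ?K" by (simp add: compact_eq_bounded_closed)
  moreover have "?K \<subseteq> polydisc" using assms(2) by (auto simp: polydisc_def intro: le_less_trans)
  ultimately have "compact (f ` ?K)" using holo_continuous[OF assms(1)]
    by (meson compact_continuous_image continuous_on_subset)
  then obtain M where M: "\<And>x. x \<in> f ` ?K \<Longrightarrow> norm x \<le> M"
    using compact_imp_bounded bounded_iff by metis
  show ?thesis by (rule that[of "max M 0"]) (use M in \<open>auto simp: le_max_iff_disj\<close>)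
qed

lemma holo_slice:
  fixes f :: "complex^'n::finite \<Rightarrow> complex"
  assumes f: "holo_on f polydisc" and w: "\<And>i. i \<noteq> j \<Longrightarrow> cmod (w i) < 1"
  shows "(\<lambda>t. f (\<chi> i. if i = j then t else w i)) holomorphic_on ball 0 1"
  unfolding holomorphic_on_def
proof
  fix t :: complex assume t: "t \<in> ball 0 1"
  let ?g = "\<lambda>t. (\<chi> i. if i = j then t else w i) :: complex^'n"
  have "?g t \<in> polydisc" using t w by (auto simp: polydisc_def)
  then obtain c :: "complex^'n" where c: "(f has_derivative (\<lambda>h. \<Sum>i\<in>UNIV. c$i * h$i)) (at (?g t))"
    using f unfolding holo_on_def by blast
  have "(?g has_derivative (\<lambda>h. axis j h)) (at t within ball 0 1)"
  proof -
    have "?g = (\<lambda>t. ?g 0 + axis j t)" by (auto simp: vec_eq_iff axis_def)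
    moreover have "linear (\<lambda>h :: complex. axis j h :: complex^'n)" 
      by (rule linearI) (auto simp: vec_eq_iff axis_def)
    then have "bounded_linear (\<lambda>h :: complex. axis j h :: complex^'n)" by (simp add: linear_conv_bounded_linear)
    then have "((\<lambda>t. ?g 0 + axis j t) has_derivative (\<lambda>h. 0 + axis j h)) (at t within ball 0 1)"
      by (intro has_derivative_add has_derivative_const bounded_linear_imp_has_derivative)
    ultimately show ?thesis by simp
  qed
  from has_derivative_in_compose[OF this has_derivative_at_withinI[OF c]]
  have "((\<lambda>t. f (?g t)) has_derivative (\<lambda>h. \<Sum>i\<in>UNIV. c$i * axis j h $ i)) (at t within ball 0 1)" .
  moreover have "(\<lambda>h. \<Sum>i\<in>UNIV. c$i * axis j h $ i) = (*) (c $ j)"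
    by (auto simp: axis_def if_distrib[where f = "\<lambda>x. _ * x"] cong: if_cong)
  ultimately show "(\<lambda>t. f (?g t)) field_differentiable at t within ball 0 1"
    unfolding field_differentiable_def has_field_derivative_def by metis
qed

interpretation lb: product_sigma_finite "\<lambda>_. lborel :: 'a::euclidean_space measure"
  by standard

lemma integrable_weighted:
  fixes F :: "('n \<Rightarrow> 'b::euclidean_space) \<Rightarrow> complex" and u :: "'b \<Rightarrow> real"
  assumes I: "finite I" and u: "integrable lborel u" "\<And>t. 0 \<le> u t"
    and F: "F \<in> borel_measurable (Pi\<^sub>M I (\<lambda>_. lborel))" "\<And>x. cmod (F x) \<le> C"
  shows "integrable (Pi\<^sub>M I (\<lambda>_. lborel)) (\<lambda>x. complex_of_real (\<Prod>i\<in>I. u (x i)) * F x)"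
proof (rule Bochner_Integration.integrable_bound)
  show "integrable (Pi\<^sub>M I (\<lambda>_. lborel)) (\<lambda>x. C * (\<Prod>i\<in>I. u (x i)))"
    using lb.product_integrable_prod[OF I u(1)] by (rule integrable_mult_right)
  have "(\<lambda>x. \<Prod>i\<in>I. u (x i)) \<in> borel_measurable (Pi\<^sub>M I (\<lambda>_. lborel))"
    using lb.product_integrable_prod[OF I u(1)] by (rule borel_measurable_integrable)
  then show "(\<lambda>x. complex_of_real (\<Prod>i\<in>I. u (x i)) * F x) \<in> borel_measurable (Pi\<^sub>M I (\<lambda>_. lborel))"
    using F(1) by measurable
  have "C \<ge> 0" using F(2)[of undefined] norm_ge_zero order_trans by blast
  then show "AE x in Pi\<^sub>M I (\<lambda>_. lborel). norm (complex_of_real (\<Prod>i\<in>I. u (x i)) * F x) \<le> norm (C * (\<Prod>i\<in>I. u (x i)))"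
    using F(2) by (intro AE_I2) (auto simp: norm_mult abs_mult mult.commute simp del: of_real_prod intro!: mult_mono)
qed

text \<open>One coordinate is integrated at a time. Coordinates outside \<open>I\<close> are frozen
  at \<open>w\<close>, and \<open>w\<close> is arbitrary so that the induction step can replace
  \<open>w j\<close> by \<open>z j\<close>.\<close>

lemma cauchy_polydisc:
  fixes f :: "complex^'n::finite \<Rightarrow> complex"
  assumes f: "holo_on f polydisc" "\<And>z. z \<notin> polydisc \<Longrightarrow> f z = 0"
    and r: "0 < \<rho>" "\<rho> < 1" and z: "\<And>i. cmod (z i) < \<rho>" and I: "finite I"
    and w: "\<And>i. cmod (w i) < 1"
  shows "(LINT x|Pi\<^sub>M I (\<lambda>_. lborel). complex_of_real (\<Prod>i\<in>I. wt (x i)) * ((\<Prod>i\<in>I. kern \<rho> (z i) (x i)) *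
      f (\<chi> i. if i \<in> I then \<rho> * cis (x i) else w i))) = f (\<chi> i. if i \<in> I then z i else w i)"
  using I w
proof (induction I arbitrary: w rule: finite_induct)
  case empty
  \<comment> \<open>The product over no coordinates is one point of mass 1.\<close>
  interpret finite_measure "Pi\<^sub>M {} (\<lambda>_::'n. lborel :: real measure)" by rule (simp add: space_PiM)
  show ?case by (simp add: space_PiM measure_def)
next
  case (insert j I)
  have [measurable]: "f \<in> borel_measurable borel" using holo_measurable[OF f] .
  have [measurable]: "cis \<in> borel_measurable borel"
    by (intro borel_measurable_continuous_onI continuous_intros)
  let ?G = "\<lambda>x. (\<Prod>i\<in>insert j I. kern \<rho> (z i) (x i)) * f (\<chi> i. if i \<in> insert j I then \<rho> * cis (x i) else w i)"
  have meas: "?G \<in> borel_measurable (Pi\<^sub>M (insert j I) (\<lambda>_. lborel))"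
  proof -
    have comp: "(\<lambda>x. x i) \<in> borel_measurable (Pi\<^sub>M (insert j I) (\<lambda>_. lborel :: real measure))" if "i \<in> insert j I" for i
      using measurable_component_singleton[OF that, of "\<lambda>_. lborel :: real measure"] by simp
    have "(\<lambda>x. if i \<in> insert j I then \<rho> * cis (x i) else w i) \<in> borel_measurable (Pi\<^sub>M (insert j I) (\<lambda>_. lborel))" for i
    proof (cases "i \<in> insert j I")
      case True
      have "(\<lambda>x. \<rho> * cis (x i)) \<in> borel_measurable (Pi\<^sub>M (insert j I) (\<lambda>_. lborel :: real measure))"
        using comp[OF True] by measurable
      then show ?thesis using True by simp
    next
      case False
      then show ?thesis by simp
    qed
    then have [measurable]: "(\<lambda>x. \<chi> i. if i \<in> insert j I then \<rho> * cis (x i) else w i) \<in> borel_measurable (Pi\<^sub>M (insert j I) (\<lambda>_. lborel))"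
      by (rule vec_lambda_measurable)
    have "(\<lambda>x. \<Prod>i\<in>insert j I. kern \<rho> (z i) (x i)) \<in> borel_measurable (Pi\<^sub>M (insert j I) (\<lambda>_. lborel :: real measure))"
      by (rule borel_measurable_prod) (rule measurable_compose[OF comp kern_measurable])
    then show ?thesis by measurable
  qed
  \<comment> \<open>A radius below 1 that covers both the circle and all frozen coordinates; on that
    closed polydisc \<open>f\<close> is bounded, which gives the integrability needed for
    Fubini.\<close>
  obtain m where m: "m < 1" "\<rho> \<le> m" "\<And>i. cmod (w i) \<le> m"
  proof
    let ?S = "insert \<rho> (range (\<lambda>i. cmod (w i)))"
    show "Max ?S < 1" using r insert.prems by (subst Max_less_iff) auto
    show "\<rho> \<le> Max ?S" by (rule Max_ge) auto
    show "cmod (w i) \<le> Max ?S" for i by (rule Max_ge) auto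
  qed
  obtain M where M: "0 \<le> M" "\<And>z. (\<And>i. cmod (z $ i) \<le> m) \<Longrightarrow> cmod (f z) \<le> M"
    using holo_bounded[OF f(1) m(1)] by blast
  have bound: "cmod (?G x) \<le> (\<Prod>i\<in>insert j I. 1 / (1 - cmod (z i) / \<rho>)) * M" for x
    unfolding norm_mult
  proof (intro mult_mono)
    show "cmod (\<Prod>i\<in>insert j I. kern \<rho> (z i) (x i)) \<le> (\<Prod>i\<in>insert j I. 1 / (1 - cmod (z i) / \<rho>))"
      unfolding prod_norm[symmetric] by (intro prod_mono) (use r z kern_bound in auto)
    show "cmod (f (\<chi> i. if i \<in> insert j I then \<rho> * cis (x i) else w i)) \<le> M"
      by (rule M) (use r m in \<open>auto simp: norm_mult\<close>)
    show "0 \<le> (\<Prod>i\<in>insert j I. 1 / (1 - cmod (z i) / \<rho>))"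
      using r z by (intro prod_nonneg) (auto simp: less_imp_le)
  qed auto
  have "(LINT x|Pi\<^sub>M (insert j I) (\<lambda>_. lborel). complex_of_real (\<Prod>i\<in>insert j I. wt (x i)) * ?G x)
     = (LINT x|Pi\<^sub>M I (\<lambda>_. lborel). LINT y|lborel. complex_of_real (\<Prod>i\<in>insert j I. wt ((x(j := y)) i)) * ?G (x(j := y)))"
    by (rule lb.product_integral_insert[OF insert.hyps(1,2) integrable_weighted[OF _ wt_integrable wt_nonneg meas bound]])
       (simp add: insert.hyps)
  also have "\<dots> = (LINT x|Pi\<^sub>M I (\<lambda>_. lborel). complex_of_real (\<Prod>i\<in>I. wt (x i)) * ((\<Prod>i\<in>I. kern \<rho> (z i) (x i)) *
      f (\<chi> i. if i \<in> I then \<rho> * cis (x i) else (w(j := z j)) i)))"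
  proof (intro Bochner_Integration.integral_cong refl)
    fix x :: "'n \<Rightarrow> real"
    define v where "v i = (if i \<in> I then \<rho> * cis (x i) else w i)" for i
    define h where "h t = f (\<chi> i. if i = j then t else v i)" for t
    have h: "h holomorphic_on ball 0 1"
      unfolding h_def by (rule holo_slice[OF f(1)]) (use r insert.prems in \<open>auto simp: v_def norm_mult\<close>)
    have p: "(\<Prod>i\<in>insert j I. k i ((x(j := y)) i)) = k j y * (\<Prod>i\<in>I. k i (x i))" for y :: real and k :: "'n \<Rightarrow> real \<Rightarrow> 'c::comm_monoid_mult"
      using insert.hyps by (auto intro!: arg_cong2[where f = "(*)"] prod.cong)
    have "complex_of_real (\<Prod>i\<in>insert j I. wt ((x(j := y)) i)) * ?G (x(j := y))
       = (complex_of_real (\<Prod>i\<in>I. wt (x i)) * (\<Prod>i\<in>I. kern \<rho> (z i) (x i))) *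
          (complex_of_real (wt y) * kern \<rho> (z j) y * h (\<rho> * cis y))" for y
    proof -
      have "(\<chi> i. if i \<in> insert j I then complex_of_real \<rho> * cis ((x(j := y)) i) else w i) = (\<chi> i. if i = j then \<rho> * cis y else v i)"
        by (auto simp: vec_eq_iff v_def)
      then show ?thesis unfolding p[of "\<lambda>i. wt"] p[of "\<lambda>i. kern \<rho> (z i)"] h_def by simp
    qed
    then have "(LINT y|lborel. complex_of_real (\<Prod>i\<in>insert j I. wt ((x(j := y)) i)) * ?G (x(j := y)))
       = (complex_of_real (\<Prod>i\<in>I. wt (x i)) * (\<Prod>i\<in>I. kern \<rho> (z i) (x i))) *
          (LINT y|lborel. complex_of_real (wt y) * kern \<rho> (z j) y * h (\<rho> * cis y))"
      by (simp del: prod.insert)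
    also have "(LINT y|lborel. complex_of_real (wt y) * kern \<rho> (z j) y * h (\<rho> * cis y)) = h (z j)"
      by (rule cauchy_circle[OF h r z])
    also have "h (z j) = f (\<chi> i. if i \<in> I then \<rho> * cis (x i) else (w(j := z j)) i)"
      unfolding h_def v_def using insert.hyps by (intro arg_cong[where f = f]) (auto simp: vec_eq_iff)
    finally show "(LINT y|lborel. complex_of_real (\<Prod>i\<in>insert j I. wt ((x(j := y)) i)) * ?G (x(j := y)))
      = complex_of_real (\<Prod>i\<in>I. wt (x i)) * ((\<Prod>i\<in>I. kern \<rho> (z i) (x i)) *
      f (\<chi> i. if i \<in> I then \<rho> * cis (x i) else (w(j := z j)) i))" by simp
  qed
  also have "\<dots> = f (\<chi> i. if i \<in> I then z i else (w(j := z j)) i)"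
    by (rule insert.IH) (use insert.prems z r in \<open>auto intro: less_trans\<close>)
  also have "(\<chi> i. if i \<in> I then z i else (w(j := z j)) i) = (\<chi> i. if i \<in> insert j I then z i else w i)"
    by (auto simp: vec_eq_iff)
  finally show ?case .
qed

lemma component_measurable:
  fixes g :: "'b::euclidean_space \<Rightarrow> 'c::euclidean_space"
  assumes "g \<in> borel_measurable borel" "i \<in> I"
  shows "(\<lambda>x. g (x i)) \<in> borel_measurable (Pi\<^sub>M I (\<lambda>_. lborel))"
proof -
  have "(\<lambda>x. x i) \<in> borel_measurable (Pi\<^sub>M I (\<lambda>_. lborel :: 'b measure))"
    using measurable_component_singleton[OF assms(2), of "\<lambda>_. lborel :: 'b measure"] by simp
  then show ?thesis using assms(1) by (rule measurable_compose)
qed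

lemma cis_measurable [measurable]: "cis \<in> borel_measurable borel"
  by (intro borel_measurable_continuous_onI continuous_intros)

lemma cnj_measurable [measurable]: "cnj \<in> borel_measurable borel"
  by (intro borel_measurable_continuous_onI continuous_intros)

text \<open>Convergence along cubes only identifies the value of the sum; unordered summability
  comes from the dominating family \<open>G\<close>.\<close>

lemma abs_summable_exps_limit:
  fixes F :: "('n::finite \<Rightarrow> nat) \<Rightarrow> complex"
  assumes "\<And>\<alpha>. cmod (F \<alpha>) \<le> G \<alpha>" "G summable_on UNIV" "(\<lambda>N. \<Sum>\<alpha>\<in>exps N. F \<alpha>) \<longlonglongrightarrow> S"
  shows "(F has_sum S) UNIV"
proof -
  have "F summable_on UNIV"
    using summable_on_comparison_test[OF assms(2), of "\<lambda>\<alpha>. cmod (F \<alpha>)"] assms(1)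
    by (metis abs_summable_summable norm_ge_zero)
  then have "(F has_sum infsum F UNIV) UNIV" by simp
  then show ?thesis using has_sum_exps[of F "infsum F UNIV"] assms(3) LIMSEQ_unique by blast
qed

text \<open>The coefficients are Cauchy integrals over the torus of radius \<open>\<rho>\<close>,
  found by expanding the product kernel into geometric series under the integral. At this stage they
  may depend on \<open>\<rho>\<close>.\<close>

lemma taylor_exists_on:
  fixes f :: "complex^'n::finite \<Rightarrow> complex"
  assumes f: "holo_on f polydisc" "\<And>z. z \<notin> polydisc \<Longrightarrow> f z = 0" and r: "0 < \<rho>" "\<rho> < 1"
  shows "\<exists>a. taylor_on \<rho> f a"
proof -
  let ?M = "Pi\<^sub>M (UNIV :: 'n set) (\<lambda>_. lborel :: real measure)"
  define F where "F x = f (\<chi> i. \<rho> * cis (x i))" for x :: "'n \<Rightarrow> real"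
  obtain B where B: "0 \<le> B" "\<And>z. (\<And>i. cmod (z $ i) \<le> \<rho>) \<Longrightarrow> cmod (f z) \<le> B"
    using holo_bounded[OF f(1) r(2)] by blast
  have FB: "cmod (F x) \<le> B" for x unfolding F_def by (rule B) (use r in \<open>simp add: norm_mult\<close>)
  have [measurable]: "f \<in> borel_measurable borel" using holo_measurable[OF f] .
  have [measurable]: "F \<in> borel_measurable ?M" unfolding F_def
    by (rule measurable_compose[OF vec_lambda_measurable \<open>f \<in> borel_measurable borel\<close>])
       (rule component_measurable, measurable)
  \<comment> \<open>The reciprocal of the boundary point \<rho> * cis x; its powers are the test
    functions that extract coefficients.\<close>
  define q where "q i x = cis (- x) / complex_of_real \<rho>" for i :: 'n and x
  have qn: "cmod (q i x) = 1 / \<rho>" for i x using r by (simp add: q_def norm_divide)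
  have [measurable]: "q i \<in> borel_measurable borel" for i unfolding q_def by measurable
  define a where "a \<alpha> = (LINT x|?M. complex_of_real (\<Prod>i\<in>UNIV. wt (x i)) * ((\<Prod>i\<in>UNIV. q i (x i) ^ \<alpha> i) * F x))" for \<alpha>
  define W where "W = (LINT x|?M. (\<Prod>i\<in>UNIV. wt (x i)))"
  have intW: "integrable ?M (\<lambda>x. \<Prod>i\<in>UNIV. wt (x i))"
    by (rule lb.product_integrable_prod[OF finite wt_integrable])
  have meas_q: "(\<lambda>x. (\<Prod>i\<in>UNIV. (c i * q i (x i)) ^ \<alpha> i)) \<in> borel_measurable ?M" for \<alpha> c
    by (intro borel_measurable_prod borel_measurable_power borel_measurable_times borel_measurable_const component_measurable) (measurable)
  have int_a: "integrable ?M (\<lambda>x. complex_of_real (\<Prod>i\<in>UNIV. wt (x i)) * ((\<Prod>i\<in>UNIV. q i (x i) ^ \<alpha> i) * F x))" for \<alpha>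
  proof (rule integrable_weighted[OF finite wt_integrable wt_nonneg])
    show "(\<lambda>x. (\<Prod>i\<in>UNIV. q i (x i) ^ \<alpha> i) * F x) \<in> borel_measurable ?M"
      using meas_q[of "\<lambda>_. 1" \<alpha>] by simp
    show "cmod ((\<Prod>i\<in>UNIV. q i (x i) ^ \<alpha> i) * F x) \<le> (\<Prod>i\<in>UNIV. (1/\<rho>) ^ \<alpha> i) * B" for x
      unfolding norm_mult prod_norm[symmetric] norm_power qn using r FB by (intro mult_left_mono prod_nonneg) auto
  qed
  have a_bound: "cmod (a \<alpha>) \<le> (\<Prod>i\<in>UNIV. (1/\<rho>) ^ \<alpha> i) * B * W" for \<alpha>
  proof -
    have "cmod (a \<alpha>) \<le> (LINT x|?M. cmod (complex_of_real (\<Prod>i\<in>UNIV. wt (x i)) * ((\<Prod>i\<in>UNIV. q i (x i) ^ \<alpha> i) * F x)))"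
      unfolding a_def by (rule integral_norm_bound)
    also have "\<dots> \<le> (LINT x|?M. (\<Prod>i\<in>UNIV. (1/\<rho>) ^ \<alpha> i) * B * (\<Prod>i\<in>UNIV. wt (x i)))"
    proof (rule integral_mono)
      fix x
      have "cmod ((\<Prod>i\<in>UNIV. q i (x i) ^ \<alpha> i) * F x) \<le> (\<Prod>i\<in>UNIV. (1/\<rho>) ^ \<alpha> i) * B"
        unfolding norm_mult prod_norm[symmetric] norm_power qn using r FB by (intro mult_left_mono prod_nonneg) auto
      moreover have "0 \<le> (\<Prod>i\<in>UNIV. wt (x i))" by (intro prod_nonneg) auto
      ultimately show "cmod (complex_of_real (\<Prod>i\<in>UNIV. wt (x i)) * ((\<Prod>i\<in>UNIV. q i (x i) ^ \<alpha> i) * F x))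
         \<le> (\<Prod>i\<in>UNIV. (1/\<rho>) ^ \<alpha> i) * B * (\<Prod>i\<in>UNIV. wt (x i))"
        unfolding norm_mult[of "complex_of_real _"] norm_of_real by (subst mult.commute) (intro mult_mono, auto)
    qed (use int_a intW in auto)
    finally show ?thesis by (simp add: W_def)
  qed
  have "taylor_on \<rho> f a"
    unfolding taylor_on_def
  proof (intro allI impI)
    fix z :: "complex^'n" assume z: "\<forall>i. cmod (z $ i) < \<rho>"
    define t where "t i x = z $ i * q i x" for i x
    have tn: "cmod (t i x) = cmod (z $ i) / \<rho>" for i x by (simp add: t_def norm_mult qn)
    have tlt: "cmod (z $ i) / \<rho> < 1" for i using z r by simp
    show "((\<lambda>\<alpha>. a \<alpha> * zpow \<alpha> z) has_sum f z) UNIV"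
    proof (rule abs_summable_exps_limit)
      show "cmod (a \<alpha> * zpow \<alpha> z) \<le> B * W * (\<Prod>i\<in>UNIV. (cmod (z $ i) / \<rho>) ^ \<alpha> i)" for \<alpha>
      proof -
        have "cmod (a \<alpha> * zpow \<alpha> z) \<le> (\<Prod>i\<in>UNIV. (1/\<rho>) ^ \<alpha> i) * B * W * (\<Prod>i\<in>UNIV. cmod (z $ i) ^ \<alpha> i)"
          unfolding norm_mult zpow_norm using a_bound by (intro mult_right_mono prod_nonneg) auto
        also have "\<dots> = B * W * (\<Prod>i\<in>UNIV. (cmod (z $ i) / \<rho>) ^ \<alpha> i)"
          by (simp add: power_divide prod_dividef)
        finally show ?thesis .
      qed
      show "(\<lambda>\<alpha>. B * W * (\<Prod>i\<in>UNIV. (cmod (z $ i) / \<rho>) ^ \<alpha> i)) summable_on UNIV"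
        using r tlt by (intro summable_on_cmult_right geometric_summable) auto
      let ?s = "\<lambda>N x. complex_of_real (\<Prod>i\<in>UNIV. wt (x i)) * ((\<Prod>i\<in>UNIV. \<Sum>k<N. t i (x i) ^ k) * F x)"
      let ?l = "\<lambda>x. complex_of_real (\<Prod>i\<in>UNIV. wt (x i)) * ((\<Prod>i\<in>UNIV. kern \<rho> (z $ i) (x i)) * F x)"
      have sum_eq: "(\<Sum>\<alpha>\<in>exps N. a \<alpha> * zpow \<alpha> z) = (LINT x|?M. ?s N x)" for N
      proof -
        have "(\<Sum>\<alpha>\<in>exps N. a \<alpha> * zpow \<alpha> z) = (\<Sum>\<alpha>\<in>exps N. LINT x|?M. complex_of_real (\<Prod>i\<in>UNIV. wt (x i)) * ((\<Prod>i\<in>UNIV. q i (x i) ^ \<alpha> i) * F x) * zpow \<alpha> z)"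
          unfolding a_def by (intro sum.cong refl) (rule Bochner_Integration.integral_mult_left[symmetric], rule int_a)
        also have "\<dots> = (LINT x|?M. (\<Sum>\<alpha>\<in>exps N. complex_of_real (\<Prod>i\<in>UNIV. wt (x i)) * ((\<Prod>i\<in>UNIV. q i (x i) ^ \<alpha> i) * F x) * zpow \<alpha> z))"
          by (rule Bochner_Integration.integral_sum[symmetric]) (use int_a in auto)
        also have "\<dots> = (LINT x|?M. ?s N x)"
        proof (intro Bochner_Integration.integral_cong refl)
          fix x
          have "(\<Sum>\<alpha>\<in>exps N. (\<Prod>i\<in>UNIV. q i (x i) ^ \<alpha> i) * zpow \<alpha> z) = (\<Sum>\<alpha>\<in>exps N. \<Prod>i\<in>UNIV. t i (x i) ^ \<alpha> i)"
            by (simp add: zpow_def t_def power_mult_distrib prod.distrib mult.commute)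
          also have "\<dots> = (\<Prod>i\<in>UNIV. \<Sum>k<N. t i (x i) ^ k)" by (rule sum_exps_prod[of "\<lambda>i k. t i (x i) ^ k"])
          finally have 1: "(\<Prod>i\<in>UNIV. \<Sum>k<N. t i (x i) ^ k) = (\<Sum>\<alpha>\<in>exps N. (\<Prod>i\<in>UNIV. q i (x i) ^ \<alpha> i) * zpow \<alpha> z)" ..
          show "(\<Sum>\<alpha>\<in>exps N. complex_of_real (\<Prod>i\<in>UNIV. wt (x i)) * ((\<Prod>i\<in>UNIV. q i (x i) ^ \<alpha> i) * F x) * zpow \<alpha> z) = ?s N x"
            unfolding 1 sum_distrib_left sum_distrib_right by (intro sum.cong refl) (simp only: ac_simps)
        qed
        finally show ?thesis .
      qed
      \<comment> \<open>Since |z_i| < \<rho>, the partial geometric sums are bounded by 1 / (1 -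
        |z_i| / \<rho>) uniformly in \<open>N\<close> and in the angles, so dominated convergence
        reaches the Cauchy kernel.\<close>
      have "(\<lambda>N. LINT x|?M. ?s N x) \<longlonglongrightarrow> (LINT x|?M. ?l x)"
      proof (rule integral_dominated_convergence)
        let ?C = "(\<Prod>i\<in>UNIV. 1 / (1 - cmod (z $ i) / \<rho>)) * B"
        have "(\<lambda>x. \<Prod>i\<in>UNIV. kern \<rho> (z $ i) (x i)) \<in> borel_measurable ?M"
          by (intro borel_measurable_prod component_measurable) (measurable)
        moreover have wm: "(\<lambda>x. \<Prod>i\<in>UNIV. wt (x i)) \<in> borel_measurable ?M"
          using intW by (rule borel_measurable_integrable)
        ultimately show "?l \<in> borel_measurable ?M" by measurable
        have "(\<lambda>x. \<Prod>i\<in>UNIV. \<Sum>k<N. t i (x i) ^ k) \<in> borel_measurable ?M" for N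
          unfolding t_def
          by (intro borel_measurable_prod borel_measurable_sum borel_measurable_power borel_measurable_times borel_measurable_const component_measurable) (measurable)
        then show "?s N \<in> borel_measurable ?M" for N using wm by measurable
        show "integrable ?M (\<lambda>x. (\<Prod>i\<in>UNIV. wt (x i)) * ?C)" using intW by (rule integrable_mult_left)
        show "AE x in ?M. (\<lambda>N. ?s N x) \<longlonglongrightarrow> ?l x"
        proof (intro AE_I2 tendsto_intros)
          fix x i
          have "(\<lambda>k. t i (x i) ^ k) sums (1 / (1 - t i (x i)))" using tn tlt by (intro geometric_sums) simp
          then show "(\<lambda>N. \<Sum>k<N. t i (x i) ^ k) \<longlonglongrightarrow> kern \<rho> (z $ i) (x i)"
            by (simp add: sums_def kern_def t_def q_def)
        qed
        show "AE x in ?M. norm (?s N x) \<le> (\<Prod>i\<in>UNIV. wt (x i)) * ?C" for N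
        proof (intro AE_I2)
          fix x
          have "cmod (\<Prod>i\<in>UNIV. \<Sum>k<N. t i (x i) ^ k) \<le> (\<Prod>i\<in>UNIV. 1 / (1 - cmod (z $ i) / \<rho>))"
            unfolding prod_norm[symmetric]
          proof (intro prod_mono conjI)
            fix i
            have "cmod (\<Sum>k<N. t i (x i) ^ k) \<le> (\<Sum>k<N. (cmod (z $ i) / \<rho>) ^ k)"
              by (rule order_trans[OF norm_sum]) (simp add: norm_power tn)
            also have "\<dots> \<le> (\<Sum>k. (cmod (z $ i) / \<rho>) ^ k)" using r tlt by (intro sum_le_suminf) auto
            also have "\<dots> = 1 / (1 - cmod (z $ i) / \<rho>)" using r tlt by (intro suminf_geometric) auto
            finally show "cmod (\<Sum>k<N. t i (x i) ^ k) \<le> 1 / (1 - cmod (z $ i) / \<rho>)" .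
          qed auto
          then have "cmod ((\<Prod>i\<in>UNIV. \<Sum>k<N. t i (x i) ^ k) * F x) \<le> ?C"
            unfolding norm_mult using FB tlt r by (intro mult_mono prod_nonneg) (auto simp: less_imp_le)
          moreover have "0 \<le> (\<Prod>i\<in>UNIV. wt (x i))" by (intro prod_nonneg) auto
          ultimately show "norm (?s N x) \<le> (\<Prod>i\<in>UNIV. wt (x i)) * ?C"
            unfolding norm_mult[of "complex_of_real _"] norm_of_real by (intro mult_mono) auto
        qed
      qed
      moreover have "(LINT x|?M. ?l x) = f z"
        using cauchy_polydisc[OF f r _ finite, of "\<lambda>i. z $ i" "\<lambda>_. 0" UNIV] z by (simp add: F_def)
      ultimately show "(\<lambda>N. \<Sum>\<alpha>\<in>exps N. a \<alpha> * zpow \<alpha> z) \<longlonglongrightarrow> f z" by (simp add: sum_eq)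
    qed
  qed
  then show ?thesis by blast
qed

section \<open>Parseval identities and rotation invariance\<close>

text \<open>The density \<open>u\<close> and the coordinate map \<open>g\<close> are kept general to
  cover both a circle, where g = r cis, and a truncated disc, where g is the identity cut off at
  radius R. The strict bound R < R' gives absolute convergence of the Taylor series on the range of
  \<open>g\<close>, and the product measure reduces orthogonality to one variable.\<close>

lemma parseval:
  fixes f :: "complex^'n::finite \<Rightarrow> complex" and g :: "'b::euclidean_space \<Rightarrow> complex" and u :: "'b \<Rightarrow> real"
  assumes a: "taylor_on R' f a" and R: "0 \<le> R" "R < R'"
    and u: "integrable lborel u" "\<And>t. 0 \<le> u t"
    and g: "g \<in> borel_measurable borel" "\<And>t. cmod (g t) \<le> R"
    and orth: "\<And>k l. k \<noteq> l \<Longrightarrow> (LINT t|lborel. complex_of_real (u t) * (g t ^ k * cnj (g t) ^ l)) = 0"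
  defines "\<omega> \<equiv> \<lambda>k. LINT t|lborel. u t * cmod (g t) ^ (2 * k)"
  shows "(\<integral>\<^sup>+x. ennreal ((\<Prod>i\<in>UNIV. u (x i)) * (cmod (f (\<chi> i. g (x i))))\<^sup>2) \<partial>Pi\<^sub>M UNIV (\<lambda>_. lborel))
    = (SUP N. ennreal (\<Sum>\<alpha>\<in>exps N. (cmod (a \<alpha>))\<^sup>2 * (\<Prod>i\<in>UNIV. \<omega> (\<alpha> i))))"
proof -
  let ?M = "Pi\<^sub>M (UNIV :: 'n set) (\<lambda>_. lborel :: 'b measure)"
  define S where "S N x = (\<Sum>\<alpha>\<in>exps N. a \<alpha> * zpow \<alpha> (\<chi> i. g (x i)))" for N x
  \<comment> \<open>The absolutely convergent series at the point (R, ..., R) bounds every partial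
    sum at every \<open>x\<close>.\<close>
  define B where "B = infsum (\<lambda>\<alpha>. cmod (a \<alpha> * zpow \<alpha> (\<chi> i. complex_of_real R))) UNIV"
  have intu: "integrable ?M (\<lambda>x. \<Prod>i\<in>UNIV. u (x i))"
    by (rule lb.product_integrable_prod[OF finite u(1)])
  have um: "(\<lambda>x. \<Prod>i\<in>UNIV. u (x i)) \<in> borel_measurable ?M"
    using intu by (rule borel_measurable_integrable)
  have abs: "(\<lambda>\<alpha>. cmod (a \<alpha> * zpow \<alpha> (\<chi> i. complex_of_real R))) summable_on UNIV"
  proof -
    have "((\<lambda>\<alpha>. a \<alpha> * zpow \<alpha> (\<chi> i. complex_of_real R)) has_sum f (\<chi> i. complex_of_real R)) UNIV"
      using a R by (simp add: taylor_on_def)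
    then have "(\<lambda>\<alpha>. a \<alpha> * zpow \<alpha> (\<chi> i. complex_of_real R)) summable_on UNIV" by (rule has_sum_imp_summable)
    then show ?thesis by (simp only: summable_on_iff_abs_summable_on_complex)
  qed
  have gx: "cmod (zpow \<alpha> (\<chi> i. g (x i))) \<le> cmod (zpow \<alpha> (\<chi> i. complex_of_real R))" for \<alpha> x
    unfolding zpow_norm using g R by (intro prod_mono conjI power_mono) auto
  have SB: "cmod (S N x) \<le> B" for N x
  proof -
    have "cmod (S N x) \<le> (\<Sum>\<alpha>\<in>exps N. cmod (a \<alpha> * zpow \<alpha> (\<chi> i. complex_of_real R)))"
      unfolding S_def by (rule order_trans[OF norm_sum sum_mono]) (unfold norm_mult, intro mult_left_mono gx norm_ge_zero)
    also have "\<dots> \<le> B" unfolding B_def using abs by (intro finite_sum_le_infsum) auto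
    finally show ?thesis .
  qed
  have Slim: "(\<lambda>N. S N x) \<longlonglongrightarrow> f (\<chi> i. g (x i))" for x
    unfolding S_def using a le_less_trans[OF g(2) R(2)] by (intro has_sum_exps) (simp add: taylor_on_def)
  have Sm: "S N \<in> borel_measurable ?M" for N
    unfolding S_def zpow_def vec_lambda_beta
    by (intro borel_measurable_sum borel_measurable_times borel_measurable_const borel_measurable_prod borel_measurable_power component_measurable g) auto
  have fm: "(\<lambda>x. f (\<chi> i. g (x i))) \<in> borel_measurable ?M"
    by (rule borel_measurable_LIMSEQ_metric[OF Sm Slim])
  let ?s = "\<lambda>N x. (\<Prod>i\<in>UNIV. u (x i)) * (cmod (S N x))\<^sup>2"
  let ?l = "\<lambda>x. (\<Prod>i\<in>UNIV. u (x i)) * (cmod (f (\<chi> i. g (x i))))\<^sup>2"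
  have unn: "0 \<le> (\<Prod>i\<in>UNIV. u (x i))" for x :: "'n \<Rightarrow> 'b" using u by (intro prod_nonneg) auto
  have meas: "?l \<in> borel_measurable ?M" "\<And>N. ?s N \<in> borel_measurable ?M"
    using um fm Sm by measurable
  have Cint: "integrable ?M (\<lambda>x. (\<Prod>i\<in>UNIV. u (x i)) * B\<^sup>2)" using intu by (rule integrable_mult_left)
  have lim_ae: "AE x in ?M. (\<lambda>N. ?s N x) \<longlonglongrightarrow> ?l x"
    using Slim by (intro AE_I2 tendsto_intros) auto
  have bound: "AE x in ?M. norm (?s N x) \<le> (\<Prod>i\<in>UNIV. u (x i)) * B\<^sup>2" for N
    using unn SB by (intro AE_I2) (auto simp: abs_mult intro!: mult_left_mono power_mono)
  have lim: "(\<lambda>N. LINT x|?M. ?s N x) \<longlonglongrightarrow> (LINT x|?M. ?l x)"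
    and intl: "integrable ?M ?l" and ints: "\<And>N. integrable ?M (?s N)"
    using integral_dominated_convergence[OF meas Cint lim_ae bound]
      integrable_dominated_convergence[OF meas Cint lim_ae bound]
      integrable_dominated_convergence2[OF meas Cint lim_ae bound] by auto
  have term_int: "integrable lborel (\<lambda>t. complex_of_real (u t) * (g t ^ k * cnj (g t) ^ l))" for k l
  proof (rule Bochner_Integration.integrable_bound)
    show "integrable lborel (\<lambda>t. u t * (R ^ k * R ^ l))" using u(1) by (rule integrable_mult_left)
    show "(\<lambda>t. complex_of_real (u t) * (g t ^ k * cnj (g t) ^ l)) \<in> borel_measurable lborel"
      using g(1) borel_measurable_integrable[OF u(1)] by measurable
    show "AE t in lborel. norm (complex_of_real (u t) * (g t ^ k * cnj (g t) ^ l)) \<le> norm (u t * (R ^ k * R ^ l))"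
      using u g R by (intro AE_I2) (auto simp: norm_mult norm_power abs_mult intro!: mult_left_mono mult_mono power_mono)
  qed
  have diag: "(LINT t|lborel. complex_of_real (u t) * (g t ^ k * cnj (g t) ^ k)) = complex_of_real (\<omega> k)" for k
  proof -
    have "complex_of_real (u t) * (g t ^ k * cnj (g t) ^ k) = complex_of_real (u t * cmod (g t) ^ (2 * k))" for t
      by (simp only: power_mult_distrib[symmetric] complex_norm_square[symmetric] power_mult of_real_mult of_real_power)
    then show ?thesis by (simp only: \<omega>_def integral_complex_of_real)
  qed
  have energy: "(LINT x|?M. ?s N x) = (\<Sum>\<alpha>\<in>exps N. (cmod (a \<alpha>))\<^sup>2 * (\<Prod>i\<in>UNIV. \<omega> (\<alpha> i)))" for N
  proof -
    let ?t = "\<lambda>\<alpha> \<beta> x. \<Prod>i\<in>UNIV. complex_of_real (u (x i)) * (g (x i) ^ \<alpha> i * cnj (g (x i)) ^ \<beta> i)"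
    have ti: "integrable ?M (?t \<alpha> \<beta>)" for \<alpha> \<beta> :: "'n \<Rightarrow> nat"
      by (rule lb.product_integrable_prod[OF finite term_int])
    \<comment> \<open>Different exponents differ at some coordinate, and the one-variable factor
      there is zero by \<open>orth\<close>; only the diagonal of the double sum survives.\<close>
    have tv: "(LINT x|?M. ?t \<alpha> \<beta> x) = (if \<alpha> = \<beta> then complex_of_real (\<Prod>i\<in>UNIV. \<omega> (\<alpha> i)) else 0)" for \<alpha> \<beta> :: "'n \<Rightarrow> nat"
    proof -
      have "(LINT x|?M. ?t \<alpha> \<beta> x) = (\<Prod>i\<in>UNIV. LINT t|lborel. complex_of_real (u t) * (g t ^ \<alpha> i * cnj (g t) ^ \<beta> i))"
        by (rule lb.product_integral_prod[OF finite term_int])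
      moreover have "\<dots> = 0" if "\<alpha> \<noteq> \<beta>"
      proof -
        obtain i where "\<alpha> i \<noteq> \<beta> i" using \<open>\<alpha> \<noteq> \<beta>\<close> by auto
        then show ?thesis using orth by (intro prod_zero bexI[of _ i]) auto
      qed
      ultimately show ?thesis using diag by auto
    qed
    have "complex_of_real (?s N x) = (\<Sum>\<alpha>\<in>exps N. \<Sum>\<beta>\<in>exps N. a \<alpha> * cnj (a \<beta>) * ?t \<alpha> \<beta> x)" for x
    proof -
      have "complex_of_real (?s N x) = (\<Prod>i\<in>UNIV. complex_of_real (u (x i))) * (S N x * cnj (S N x))"
        by (simp only: of_real_mult of_real_prod complex_norm_square)
      also have "\<dots> = (\<Sum>\<alpha>\<in>exps N. \<Sum>\<beta>\<in>exps N. (\<Prod>i\<in>UNIV. complex_of_real (u (x i))) *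
          (a \<alpha> * zpow \<alpha> (\<chi> i. g (x i)) * (cnj (a \<beta>) * cnj (zpow \<beta> (\<chi> i. g (x i))))))"
        unfolding S_def cnj_sum complex_cnj_mult sum_product by (simp only: sum_distrib_left)
      also have "\<dots> = (\<Sum>\<alpha>\<in>exps N. \<Sum>\<beta>\<in>exps N. a \<alpha> * cnj (a \<beta>) * ?t \<alpha> \<beta> x)"
        by (intro sum.cong refl) (simp add: zpow_def prod.distrib ac_simps)
      finally show ?thesis .
    qed
    then have "complex_of_real (LINT x|?M. ?s N x) = (LINT x|?M. (\<Sum>\<alpha>\<in>exps N. \<Sum>\<beta>\<in>exps N. a \<alpha> * cnj (a \<beta>) * ?t \<alpha> \<beta> x))"
      by (subst integral_complex_of_real[symmetric]) (simp only:)
    also have "\<dots> = (\<Sum>\<alpha>\<in>exps N. \<Sum>\<beta>\<in>exps N. a \<alpha> * cnj (a \<beta>) * (LINT x|?M. ?t \<alpha> \<beta> x))"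
      using ti by (subst Bochner_Integration.integral_sum; auto intro!: sum.cong Bochner_Integration.integrable_sum)
    also have "\<dots> = (\<Sum>\<alpha>\<in>exps N. a \<alpha> * cnj (a \<alpha>) * complex_of_real (\<Prod>i\<in>UNIV. \<omega> (\<alpha> i)))"
      unfolding tv by (intro sum.cong refl) (simp add: if_distrib[where f = "\<lambda>x. _ * x"] cong: if_cong)
    also have "\<dots> = complex_of_real (\<Sum>\<alpha>\<in>exps N. (cmod (a \<alpha>))\<^sup>2 * (\<Prod>i\<in>UNIV. \<omega> (\<alpha> i)))"
      by (simp only: of_real_sum of_real_mult complex_norm_square)
    finally show ?thesis by (simp only: of_real_eq_iff)
  qed
  have \<omega>nn: "0 \<le> \<omega> k" for k unfolding \<omega>_def using u by (intro integral_nonneg_AE AE_I2) auto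
  have tnn: "0 \<le> (cmod (a \<alpha>))\<^sup>2 * (\<Prod>i\<in>UNIV. \<omega> (\<alpha> i))" for \<alpha> using \<omega>nn by (intro mult_nonneg_nonneg prod_nonneg) auto
  have "incseq (\<lambda>N. ennreal (\<Sum>\<alpha>\<in>exps N. (cmod (a \<alpha>))\<^sup>2 * (\<Prod>i\<in>UNIV. \<omega> (\<alpha> i))))"
    by (intro incseq_SucI ennreal_leI sum_mono2) (use tnn subsetD[OF exps_mono[OF le_SucI[OF order_refl]]] in auto)
  then have "(\<lambda>N. ennreal (\<Sum>\<alpha>\<in>exps N. (cmod (a \<alpha>))\<^sup>2 * (\<Prod>i\<in>UNIV. \<omega> (\<alpha> i))))
     \<longlonglongrightarrow> (SUP N. ennreal (\<Sum>\<alpha>\<in>exps N. (cmod (a \<alpha>))\<^sup>2 * (\<Prod>i\<in>UNIV. \<omega> (\<alpha> i))))"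
    by (rule LIMSEQ_SUP)
  moreover have "(\<lambda>N. ennreal (\<Sum>\<alpha>\<in>exps N. (cmod (a \<alpha>))\<^sup>2 * (\<Prod>i\<in>UNIV. \<omega> (\<alpha> i))))
     \<longlonglongrightarrow> ennreal (LINT x|?M. ?l x)"
    using lim unfolding energy by (rule tendsto_ennrealI)
  ultimately have "(SUP N. ennreal (\<Sum>\<alpha>\<in>exps N. (cmod (a \<alpha>))\<^sup>2 * (\<Prod>i\<in>UNIV. \<omega> (\<alpha> i)))) = ennreal (LINT x|?M. ?l x)"
    by (rule LIMSEQ_unique)
  moreover have "(\<integral>\<^sup>+x. ennreal (?l x) \<partial>?M) = ennreal (LINT x|?M. ?l x)"
    using intl unn by (intro nn_integral_eq_integral AE_I2) auto
  ultimately show ?thesis by simp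
qed

section \<open>Lebesgue measure in coordinates and its rotation invariance\<close>

lemma prod_Basis_vec:
  fixes f :: "'a::euclidean_space^'n::finite \<Rightarrow> 'c::comm_monoid_mult"
  shows "prod f Basis = (\<Prod>i\<in>UNIV. \<Prod>b\<in>Basis. f (axis i b))"
proof -
  have inj: "inj_on (\<lambda>(i, b). axis i b) (UNIV \<times> (Basis :: 'a set))"
    by (auto simp: inj_on_def axis_eq_axis)
  have "Basis = (\<lambda>(i, b). axis i b :: 'a^'n) ` (UNIV \<times> Basis)"
    by (auto simp: Basis_vec_def)
  then have "prod f Basis = prod f ((\<lambda>(i, b). axis i b) ` (UNIV \<times> Basis))" by simp
  also have "\<dots> = (\<Prod>(i, b)\<in>UNIV \<times> Basis. f (axis i b))"
    by (subst prod.reindex[OF inj]) (auto intro!: prod.cong)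
  also have "\<dots> = (\<Prod>i\<in>UNIV. \<Prod>b\<in>Basis. f (axis i b))"
    by (rule prod.cartesian_product[symmetric])
  finally show ?thesis .
qed

text \<open>Checked on boxes. It is used with real coordinates for torus integrals and with complex
  coordinates for Bergman integrals.\<close>

lemma lborel_vec:
  "(lborel :: ('a::euclidean_space^'n::finite) measure) = distr (Pi\<^sub>M UNIV (\<lambda>_. lborel)) borel vec_lambda"
proof (rule lborel_eqI)
  fix l u :: "'a^'n" assume lu: "\<And>b. b \<in> Basis \<Longrightarrow> l \<bullet> b \<le> u \<bullet> b"
  have ax: "l $ i \<bullet> b \<le> u $ i \<bullet> b" if "b \<in> Basis" for i b
    using lu[of "axis i b"] that by (auto simp: inner_axis Basis_vec_def)
  have m: "vec_lambda \<in> measurable (Pi\<^sub>M UNIV (\<lambda>_. lborel)) (borel :: ('a^'n) measure)"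
  proof -
    have "(\<lambda>x. x i) \<in> borel_measurable (Pi\<^sub>M UNIV (\<lambda>_. lborel :: 'a measure))" for i :: 'n
      using measurable_component_singleton[of i UNIV "\<lambda>_. lborel :: 'a measure"] by simp
    then have "(\<lambda>x. (\<chi> i. x i) :: 'a^'n) \<in> borel_measurable (Pi\<^sub>M UNIV (\<lambda>_. lborel :: 'a measure))"
      by (rule vec_lambda_measurable[of "\<lambda>i x. x i"])
    then show ?thesis by simp
  qed
  have pre: "vec_lambda -` box l u \<inter> space (Pi\<^sub>M UNIV (\<lambda>_. lborel)) = PiE UNIV (\<lambda>i. box (l $ i) (u $ i))"
    by (auto simp: space_PiM mem_box Basis_vec_def inner_axis PiE_def Pi_iff)
  have "emeasure (distr (Pi\<^sub>M UNIV (\<lambda>_. lborel)) borel vec_lambda) (box l u)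
      = emeasure (Pi\<^sub>M UNIV (\<lambda>_. lborel)) (PiE UNIV (\<lambda>i. box (l $ i) (u $ i)))"
    using m by (simp add: emeasure_distr pre)
  also have "\<dots> = (\<Prod>i\<in>UNIV. emeasure lborel (box (l $ i) (u $ i)))"
    by (rule lb.emeasure_PiM) auto
  also have "\<dots> = (\<Prod>i\<in>UNIV. ennreal (\<Prod>b\<in>Basis. (u $ i - l $ i) \<bullet> b))"
    using ax by simp
  also have "\<dots> = ennreal (\<Prod>i\<in>UNIV. \<Prod>b\<in>Basis. (u $ i - l $ i) \<bullet> b)"
    using ax by (intro prod_ennreal prod_nonneg) (auto simp: inner_diff_left)
  also have "\<dots> = ennreal (\<Prod>b\<in>Basis. (u - l) \<bullet> b)"
    by (simp add: prod_Basis_vec inner_axis)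
  finally show "emeasure (distr (Pi\<^sub>M UNIV (\<lambda>_. lborel)) borel vec_lambda) (box l u) = (\<Prod>b\<in>Basis. (u - l) \<bullet> b)" .
qed simp

lemma nn_integral_lborel_vec:
  fixes f :: "'a::euclidean_space^'n::finite \<Rightarrow> ennreal"
  assumes "f \<in> borel_measurable borel"
  shows "(\<integral>\<^sup>+z. f z \<partial>lborel) = (\<integral>\<^sup>+x. f (\<chi> i. x i) \<partial>Pi\<^sub>M UNIV (\<lambda>_. lborel))"
proof -
  have "(\<lambda>x. x i) \<in> borel_measurable (Pi\<^sub>M UNIV (\<lambda>_. lborel :: 'a measure))" for i :: 'n
    using measurable_component_singleton[of i UNIV "\<lambda>_. lborel :: 'a measure"] by simp
  then have "(\<lambda>x. (\<chi> i. x i) :: 'a^'n) \<in> borel_measurable (Pi\<^sub>M UNIV (\<lambda>_. lborel :: 'a measure))"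
    by (rule vec_lambda_measurable[of "\<lambda>i x. x i"])
  then show ?thesis using assms by (subst lborel_vec) (simp add: nn_integral_distr)
qed

lemma nn_integral_lborel_complex:
  assumes "f \<in> borel_measurable borel"
  shows "(\<integral>\<^sup>+z. f z \<partial>lborel) = (\<integral>\<^sup>+x. \<integral>\<^sup>+y. f (Complex x y) \<partial>lborel \<partial>lborel)"
proof -
  have m: "(\<lambda>(x, y). Complex x y) \<in> measurable (borel :: (real \<times> real) measure) borel"
    unfolding Complex_eq case_prod_unfold by (intro borel_measurable_continuous_onI continuous_intros)
  have eq: "(lborel :: complex measure) = distr lborel borel (\<lambda>(x, y). Complex x y)"
  proof (rule lborel_eqI)
    fix l u :: complex assume lu: "\<And>b. b \<in> Basis \<Longrightarrow> l \<bullet> b \<le> u \<bullet> b"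
    have le: "Re l \<le> Re u" "Im l \<le> Im u" using lu[of 1] lu[of \<i>] by (auto simp: Basis_complex_def inner_complex_def)
    have "(\<lambda>(x, y). Complex x y) -` box l u = box (Re l, Im l) (Re u, Im u)"
      by (auto simp: mem_box Basis_complex_def inner_complex_def Basis_prod_def)
    then have "emeasure (distr lborel borel (\<lambda>(x, y). Complex x y)) (box l u) = emeasure lborel (box (Re l, Im l) (Re u, Im u))"
      using m by (simp add: emeasure_distr)
    also have "\<dots> = ennreal ((Re u - Re l) * (Im u - Im l))"
      using le by (subst emeasure_lborel_box) (auto simp: Basis_prod_def prod.union_disjoint)
    also have "\<dots> = ennreal (\<Prod>b\<in>Basis. (u - l) \<bullet> b)" by (simp add: Basis_complex_def inner_complex_def)
    finally show "emeasure (distr lborel borel (\<lambda>(x, y). Complex x y)) (box l u) = ennreal (\<Prod>b\<in>Basis. (u - l) \<bullet> b)" .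
  qed simp
  have "(\<integral>\<^sup>+z. f z \<partial>lborel) = (\<integral>\<^sup>+z. f (Complex (fst z) (snd z)) \<partial>(lborel \<Otimes>\<^sub>M lborel))"
    using m assms by (subst eq) (simp add: nn_integral_distr lborel_prod case_prod_unfold)
  also have "\<dots> = (\<integral>\<^sup>+x. \<integral>\<^sup>+y. f (Complex x y) \<partial>lborel \<partial>lborel)"
  proof (subst lborel.nn_integral_fst[symmetric])
    have "(\<lambda>z. f (Complex (fst z) (snd z))) \<in> borel_measurable borel"
      using measurable_compose[OF m assms] by (simp add: case_prod_unfold)
    then show "(\<lambda>z. f (Complex (fst z) (snd z))) \<in> borel_measurable (lborel \<Otimes>\<^sub>M lborel)"
      by (simp add: lborel_prod)
  qed simp
  finally show ?thesis .
qed

text \<open>The opposite order of integration serves the horizontal shear, which is a translation in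
  x for each fixed y.\<close>

lemma nn_integral_lborel_complex':
  assumes "f \<in> borel_measurable borel"
  shows "(\<integral>\<^sup>+z. f z \<partial>lborel) = (\<integral>\<^sup>+y. \<integral>\<^sup>+x. f (Complex x y) \<partial>lborel \<partial>lborel)"
proof -
  have m: "(\<lambda>(x, y). Complex x y) \<in> measurable (borel :: (real \<times> real) measure) borel"
    unfolding Complex_eq case_prod_unfold by (intro borel_measurable_continuous_onI continuous_intros)
  have "(\<lambda>(x, y). f (Complex x y)) \<in> borel_measurable (lborel \<Otimes>\<^sub>M lborel)"
    using measurable_compose[OF m assms] by (simp add: case_prod_unfold lborel_prod)
  from lborel_pair.Fubini'[OF this] show ?thesis
    using nn_integral_lborel_complex[OF assms] by simp
qed

lemma nn_integral_lborel_translate: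
  fixes f :: "real \<Rightarrow> ennreal"
  assumes "f \<in> borel_measurable borel"
  shows "(\<integral>\<^sup>+y. f (y + c) \<partial>lborel) = (\<integral>\<^sup>+y. f y \<partial>lborel)"
  using nn_integral_real_affine[OF assms, of 1 c] by (simp add: add.commute)

text \<open>A rotation is a product of three shears.\<close>
lemma nn_integral_rotate:
  assumes f: "f \<in> borel_measurable borel" and u: "cmod u = 1" "Im u \<noteq> 0"
  shows "(\<integral>\<^sup>+z. f (u * z) \<partial>lborel) = (\<integral>\<^sup>+z. f z \<partial>lborel)"
proof -
  have CX: "Complex x \<in> borel_measurable borel" for x unfolding Complex_eq by measurable
  have CY: "(\<lambda>x. Complex x y) \<in> borel_measurable borel" for y unfolding Complex_eq by measurable
  have ReIm: "Re \<in> borel_measurable borel" "Im \<in> borel_measurable borel"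
    by (intro borel_measurable_continuous_onI continuous_intros)+
  \<comment> \<open>For u = cis \<theta> these are -tan (\<theta> / 2) and sin \<theta>, the
    parameters of the factorisation into shears; the division explains why Im u must be
    nonzero.\<close>
  define s t where "s = (Re u - 1) / Im u" and "t = Im u"
  define A where "A z = Complex (Re z) (Im z + t * Re z)" for z
  define B where "B z = Complex (Re z + s * Im z) (Im z)" for z
  have mA: "A \<in> borel_measurable borel" and mB: "B \<in> borel_measurable borel"
    unfolding A_def B_def Complex_eq using ReIm by measurable
  have iA: "(\<integral>\<^sup>+z. g (A z) \<partial>lborel) = (\<integral>\<^sup>+z. g z \<partial>lborel)" if g: "g \<in> borel_measurable borel" for g
  proof -
    have "(\<integral>\<^sup>+z. g (A z) \<partial>lborel) = (\<integral>\<^sup>+x. \<integral>\<^sup>+y. g (Complex x (y + t * x)) \<partial>lborel \<partial>lborel)"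
      using nn_integral_lborel_complex[OF measurable_compose[OF mA g]] by (simp add: A_def)
    also have "\<dots> = (\<integral>\<^sup>+x. \<integral>\<^sup>+y. g (Complex x y) \<partial>lborel \<partial>lborel)"
      by (rule nn_integral_cong) (rule nn_integral_lborel_translate[OF measurable_compose[OF CX g]])
    finally show ?thesis using nn_integral_lborel_complex[OF g] by simp
  qed
  have iB: "(\<integral>\<^sup>+z. g (B z) \<partial>lborel) = (\<integral>\<^sup>+z. g z \<partial>lborel)" if g: "g \<in> borel_measurable borel" for g
  proof -
    have "(\<integral>\<^sup>+z. g (B z) \<partial>lborel) = (\<integral>\<^sup>+y. \<integral>\<^sup>+x. g (Complex (x + s * y) y) \<partial>lborel \<partial>lborel)"
      using nn_integral_lborel_complex'[OF measurable_compose[OF mB g]] by (simp add: B_def)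
    also have "\<dots> = (\<integral>\<^sup>+y. \<integral>\<^sup>+x. g (Complex x y) \<partial>lborel \<partial>lborel)"
      by (rule nn_integral_cong) (rule nn_integral_lborel_translate[OF measurable_compose[OF CY g]])
    finally show ?thesis using nn_integral_lborel_complex'[OF g] by simp
  qed
  have un: "(Re u)\<^sup>2 + (Im u)\<^sup>2 = 1" using u(1) by (metis cmod_power2 power_one)
  have rot: "u * z = B (A (B z))" for z
  proof -
    have st: "1 + t * s = Re u" using u by (simp add: s_def t_def)
    have s2: "s * (1 + Re u) = - Im u"
    proof -
      have "(Re u - 1) * (1 + Re u) = - (Im u * Im u)" using un by (simp add: algebra_simps power2_eq_square)
      then show ?thesis using u by (simp add: s_def field_simps)
    qed
    have im: "Im z + t * (Re z + s * Im z) = Im u * Re z + Re u * Im z"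
      using arg_cong[OF st, of "\<lambda>c. c * Im z"] by (simp add: algebra_simps t_def)
    have "Re z + s * Im z + s * (Im u * Re z + Re u * Im z) = (1 + t * s) * Re z + (s * (1 + Re u)) * Im z"
      by (simp add: algebra_simps t_def)
    also have "\<dots> = Re u * Re z - Im u * Im z" unfolding st s2 by simp
    finally show ?thesis using im by (simp add: A_def B_def complex_eq_iff)
  qed
  have "(\<integral>\<^sup>+z. f (u * z) \<partial>lborel) = (\<integral>\<^sup>+z. f (B (A (B z))) \<partial>lborel)" by (simp add: rot)
  also have "\<dots> = (\<integral>\<^sup>+z. f (B (A z)) \<partial>lborel)"
    by (rule iB) (intro measurable_compose[OF mA] measurable_compose[OF mB] f)
  also have "\<dots> = (\<integral>\<^sup>+z. f (B z) \<partial>lborel)"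
    by (rule iA) (intro measurable_compose[OF mB] f)
  also have "\<dots> = (\<integral>\<^sup>+z. f z \<partial>lborel)" by (rule iB[OF f])
  finally show ?thesis .
qed

lemma lborel_distr_rotate:
  assumes u: "cmod u = 1" "Im u \<noteq> 0"
  shows "distr lborel borel (\<lambda>z. u * z) = (lborel :: complex measure)"
proof (rule measure_eqI)
  have m: "(\<lambda>z. u * z) \<in> borel_measurable borel" by measurable
  fix X assume "X \<in> sets (distr lborel borel (\<lambda>z. u * z))"
  then have X: "X \<in> sets borel" by simp
  have "emeasure (distr lborel borel (\<lambda>z. u * z)) X = (\<integral>\<^sup>+z. indicator X z \<partial>distr lborel borel (\<lambda>z. u * z))"
    using X by (intro nn_integral_indicator[symmetric]) simp
  also have "\<dots> = (\<integral>\<^sup>+z. indicator X (u * z) \<partial>lborel)"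
    using X m by (subst nn_integral_distr) auto
  also have "\<dots> = (\<integral>\<^sup>+z. indicator X z \<partial>lborel)" using X by (intro nn_integral_rotate u) simp
  also have "\<dots> = emeasure lborel X" using X by simp
  finally show "emeasure (distr lborel borel (\<lambda>z. u * z)) X = emeasure lborel X" .
qed simp

lemma orthogonal_by_conjugation:
  fixes u :: "'b::euclidean_space \<Rightarrow> real" and g :: "'b \<Rightarrow> complex"
  assumes "k \<noteq> l" and less: "\<And>k l. l < k \<Longrightarrow> (LINT t|lborel. complex_of_real (u t) * (g t ^ k * cnj (g t) ^ l)) = 0"
  shows "(LINT t|lborel. complex_of_real (u t) * (g t ^ k * cnj (g t) ^ l)) = 0"
proof (cases "l < k")
  case False
  then have kl: "k < l" using assms(1) by simp
  have "(LINT t|lborel. complex_of_real (u t) * (g t ^ k * cnj (g t) ^ l))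
     = (LINT t|lborel. cnj (complex_of_real (u t) * (g t ^ l * cnj (g t) ^ k)))"
    by (intro Bochner_Integration.integral_cong refl) (simp add: ac_simps)
  also have "\<dots> = cnj (LINT t|lborel. complex_of_real (u t) * (g t ^ l * cnj (g t) ^ k))"
    by (rule Bochner_Integration.integral_cnj)
  also have "\<dots> = 0" unfolding less[OF kl] by simp
  finally show ?thesis .
qed (rule less)

text \<open>Rotation by a unimodular w preserves Lebesgue measure and multiplies the integral by
  w^(k - l) when k > l, so the integral vanishes once this factor differs from 1.\<close>

lemma radial_orthogonal:
  fixes u :: "complex \<Rightarrow> real" and g :: "complex \<Rightarrow> complex"
  assumes u: "u \<in> borel_measurable borel" "\<And>w z. cmod w = 1 \<Longrightarrow> u (w * z) = u z"
    and g: "g \<in> borel_measurable borel" "\<And>w z. cmod w = 1 \<Longrightarrow> g (w * z) = w * g z" and kl: "k \<noteq> l"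
  shows "(LINT z|lborel. complex_of_real (u z) * (g z ^ k * cnj (g z) ^ l)) = 0"
proof -
  have *: "(LINT z|lborel. complex_of_real (u z) * (g z ^ k * cnj (g z) ^ l)) = 0" if kl: "k > l" for k l
  proof -
    define m where "m = k - l"
    have m: "m \<ge> 1" using kl by (simp add: m_def)
    \<comment> \<open>With this angle both \<open>w\<close> and \<open>w ^ m\<close> have arguments
      strictly between 0 and pi: the first makes the rotation lemma applicable, the second gives
      \<open>w ^ m \<noteq> 1\<close>.\<close>
    define w where "w = cis (pi / real (m + 1))"
    have w1: "cmod w = 1" by (simp add: w_def)
    have "0 < pi / real (m + 1)" "pi / real (m + 1) < pi" using m by (auto simp: divide_less_eq)
    then have "Im w \<noteq> 0" using sin_gt_zero[of "pi / real (m + 1)"] by (simp add: w_def)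
    have "0 < real m * (pi / real (m + 1))" "real m * (pi / real (m + 1)) < pi" using m by (auto simp: field_simps)
    then have "Im (w ^ m) \<noteq> 0" using sin_gt_zero[of "real m * (pi / real (m + 1))"] by (simp add: w_def Complex.DeMoivre)
    then have wm: "w ^ m \<noteq> 1" by auto
    let ?F = "\<lambda>z. complex_of_real (u z) * (g z ^ k * cnj (g z) ^ l)"
    have [measurable]: "cnj \<in> borel_measurable borel"
      by (intro borel_measurable_continuous_onI continuous_intros)
    have F: "?F \<in> borel_measurable borel" using u(1) g(1) by measurable
    have "w ^ k = w ^ m * w ^ l" using kl by (simp add: m_def flip: power_add)
    moreover have "w * cnj w = 1" using complex_norm_square[of w] w1 by simp
    then have "w ^ l * cnj w ^ l = 1" by (simp only: power_mult_distrib[symmetric] power_one)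
    ultimately have ww: "w ^ k * cnj w ^ l = w ^ m" by (simp only: mult.assoc mult_1_right)
    have Fw: "?F (w * z) = w ^ m * ?F z" for z
    proof -
      have "?F (w * z) = (w ^ k * cnj w ^ l) * ?F z"
        unfolding u(2)[OF w1] g(2)[OF w1] complex_cnj_mult power_mult_distrib by (simp only: ac_simps)
      then show ?thesis by (simp only: ww)
    qed
    have "(LINT z|lborel. ?F z) = (LINT z|distr lborel borel (\<lambda>z. w * z). ?F z)"
      by (simp only: lborel_distr_rotate[OF w1 \<open>Im w \<noteq> 0\<close>])
    also have "\<dots> = (LINT z|lborel. ?F (w * z))"
      by (rule integral_distr[OF _ F]) measurable
    also have "\<dots> = w ^ m * (LINT z|lborel. ?F z)" unfolding Fw by (rule integral_mult_right_zero)
    finally have "(LINT z|lborel. ?F z) = w ^ m * (LINT z|lborel. ?F z)" .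
    moreover have "I = 0" if "I = w ^ m * I" for I :: complex using that wm by simp
    ultimately show ?thesis by blast
  qed
  show ?thesis by (rule orthogonal_by_conjugation[OF kl *])
qed

section \<open>Orthogonality on circles and uniqueness of Taylor coefficients\<close>

lemma kern_0 [simp]: "kern \<rho> 0 t = 1"
  by (simp add: kern_def)

lemma wt_integral: "(LINT t|lborel. wt t) = 1"
proof -
  have "(LINT t|lborel. complex_of_real (wt t) * kern (1/2) 0 t * 1) = 1"
    by (rule cauchy_circle[of "\<lambda>_. 1" "1/2" 0]) (auto intro!: holomorphic_intros)
  then have "complex_of_real (LINT t|lborel. wt t) = 1" by (simp add: integral_complex_of_real)
  then show ?thesis by (simp only: of_real_eq_1_iff)
qed

text \<open>At the centre \<open>kern\<close> is 1 and Cauchy's formula becomes the mean value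
  property; for w^m with m > 0 it gives mean 0. The radius only contributes the constant factor r^(k
  + l).\<close>

lemma circle_orthogonal:
  fixes r :: real
  assumes "k \<noteq> l"
  shows "(LINT t|lborel. complex_of_real (wt t) * ((r * cis t) ^ k * cnj (r * cis t) ^ l)) = 0"
proof -
  have pos: "(LINT t|lborel. complex_of_real (wt t) * cis t ^ m) = 0" if m: "m > 0" for m
  proof -
    have "(LINT t|lborel. complex_of_real (wt t) * kern (1/2) 0 t * (complex_of_real (1/2) * cis t) ^ m) = 0 ^ m"
      by (rule cauchy_circle[of "\<lambda>w. w ^ m" "1/2" 0]) (auto intro!: holomorphic_intros)
    moreover have "complex_of_real (wt t) * kern (1/2) 0 t * (complex_of_real (1/2) * cis t) ^ m
       = (complex_of_real (1/2)) ^ m * (complex_of_real (wt t) * cis t ^ m)" for t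
      by (simp only: kern_0 power_mult_distrib ac_simps mult_1_left mult_1_right)
    ultimately have "(complex_of_real (1/2)) ^ m * (LINT t|lborel. complex_of_real (wt t) * cis t ^ m) = 0"
      using m by (simp only: integral_mult_right_zero zero_power)
    then show ?thesis by simp
  qed
  have *: "(LINT t|lborel. complex_of_real (wt t) * ((r * cis t) ^ k * cnj (r * cis t) ^ l)) = 0" if kl: "k > l" for k l
  proof -
    have "complex_of_real (wt t) * ((r * cis t) ^ k * cnj (r * cis t) ^ l)
       = complex_of_real (r ^ (k + l)) * (complex_of_real (wt t) * cis t ^ (k - l))" for t
    proof -
      have "cis t ^ k = cis t ^ (k - l) * cis t ^ l" using kl by (simp flip: power_add)
      moreover have "cis t ^ l * cnj (cis t) ^ l = 1" by (simp add: cis_cnj cis_mult flip: power_mult_distrib)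
      ultimately have "cis t ^ k * cnj (cis t) ^ l = cis t ^ (k - l)" by (simp only: mult.assoc mult_1_right)
      then show ?thesis by (simp add: power_mult_distrib power_add)
    qed
    then have "(LINT t|lborel. complex_of_real (wt t) * ((r * cis t) ^ k * cnj (r * cis t) ^ l))
       = complex_of_real (r ^ (k + l)) * (LINT t|lborel. complex_of_real (wt t) * cis t ^ (k - l))"
      by (simp only: integral_mult_right_zero)
    then show ?thesis using pos[of "k - l"] kl by simp
  qed
  show ?thesis by (rule orthogonal_by_conjugation[OF assms *])
qed

lemma circle_measurable: "(\<lambda>t. complex_of_real r * cis t) \<in> borel_measurable borel"
  by measurable

lemma parseval_circle:
  fixes f :: "complex^'n::finite \<Rightarrow> complex"
  assumes "taylor_on R f a" "0 \<le> r" "r < R"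
  shows "(\<integral>\<^sup>+x. ennreal ((\<Prod>i\<in>UNIV. wt (x i)) * (cmod (f (\<chi> i. r * cis (x i))))\<^sup>2) \<partial>Pi\<^sub>M UNIV (\<lambda>_. lborel))
    = (SUP N. ennreal (\<Sum>\<alpha>\<in>exps N. (cmod (a \<alpha>))\<^sup>2 * (\<Prod>i\<in>UNIV. r ^ (2 * \<alpha> i))))"
proof -
  show ?thesis
    using parseval[OF assms wt_integrable wt_nonneg circle_measurable[of r] _ circle_orthogonal[of _ _ r]] assms(2)
    by (simp add: norm_mult wt_integral)
qed

lemma taylor_on_diff:
  fixes f g :: "complex^'n::finite \<Rightarrow> complex"
  assumes "taylor_on R f a" "taylor_on R g b"
  shows "taylor_on R (\<lambda>z. f z - g z) (\<lambda>\<alpha>. a \<alpha> - b \<alpha>)"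
  unfolding taylor_on_def
proof (intro allI impI)
  fix z :: "complex^'n" assume z: "\<forall>i. cmod (z $ i) < R"
  have "((\<lambda>\<alpha>. a \<alpha> * zpow \<alpha> z) has_sum f z) UNIV" "((\<lambda>\<alpha>. b \<alpha> * zpow \<alpha> z) has_sum g z) UNIV"
    using assms z by (auto simp: taylor_on_def)
  then have "((\<lambda>\<alpha>. a \<alpha> * zpow \<alpha> z + - (b \<alpha> * zpow \<alpha> z)) has_sum (f z + - g z)) UNIV"
    by (intro has_sum_add) (simp_all add: has_sum_uminus)
  then show "((\<lambda>\<alpha>. (a \<alpha> - b \<alpha>) * zpow \<alpha> z) has_sum (f z - g z)) UNIV"
    by (simp add: algebra_simps)
qed

lemma taylor_on_subset: "taylor_on R f a \<Longrightarrow> R' \<le> R \<Longrightarrow> taylor_on R' f a"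
  unfolding taylor_on_def by (meson less_le_trans)

text \<open>The coefficient differences form an expansion of the zero function, and Parseval on the
  torus of radius R/2 makes every one of them vanish.\<close>

lemma taylor_unique:
  fixes a b :: "('n::finite \<Rightarrow> nat) \<Rightarrow> complex"
  assumes "taylor_on R f a" "taylor_on R f b" "0 < R"
  shows "a = b"
proof
  fix \<alpha> :: "'n \<Rightarrow> nat"
  define c where "c \<alpha> = a \<alpha> - b \<alpha>" for \<alpha>
  have "taylor_on R (\<lambda>z. 0) c" using taylor_on_diff[OF assms(1,2)] by (simp add: c_def[abs_def])
  from parseval_circle[OF this, of "R/2"] assms(3)
  have "0 = (SUP N. ennreal (\<Sum>\<alpha>\<in>exps N. (cmod (c \<alpha>))\<^sup>2 * (\<Prod>i\<in>UNIV. (R/2) ^ (2 * \<alpha> i))))" by simp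
  have z: "ennreal (\<Sum>\<alpha>\<in>exps N. (cmod (c \<alpha>))\<^sup>2 * (\<Prod>i\<in>UNIV. (R/2) ^ (2 * \<alpha> i))) = 0" for N
  proof -
    have "ennreal (\<Sum>\<alpha>\<in>exps N. (cmod (c \<alpha>))\<^sup>2 * (\<Prod>i\<in>UNIV. (R/2) ^ (2 * \<alpha> i))) \<le> 0"
      by (subst \<open>0 = _\<close>) (rule SUP_upper, simp)
    then show ?thesis by (simp only: le_zero_eq)
  qed
  obtain N where N: "\<alpha> \<in> exps N" using finite_subset_exps[of "{\<alpha>}"] by auto
  have nn: "0 \<le> (cmod (c \<alpha>))\<^sup>2 * (\<Prod>i\<in>UNIV. (R/2) ^ (2 * \<alpha> i))" for \<alpha>
    using assms(3) by (intro mult_nonneg_nonneg prod_nonneg) auto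
  have "(\<Sum>\<alpha>\<in>exps N. (cmod (c \<alpha>))\<^sup>2 * (\<Prod>i\<in>UNIV. (R/2) ^ (2 * \<alpha> i))) \<le> 0"
    using z[of N] by (simp only: ennreal_eq_0_iff)
  moreover have "(cmod (c \<alpha>))\<^sup>2 * (\<Prod>i\<in>UNIV. (R/2) ^ (2 * \<alpha> i)) \<le> (\<Sum>\<alpha>\<in>exps N. (cmod (c \<alpha>))\<^sup>2 * (\<Prod>i\<in>UNIV. (R/2) ^ (2 * \<alpha> i)))"
    by (rule member_le_sum[OF N nn]) auto
  ultimately have "(cmod (c \<alpha>))\<^sup>2 * (\<Prod>i\<in>UNIV. (R/2) ^ (2 * \<alpha> i)) \<le> 0" by linarith
  moreover have "0 < (\<Prod>i\<in>UNIV. (R/2) ^ (2 * \<alpha> i))" using assms(3) by (intro prod_pos) auto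
  ultimately have "c \<alpha> = 0" by (simp add: mult_le_0_iff)
  then show "a \<alpha> = b \<alpha>" by (simp add: c_def)
qed

text \<open>Coefficients obtained at different radii agree by uniqueness on the smaller polydisc, so
  the family found at radius 1/2 serves all points of the unit polydisc.\<close>

lemma taylor_exists:
  fixes f :: "complex^'n::finite \<Rightarrow> complex"
  assumes f: "holo_on f polydisc" "\<And>z. z \<notin> polydisc \<Longrightarrow> f z = 0"
  obtains a where "taylor_on 1 f a"
proof -
  obtain a where a: "taylor_on (1/2) f a" using taylor_exists_on[OF f, of "1/2"] by auto
  have "taylor_on 1 f a"
    unfolding taylor_on_def
  proof (intro allI impI)
    fix z :: "complex^'n" assume z: "\<forall>i. cmod (z $ i) < 1"
    \<comment> \<open>Including 1/2 in the maximum keeps \<rho> at least 1/2, so that the two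
      expansions can be compared on the polydisc of radius 1/2.\<close>
    define m where "m = Max (insert (1/2) (range (\<lambda>i. cmod (z $ i))))"
    have m: "m < 1" "1/2 \<le> m" "\<And>i. cmod (z $ i) \<le> m"
    proof -
      show "cmod (z $ i) \<le> m" for i unfolding m_def by (rule Max_ge) auto
    qed (use z in \<open>auto simp: m_def\<close>)
    define \<rho> where "\<rho> = (m + 1) / 2"
    have r: "0 < \<rho>" "\<rho> < 1" "1/2 \<le> \<rho>" "\<And>i. cmod (z $ i) < \<rho>"
    proof -
      show "cmod (z $ i) < \<rho>" for i using m(1) m(3)[of i] unfolding \<rho>_def by simp
    qed (use m in \<open>auto simp: \<rho>_def\<close>)
    obtain b where b: "taylor_on \<rho> f b" using taylor_exists_on[OF f r(1,2)] by blast
    have "b = a" by (rule taylor_unique[OF taylor_on_subset[OF b r(3)] a]) simp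
    then show "((\<lambda>\<alpha>. a \<alpha> * zpow \<alpha> z) has_sum f z) UNIV" using b r(4) by (simp add: taylor_on_def)
  qed
  then show ?thesis by (rule that)
qed

section \<open>Norms in terms of Taylor coefficients\<close>

lemma torus_integrand_measurable:
  fixes f :: "complex^'n::finite \<Rightarrow> complex"
  assumes "f \<in> borel_measurable borel"
  shows "(\<lambda>\<theta> :: real^'n. f (\<chi> i. complex_of_real r * cis (\<theta> $ i))) \<in> borel_measurable borel"
proof (rule measurable_compose[OF _ assms])
  show "(\<lambda>\<theta> :: real^'n. \<chi> i. complex_of_real r * cis (\<theta> $ i)) \<in> borel_measurable borel"
    by (rule vec_lambda_measurable) (intro borel_measurable_continuous_onI continuous_intros)
qed

lemma component_prod_measurable:
  fixes u :: "complex \<Rightarrow> real"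
  assumes "u \<in> borel_measurable borel"
  shows "(\<lambda>z :: complex^'n::finite. \<Prod>i\<in>UNIV. u (z $ i)) \<in> borel_measurable borel"
  by (rule borel_measurable_prod, rule measurable_compose[OF _ assms], intro borel_measurable_continuous_onI continuous_intros)

lemma bergman_integrand_measurable:
  fixes f :: "complex^'n::finite \<Rightarrow> complex"
  assumes "f \<in> borel_measurable borel"
  shows "(\<lambda>z. indicator polydisc z * ennreal ((cmod (f z))\<^sup>2 * (\<Prod>i\<in>UNIV. (1 - (cmod (z$i))\<^sup>2) powr (lam - 2)))) \<in> borel_measurable lborel"
proof -
  have "(\<lambda>z :: complex^'n. \<Prod>i\<in>UNIV. (1 - (cmod (z$i))\<^sup>2) powr (lam - 2)) \<in> borel_measurable borel"
    by (rule component_prod_measurable[of "\<lambda>x. (1 - (cmod x)\<^sup>2) powr (lam - 2)"]) measurable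
  moreover have "(polydisc :: (complex^'n) set) \<in> sets borel" using open_polydisc by (rule borel_open)
  ultimately show ?thesis using assms by measurable
qed

lemma ennreal_SUP_eq_limit:
  fixes s :: "nat \<Rightarrow> real"
  assumes "s \<longlonglongrightarrow> L" "\<And>k. s k \<le> L"
  shows "(SUP k. ennreal (s k)) = ennreal L"
proof (rule antisym)
  show "(SUP k. ennreal (s k)) \<le> ennreal L" using assms(2) by (intro SUP_least ennreal_leI)
  show "ennreal L \<le> (SUP k. ennreal (s k))"
    by (rule LIMSEQ_le_const2[OF tendsto_ennrealI[OF assms(1)]]) (intro exI[of _ 0] allI impI SUP_upper UNIV_I)
qed

text \<open>Parseval holds at each radius, and the suprema over \<open>r\<close> and over
  \<open>N\<close> commute; the limit r \<rightarrow> 1 is then taken inside finite sums.\<close>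

lemma hardy_norm:
  fixes f :: "complex^'n::finite \<Rightarrow> complex"
  assumes f: "f \<in> borel_measurable borel" and a: "taylor_on 1 f a"
  shows "bergman_nrm2 1 f = (SUP N. ennreal (\<Sum>\<alpha>\<in>exps N. (cmod (a \<alpha>))\<^sup>2))"
proof -
  define E where "E r N = ennreal (\<Sum>\<alpha>\<in>exps N. (cmod (a \<alpha>))\<^sup>2 * (\<Prod>i\<in>UNIV. r ^ (2 * \<alpha> i)))" for r N
  have circ: "ennreal (1 / (2*pi) ^ CARD('n)) * (\<integral>\<^sup>+ \<theta>. indicator (cbox (0::real^'n) (\<chi> i. 2*pi)) \<theta> *
              ennreal ((cmod (f (\<chi> i. complex_of_real r * cis (\<theta>$i))))\<^sup>2) \<partial>lborel) = (SUP N. E r N)"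
    if r: "r \<in> {0..<1}" for r
  proof -
    note fm = torus_integrand_measurable[OF f, of r]
    \<comment> \<open>The normalising constant and the indicator of the cube combine into the
      product of the densities \<open>wt\<close>, the form in which \<open>parseval_circle\<close>
      is stated.\<close>
    have pw: "ennreal (1 / (2*pi) ^ CARD('n)) * (indicator (cbox (0::real^'n) (\<chi> i. 2*pi)) \<theta> *
              ennreal ((cmod (f (\<chi> i. complex_of_real r * cis (\<theta>$i))))\<^sup>2))
        = ennreal ((\<Prod>i\<in>UNIV. wt (\<theta> $ i)) * (cmod (f (\<chi> i. complex_of_real r * cis (\<theta>$i))))\<^sup>2)" for \<theta> :: "real^'n"
    proof (cases "\<theta> \<in> cbox 0 (\<chi> i. 2*pi)")
      case True
      then have "wt (\<theta> $ i) = 1 / (2 * pi)" for i by (auto simp: wt_def mem_box_cart)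
      then show ?thesis using True by (simp add: power_divide flip: ennreal_mult')
    next
      case False
      have "\<not> (\<forall>i. \<theta> $ i \<in> {0..2*pi})" using False by (simp add: mem_box_cart)
      then obtain i where "\<theta> $ i \<notin> {0..2*pi}" by blast
      then have p0: "(\<Prod>i\<in>UNIV. wt (\<theta> $ i)) = 0" by (intro prod_zero bexI[of _ i]) (auto simp: wt_def)
      show ?thesis unfolding p0 using False by simp
    qed
    have wtm: "(\<lambda>\<theta> :: real^'n. \<Prod>i\<in>UNIV. wt (\<theta> $ i)) \<in> borel_measurable borel"
      by (rule borel_measurable_prod, rule measurable_compose[OF _ wt_measurable], intro borel_measurable_continuous_onI continuous_intros)
    have m1: "(\<lambda>\<theta>. indicator (cbox (0::real^'n) (\<chi> i. 2*pi)) \<theta> *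
              ennreal ((cmod (f (\<chi> i. complex_of_real r * cis (\<theta>$i))))\<^sup>2)) \<in> borel_measurable lborel"
      using fm by measurable
    have m2: "(\<lambda>\<theta> :: real^'n. ennreal ((\<Prod>i\<in>UNIV. wt (\<theta> $ i)) * (cmod (f (\<chi> i. complex_of_real r * cis (\<theta>$i))))\<^sup>2)) \<in> borel_measurable borel"
      using fm wtm by measurable
    have "ennreal (1 / (2*pi) ^ CARD('n)) * (\<integral>\<^sup>+ \<theta>. indicator (cbox (0::real^'n) (\<chi> i. 2*pi)) \<theta> *
              ennreal ((cmod (f (\<chi> i. complex_of_real r * cis (\<theta>$i))))\<^sup>2) \<partial>lborel)
      = (\<integral>\<^sup>+ \<theta>. ennreal ((\<Prod>i\<in>UNIV. wt (\<theta> $ i)) * (cmod (f (\<chi> i. complex_of_real r * cis (\<theta>$i))))\<^sup>2) \<partial>lborel)"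
      unfolding pw[symmetric] by (rule nn_integral_cmult[symmetric, OF m1])
    also have "\<dots> = (\<integral>\<^sup>+x. ennreal ((\<Prod>i\<in>UNIV. wt (x i)) * (cmod (f (\<chi> i. r * cis (x i))))\<^sup>2) \<partial>Pi\<^sub>M UNIV (\<lambda>_. lborel))"
      using nn_integral_lborel_vec[OF m2] by simp
    also have "\<dots> = (SUP N. E r N)"
      unfolding E_def by (rule parseval_circle[OF a]) (use r in auto)
    finally show ?thesis .
  qed
  have inner: "(SUP r\<in>{0..<1}. E r N) = ennreal (\<Sum>\<alpha>\<in>exps N. (cmod (a \<alpha>))\<^sup>2)" for N
  proof (rule antisym)
    show "(SUP r\<in>{0..<1}. E r N) \<le> ennreal (\<Sum>\<alpha>\<in>exps N. (cmod (a \<alpha>))\<^sup>2)"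
      unfolding E_def
    proof (intro SUP_least ennreal_leI sum_mono)
      fix r :: real and \<alpha> :: "'n \<Rightarrow> nat" assume "r \<in> {0..<1}"
      then have "(\<Prod>i\<in>UNIV. r ^ (2 * \<alpha> i)) \<le> 1" by (intro prod_le_1) (auto intro: power_le_one)
      then show "(cmod (a \<alpha>))\<^sup>2 * (\<Prod>i\<in>UNIV. r ^ (2 * \<alpha> i)) \<le> (cmod (a \<alpha>))\<^sup>2"
        by (intro mult_left_le) auto
    qed
    define r where "r k = 1 - 1 / real (Suc k)" for k
    have "r \<longlonglongrightarrow> 1 - 0" unfolding r_def by (rule tendsto_diff[OF tendsto_const]) (use LIMSEQ_inverse_real_of_nat in \<open>simp add: inverse_eq_divide\<close>)
    then have rl: "r \<longlonglongrightarrow> 1" by simp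
    have "(\<lambda>k. \<Sum>\<alpha>\<in>exps N. (cmod (a \<alpha>))\<^sup>2 * (\<Prod>i\<in>UNIV. r k ^ (2 * \<alpha> i))) \<longlonglongrightarrow> (\<Sum>\<alpha>\<in>exps N. (cmod (a \<alpha>))\<^sup>2 * (\<Prod>i\<in>UNIV. 1 ^ (2 * \<alpha> i)))"
      by (intro tendsto_intros rl)
    then have "(\<lambda>k. E (r k) N) \<longlonglongrightarrow> ennreal (\<Sum>\<alpha>\<in>exps N. (cmod (a \<alpha>))\<^sup>2)"
      unfolding E_def by (intro tendsto_ennrealI) simp
    then show "ennreal (\<Sum>\<alpha>\<in>exps N. (cmod (a \<alpha>))\<^sup>2) \<le> (SUP r\<in>{0..<1}. E r N)"
      by (rule LIMSEQ_le_const2) (intro exI[of _ 0] allI impI SUP_upper, simp add: r_def)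
  qed
  have "bergman_nrm2 1 f = (SUP r\<in>{0..<1}. SUP N. E r N)"
    unfolding bergman_nrm2_def if_P[OF refl] by (rule SUP_cong[OF refl circ])
  also have "\<dots> = (SUP N. SUP r\<in>{0..<1}. E r N)" by (rule SUP_commute)
  finally show ?thesis by (simp add: inner)
qed

section \<open>Moments of the radial Bergman weight\<close>

definition bw :: "real \<Rightarrow> complex \<Rightarrow> real" where
  "bw lam z = (if cmod z < 1 then (lam - 1) / pi * (1 - (cmod z)\<^sup>2) powr (lam - 2) else 0)"

lemma bw_nonneg: "1 < lam \<Longrightarrow> 0 \<le> bw lam z"
  by (simp add: bw_def)

lemma norm_sq_less_1: "cmod z < 1 \<longleftrightarrow> (cmod z)\<^sup>2 < 1"
  by (simp add: abs_square_less_1)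

lemma bw_pos: "1 < lam \<Longrightarrow> cmod z < 1 \<Longrightarrow> 0 < bw lam z"
  by (auto simp: bw_def norm_sq_less_1)

lemma bw_measurable [measurable]: "bw lam \<in> borel_measurable borel"
  unfolding bw_def by measurable

lemma emeasure_disc: "emeasure lborel (ball (0::complex) r) = ennreal (pi * r\<^sup>2)" if "0 \<le> r"
  using emeasure_ball[OF that, of "0::complex"] by (simp add: unit_ball_vol_2)

text \<open>Planar area is uniform in |z|^2, so a boundary layer of thickness \<open>x\<close> in
  that variable has area proportional to \<open>x\<close>.\<close>

lemma emeasure_annulus:
  assumes "0 \<le> x" "x \<le> 1"
  shows "emeasure lborel {z::complex. cmod z < 1 \<and> 1 - x \<le> (cmod z)\<^sup>2} = ennreal (pi * x)"
proof -
  define r where "r = sqrt (1 - x)"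
  have r0: "0 \<le> r" and r1: "r \<le> 1" and rr: "1 - x = r\<^sup>2" using assms by (auto simp: r_def)
  have iff: "(1 - x \<le> (cmod z)\<^sup>2) \<longleftrightarrow> r \<le> cmod z" for z
    unfolding rr by (rule power_mono_iff) (use r0 in auto)
  have set: "{z::complex. cmod z < 1 \<and> 1 - x \<le> (cmod z)\<^sup>2} = ball 0 1 - ball 0 r"
    unfolding iff by auto
  have e1: "emeasure lborel (ball (0::complex) 1) = ennreal pi" using emeasure_disc[of 1] by simp
  have e2: "emeasure lborel (ball (0::complex) r) = ennreal (pi * r\<^sup>2)" by (rule emeasure_disc[OF r0])
  have "emeasure lborel (ball 0 1 - ball (0::complex) r) = emeasure lborel (ball (0::complex) 1) - emeasure lborel (ball (0::complex) r)"
  proof (rule emeasure_Diff)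
    show "emeasure lborel (ball (0::complex) r) \<noteq> \<infinity>" unfolding e2 by simp
    show "ball 0 r \<subseteq> ball (0::complex) 1" by (rule subset_ball[OF r1])
  qed simp_all
  also have "\<dots> = ennreal (pi - pi * r\<^sup>2)" unfolding e1 e2 by (rule ennreal_minus) simp
  also have "pi - pi * r\<^sup>2 = pi * x" unfolding rr[symmetric] by (simp add: algebra_simps)
  finally show ?thesis by (simp only: set)
qed

text \<open>\<open>k\<close> is determined by 2^-(k+1) < x \<le> 2^-k. On such a dyadic layer the
  singular power is comparable to a constant.\<close>

lemma powr_dyadic_bound:
  fixes a x :: real
  assumes a: "0 \<le> a" and x: "0 < x" "x \<le> 1"
  shows "\<exists>k. x \<le> (1/2) ^ k \<and> x powr (-a) \<le> (2 powr a) ^ Suc k"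
proof -
  obtain m where "(1/2) ^ m < x" using real_arch_pow_inv[of x "1/2"] x by auto
  define k where "k = (LEAST m. (1/2) ^ Suc m < x)"
  have "(1/2::real) ^ Suc m \<le> (1/2) ^ m" by simp
  then have "(1/2) ^ Suc m < x" using \<open>(1/2) ^ m < x\<close> by (rule le_less_trans)
  then have k1: "(1/2) ^ Suc k < x" unfolding k_def by (rule LeastI)
  have k2: "x \<le> (1/2) ^ k"
  proof (cases k)
    case (Suc j)
    then have "\<not> (1/2) ^ Suc j < x" using not_less_Least[of j "\<lambda>m. (1/2) ^ Suc m < x"] by (simp add: k_def)
    then show ?thesis using Suc by simp
  qed (use x in simp)
  have "x powr (-a) \<le> ((1/2) ^ Suc k) powr (-a)"
    using k1 a by (intro powr_mono2') auto
  also have "(1/2) ^ Suc k = (2::real) powr (- real (Suc k))"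
    by (simp add: powr_minus powr_realpow power_one_over inverse_eq_divide del: of_nat_Suc)
  also have "\<dots> powr (-a) = 2 powr (a * real (Suc k))" by (simp only: powr_powr minus_mult_minus mult.commute)
  also have "\<dots> = (2 powr a) ^ Suc k" by (simp only: powr_powr[symmetric]) (rule powr_realpow, simp)
  finally show ?thesis using k2 by blast
qed

text \<open>For \<lambda> \<ge> 2 the weight is bounded. For \<lambda> < 2 it behaves like (1 -
  |z|^2)^-a at the circle with a = 2 - \<lambda> < 1. On the k-th dyadic layer it is at most a
  constant times 2^(a k), while the area is pi 2^-k, so the contributions form a geometric series of
  ratio 2^(a - 1) < 1.\<close>

lemma bw_integrable:
  assumes lam: "1 < lam" shows "integrable lborel (bw lam)"
proof -
  have "(\<integral>\<^sup>+z. ennreal (bw lam z) \<partial>lborel) < \<infinity>"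
  proof (cases "lam \<ge> 2")
    case True
    have "(\<integral>\<^sup>+z. ennreal (bw lam z) \<partial>lborel) \<le> (\<integral>\<^sup>+z. ennreal ((lam - 1) / pi) * indicator (ball (0::complex) 1) z \<partial>lborel)"
    proof (rule nn_integral_mono)
      fix z
      have p1: "(1 - (cmod z)\<^sup>2) powr (lam - 2) \<le> 1" if "cmod z < 1"
        using that True by (intro powr_le1) (auto simp: norm_sq_less_1)
      have "bw lam z \<le> (lam - 1) / pi" if "cmod z < 1"
        using mult_left_le[OF p1[OF that], of "(lam - 1) / pi"] that lam by (simp add: bw_def)
      then show "ennreal (bw lam z) \<le> ennreal ((lam - 1) / pi) * indicator (ball 0 1) z"
        by (cases "cmod z < 1") (simp_all add: ennreal_leI bw_def del: ennreal_le_iff)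
    qed
    also have "\<dots> = ennreal ((lam - 1) / pi) * ennreal pi"
      using emeasure_disc[of 1] by (simp add: nn_integral_cmult_indicator)
    also have "\<dots> < \<infinity>" by (simp add: ennreal_mult_less_top)
    finally show ?thesis .
  next
    case False
    define a where "a = 2 - lam"
    have a: "0 \<le> a" "a < 1" using False lam by (auto simp: a_def)
    define A where "A k = {z::complex. cmod z < 1 \<and> 1 - (1/2) ^ k \<le> (cmod z)\<^sup>2}" for k :: nat
    have Am: "A k \<in> sets borel" for k unfolding A_def by measurable
    have "(\<integral>\<^sup>+z. ennreal (bw lam z) \<partial>lborel) \<le> (\<integral>\<^sup>+z. (\<Sum>k. ennreal ((lam - 1) / pi * (2 powr a) ^ Suc k) * indicator (A k) z) \<partial>lborel)"
    proof (rule nn_integral_mono)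
      fix z
      show "ennreal (bw lam z) \<le> (\<Sum>k. ennreal ((lam - 1) / pi * (2 powr a) ^ Suc k) * indicator (A k) z)"
      proof (cases "cmod z < 1")
        case True
        have "0 < 1 - (cmod z)\<^sup>2" "1 - (cmod z)\<^sup>2 \<le> 1" using True by (auto simp: norm_sq_less_1)
        from powr_dyadic_bound[OF a(1) this] obtain k where
          k: "1 - (cmod z)\<^sup>2 \<le> (1/2) ^ k" "(1 - (cmod z)\<^sup>2) powr (-a) \<le> (2 powr a) ^ Suc k" by blast
        have "z \<in> A k" using k(1) True by (simp add: A_def)
        have "bw lam z = (lam - 1) / pi * (1 - (cmod z)\<^sup>2) powr (-a)" using True by (simp add: bw_def a_def)
        also have "\<dots> \<le> (lam - 1) / pi * (2 powr a) ^ Suc k" using k(2) lam by (intro mult_left_mono) auto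
        finally have "ennreal (bw lam z) \<le> ennreal ((lam - 1) / pi * (2 powr a) ^ Suc k) * indicator (A k) z"
          using \<open>z \<in> A k\<close> by (simp add: ennreal_leI)
        also have "\<dots> \<le> (\<Sum>k. ennreal ((lam - 1) / pi * (2 powr a) ^ Suc k) * indicator (A k) z)"
        proof -
          have h: "h k \<le> suminf h" for h :: "nat \<Rightarrow> ennreal"
            using sum_le_suminf[of h "{k}"] by simp
          show ?thesis by (rule h[of "\<lambda>k. ennreal ((lam - 1) / pi * (2 powr a) ^ Suc k) * indicator (A k) z"])
        qed
        finally show ?thesis .
      qed (simp add: bw_def)
    qed
    also have "\<dots> = (\<Sum>k. \<integral>\<^sup>+z. ennreal ((lam - 1) / pi * (2 powr a) ^ Suc k) * indicator (A k) z \<partial>lborel)"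
    proof (rule nn_integral_suminf)
      fix k
      have [measurable]: "A k \<in> sets lborel" using Am by simp
      show "(\<lambda>z. ennreal ((lam - 1) / pi * (2 powr a) ^ Suc k) * indicator (A k) z) \<in> borel_measurable lborel"
        by measurable
    qed
    also have "\<dots> = (\<Sum>k. ennreal ((lam - 1) / pi * (2 powr a) ^ Suc k) * ennreal (pi * (1/2) ^ k))"
    proof (rule suminf_cong)
      fix k
      have "emeasure lborel (A k) = ennreal (pi * (1/2) ^ k)"
        unfolding A_def by (rule emeasure_annulus) (auto intro: power_le_one)
      then show "(\<integral>\<^sup>+z. ennreal ((lam - 1) / pi * (2 powr a) ^ Suc k) * indicator (A k) z \<partial>lborel)
         = ennreal ((lam - 1) / pi * (2 powr a) ^ Suc k) * ennreal (pi * (1/2) ^ k)"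
        using Am by (subst nn_integral_cmult_indicator) auto
    qed
    also have "\<dots> = (\<Sum>k. ennreal ((lam - 1) * 2 powr a * (2 powr a / 2) ^ k))"
    proof (rule suminf_cong)
      fix k
      have gen: "(lam - 1) / pi * b ^ Suc k * (pi * (1/2) ^ k) = (lam - 1) * b * (b / 2) ^ k" for b :: real
        by (simp add: power_divide)
      have "(lam - 1) / pi * (2 powr a) ^ Suc k * (pi * (1/2) ^ k) = (lam - 1) * 2 powr a * (2 powr a / 2) ^ k"
        by (rule gen)
      then show "ennreal ((lam - 1) / pi * (2 powr a) ^ Suc k) * ennreal (pi * (1/2) ^ k) = ennreal ((lam - 1) * 2 powr a * (2 powr a / 2) ^ k)"
        using lam by (subst ennreal_mult[symmetric]) auto
    qed
    also have "\<dots> < \<infinity>"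
    proof -
      have "2 powr a < 2 powr 1" using a by (intro powr_less_mono) auto
      then have "summable (\<lambda>k. (lam - 1) * 2 powr a * (2 powr a / 2) ^ k)"
        by (intro summable_mult summable_geometric) simp
      then have "(\<Sum>k. ennreal ((lam - 1) * 2 powr a * (2 powr a / 2) ^ k)) \<noteq> top"
        using lam by (intro ennreal_suminf_neq_top) auto
      then show ?thesis by (simp add: less_top)
    qed
    finally show ?thesis .
  qed
  then show ?thesis
    using bw_nonneg[OF lam] by (intro integrableI_nonneg) auto
qed

text \<open>The squared norm of z^k in the one-variable weighted Bergman space. Positivity,
  monotonicity and the ratio of neighbours are all read off this integral.\<close>

definition bmom :: "real \<Rightarrow> nat \<Rightarrow> real" where
  "bmom lam k = (LINT z|lborel. bw lam z * cmod z ^ (2 * k))"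

lemma bmom_integrable:
  assumes "1 < lam" shows "integrable lborel (\<lambda>z. bw lam z * cmod z ^ (2 * k))"
proof (rule Bochner_Integration.integrable_bound[OF bw_integrable[OF assms]])
  show "AE z in lborel. norm (bw lam z * cmod z ^ (2 * k)) \<le> norm (bw lam z)"
  proof (intro AE_I2)
    fix z :: complex
    have "bw lam z * cmod z ^ (2 * k) \<le> bw lam z"
    proof (cases "cmod z < 1")
      case True
      then show ?thesis using bw_nonneg[OF assms, of z] by (intro mult_left_le power_le_one) auto
    qed (simp add: bw_def)
    then show "norm (bw lam z * cmod z ^ (2 * k)) \<le> norm (bw lam z)" using bw_nonneg[OF assms, of z] by simp
  qed
qed simp

lemma bmom_Suc_le: "1 < lam \<Longrightarrow> bmom lam (Suc k) \<le> bmom lam k"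
  unfolding bmom_def
proof (rule integral_mono[OF bmom_integrable bmom_integrable])
  fix z :: complex assume "1 < lam"
  show "bw lam z * cmod z ^ (2 * Suc k) \<le> bw lam z * cmod z ^ (2 * k)"
  proof (cases "cmod z < 1")
    case True
    then show ?thesis using bw_nonneg[OF \<open>1 < lam\<close>, of z] by (intro mult_left_mono power_decreasing) auto
  qed (simp add: bw_def)
qed

lemma bw_annulus_pos:
  assumes lam: "1 < lam" and s: "0 < s" "s < 1"
  shows "0 < (LINT z|lborel. bw lam z * indicator {z. s \<le> (cmod z)\<^sup>2} z)"
    and "integrable lborel (\<lambda>z. bw lam z * indicator {z. s \<le> (cmod z)\<^sup>2} z)"
proof -
  let ?A = "{z::complex. s \<le> (cmod z)\<^sup>2}"
  have A: "?A \<in> sets lborel" by measurable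
  show int: "integrable lborel (\<lambda>z. bw lam z * indicator ?A z)"
    using integrable_mult_indicator[OF A bw_integrable[OF lam]] by (simp add: mult.commute)
  have nn: "0 \<le> bw lam z * indicator ?A z" for z using bw_nonneg[OF lam] by simp
  have "(LINT z|lborel. bw lam z * indicator ?A z) \<noteq> 0"
  proof
    assume "(LINT z|lborel. bw lam z * indicator ?A z) = 0"
    then have "AE z in lborel. bw lam z * indicator ?A z = 0"
      using integral_nonneg_eq_0_iff_AE[OF int] nn by auto
    \<comment> \<open>The weight is positive inside the disc, so a zero integral would make the
      annulus null; \<open>1 - (1 - s)\<close> brings it into the shape of
      \<open>emeasure_annulus\<close>.\<close>
    then have "AE z in lborel. z \<notin> {z::complex. cmod z < 1 \<and> 1 - (1 - s) \<le> (cmod z)\<^sup>2}"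
    proof eventually_elim
      case (elim z)
      show ?case
      proof
        assume "z \<in> {z::complex. cmod z < 1 \<and> 1 - (1 - s) \<le> (cmod z)\<^sup>2}"
        then show False using elim bw_pos[OF lam, of z] by simp
      qed
    qed
    moreover have "{z::complex. cmod z < 1 \<and> 1 - (1 - s) \<le> (cmod z)\<^sup>2} \<in> sets lborel" by measurable
    ultimately have "emeasure lborel {z::complex. cmod z < 1 \<and> 1 - (1 - s) \<le> (cmod z)\<^sup>2} = 0"
      by (subst (asm) AE_iff_measurable) auto
    then show False using emeasure_annulus[of "1 - s"] s by simp
  qed
  moreover have "0 \<le> (LINT z|lborel. bw lam z * indicator ?A z)" using nn by (rule Bochner_Integration.integral_nonneg)
  ultimately show "0 < (LINT z|lborel. bw lam z * indicator ?A z)" by linarith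
qed

text \<open>Only the mass in s \<le> |z|^2 is kept. Together with a positive annular mass this shows
  that the moments dominate t^k for every t < s.\<close>

lemma bmom_lower:
  assumes lam: "1 < lam" and s: "0 < s" "s < 1"
  shows "s ^ k * (LINT z|lborel. bw lam z * indicator {z. s \<le> (cmod z)\<^sup>2} z) \<le> bmom lam k"
  unfolding bmom_def Bochner_Integration.integral_mult_right_zero[symmetric]
proof (rule integral_mono[OF _ bmom_integrable[OF lam]])
  show "integrable lborel (\<lambda>z. s ^ k * (bw lam z * indicator {z. s \<le> (cmod z)\<^sup>2} z))"
    using bw_annulus_pos(2)[OF assms] by (rule integrable_mult_right)
  fix z :: complex
  show "s ^ k * (bw lam z * indicator {z. s \<le> (cmod z)\<^sup>2} z) \<le> bw lam z * cmod z ^ (2 * k)"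
  proof (cases "s \<le> (cmod z)\<^sup>2")
    case True
    then have "s ^ k \<le> ((cmod z)\<^sup>2) ^ k" using s by (intro power_mono) auto
    then have "bw lam z * s ^ k \<le> bw lam z * ((cmod z)\<^sup>2) ^ k"
      using bw_nonneg[OF lam, of z] by (rule mult_left_mono)
    moreover have "s ^ k * (bw lam z * indicator {z. s \<le> (cmod z)\<^sup>2} z) = bw lam z * s ^ k" using True by simp
    ultimately show ?thesis by (simp only: power_mult)
  qed (use bw_nonneg[OF lam, of z] in simp)
qed

lemma bmom_pos:
  assumes "1 < lam" shows "0 < bmom lam k"
proof -
  have "0 < (1/2) ^ k * (LINT z|lborel. bw lam z * indicator {z. 1/2 \<le> (cmod z)\<^sup>2} z)"
    using bw_annulus_pos(1)[OF assms, of "1/2"] by simp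
  also have "\<dots> \<le> bmom lam k" using bmom_lower[OF assms, of "1/2" k] by simp
  finally show ?thesis .
qed

text \<open>With x = |z|^2 the estimate t (x^k - t^k) \<le> x^(k+1) holds pointwise: for x \<ge> t
  since one factor x is at least t, and for x < t since the left side is not positive.\<close>

lemma bmom_Suc_ge:
  assumes lam: "1 < lam" and t: "0 < t" "t < 1"
  shows "t * (bmom lam k - t ^ k * bmom lam 0) \<le> bmom lam (Suc k)"
proof -
  have "t * (bmom lam k - t ^ k * bmom lam 0) = (LINT z|lborel. t * (bw lam z * cmod z ^ (2 * k) - t ^ k * (bw lam z * cmod z ^ (2 * 0))))"
    unfolding bmom_def Bochner_Integration.integral_mult_right_zero
    by (subst Bochner_Integration.integral_diff[OF bmom_integrable[OF lam] integrable_mult_right[OF bmom_integrable[OF lam]]])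
       (simp only: Bochner_Integration.integral_mult_right_zero)
  also have "\<dots> \<le> bmom lam (Suc k)"
    unfolding bmom_def
  proof (rule integral_mono[OF _ bmom_integrable[OF lam]])
    show "integrable lborel (\<lambda>z. t * (bw lam z * cmod z ^ (2 * k) - t ^ k * (bw lam z * cmod z ^ (2 * 0))))"
      by (intro integrable_mult_right Bochner_Integration.integrable_diff bmom_integrable[OF lam])
    fix z :: complex
    have p: "t * ((cmod z)\<^sup>2 ^ k - t ^ k) \<le> (cmod z)\<^sup>2 ^ Suc k"
    proof (cases "t \<le> (cmod z)\<^sup>2")
      case True
      have "t * ((cmod z)\<^sup>2 ^ k - t ^ k) \<le> t * (cmod z)\<^sup>2 ^ k" using t by (intro mult_left_mono) auto
      also have "\<dots> \<le> (cmod z)\<^sup>2 * (cmod z)\<^sup>2 ^ k" using True by (intro mult_right_mono) auto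
      finally show ?thesis by simp
    next
      case False
      then have "(cmod z)\<^sup>2 ^ k \<le> t ^ k" by (intro power_mono) auto
      then have "t * ((cmod z)\<^sup>2 ^ k - t ^ k) \<le> 0" using t by (simp add: mult_le_0_iff)
      also have "0 \<le> (cmod z)\<^sup>2 ^ Suc k" by simp
      finally show ?thesis .
    qed
    have "bw lam z * (t * ((cmod z)\<^sup>2 ^ k - t ^ k)) \<le> bw lam z * (cmod z)\<^sup>2 ^ Suc k"
      using p bw_nonneg[OF lam, of z] by (rule mult_left_mono)
    then show "t * (bw lam z * cmod z ^ (2 * k) - t ^ k * (bw lam z * cmod z ^ (2 * 0))) \<le> bw lam z * cmod z ^ (2 * Suc k)"
      by (simp only: power_mult) (simp add: algebra_simps)
  qed
  finally show ?thesis .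
qed

text \<open>Monotonicity bounds the ratio by 1. From below, with a < t < s < 1, the correction t^k
  in \<open>bmom_Suc_ge\<close> is negligible against the lower bound s^k of
  \<open>bmom_lower\<close>, so the ratio eventually exceeds a.\<close>

lemma bmom_ratio:
  assumes lam: "1 < lam" shows "(\<lambda>k. bmom lam (Suc k) / bmom lam k) \<longlonglongrightarrow> 1"
proof (rule order_tendstoI)
  fix a :: real assume "a > 1"
  show "\<forall>\<^sub>F k in sequentially. bmom lam (Suc k) / bmom lam k < a"
  proof (intro always_eventually allI)
    fix k
    have "bmom lam (Suc k) / bmom lam k \<le> 1" using bmom_Suc_le[OF lam] bmom_pos[OF lam, of k] by simp
    then show "bmom lam (Suc k) / bmom lam k < a" using \<open>a > 1\<close> by simp
  qed
next
  fix a :: real assume a: "a < 1"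
  \<comment> \<open>The maximum with 0 keeps \<open>t\<close> positive when \<open>a\<close> is
    negative.\<close>
  define t where "t = (max a 0 + 1) / 2"
  have t: "0 < t" "t < 1" "a < t" using a by (auto simp: t_def)
  define s where "s = (t + 1) / 2"
  have s: "0 < s" "s < 1" "t < s" using t by (auto simp: s_def)
  define c where "c = (LINT z|lborel. bw lam z * indicator {z. s \<le> (cmod z)\<^sup>2} z)"
  have c: "0 < c" unfolding c_def using bw_annulus_pos(1)[OF lam s(1,2)] .
  have low: "t * (1 - (t / s) ^ k * (bmom lam 0 / c)) \<le> bmom lam (Suc k) / bmom lam k" for k
  proof -
    have sk: "s ^ k * c \<le> bmom lam k" unfolding c_def by (rule bmom_lower[OF lam s(1,2)])
    have "t ^ k * bmom lam 0 / bmom lam k \<le> t ^ k * bmom lam 0 / (s ^ k * c)"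
      using sk s c t bmom_pos[OF lam] by (intro divide_left_mono) (auto intro: less_imp_le)
    then have "t * (1 - (t / s) ^ k * (bmom lam 0 / c)) \<le> t * (1 - t ^ k * bmom lam 0 / bmom lam k)"
      using t by (intro mult_left_mono) (auto simp: power_divide)
    also have "\<dots> = t * (bmom lam k - t ^ k * bmom lam 0) / bmom lam k"
      using bmom_pos[OF lam, of k] by (simp add: field_simps)
    also have "\<dots> \<le> bmom lam (Suc k) / bmom lam k"
      using bmom_Suc_ge[OF lam t(1,2)] bmom_pos[OF lam, of k] by (intro divide_right_mono) auto
    finally show ?thesis .
  qed
  have "(\<lambda>k. t * (1 - (t / s) ^ k * (bmom lam 0 / c))) \<longlonglongrightarrow> t * (1 - 0 * (bmom lam 0 / c))"
    using t s by (intro tendsto_intros LIMSEQ_power_zero) auto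
  then have "(\<lambda>k. t * (1 - (t / s) ^ k * (bmom lam 0 / c))) \<longlonglongrightarrow> t" by simp
  then have "\<forall>\<^sub>F k in sequentially. a < t * (1 - (t / s) ^ k * (bmom lam 0 / c))"
    using t(3) by (rule order_tendstoD)
  then show "\<forall>\<^sub>F k in sequentially. a < bmom lam (Suc k) / bmom lam k"
    by eventually_elim (use low in \<open>blast intro: less_le_trans\<close>)
qed

text \<open>The weight charges points arbitrarily close to the boundary, where the Taylor series
  need not be bounded. Parseval is therefore applied on discs of radius R k < 1, and monotone
  convergence removes the truncation.\<close>

lemma bergman_norm:
  fixes f :: "complex^'n::finite \<Rightarrow> complex"
  assumes lam: "1 < lam" and f: "f \<in> borel_measurable borel" and a: "taylor_on 1 f a"
  shows "bergman_nrm2 lam f = (SUP N. ennreal (\<Sum>\<alpha>\<in>exps N. (cmod (a \<alpha>))\<^sup>2 * (\<Prod>i\<in>UNIV. bmom lam (\<alpha> i))))"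
proof -
  define R where "R k = 1 - 1 / real (Suc k)" for k
  have R: "0 \<le> R k" "R k < 1" for k by (auto simp: R_def)
  have Rinc: "R k \<le> R l" if "k \<le> l" for k l using that unfolding R_def by (simp add: frac_le)
  have "R \<longlonglongrightarrow> 1 - 0" unfolding R_def
    by (rule tendsto_diff[OF tendsto_const]) (use LIMSEQ_inverse_real_of_nat in \<open>simp add: inverse_eq_divide\<close>)
  then have Rlim: "R \<longlonglongrightarrow> 1" by simp
  have Rex: "\<exists>k. x \<le> R k" if x: "x < 1" for x
  proof -
    obtain k where "x < R k" using order_tendstoD(1)[OF Rlim x] unfolding eventually_sequentially by blast
    then show ?thesis by (intro exI[of _ k]) simp
  qed
  define tb where "tb k z = (if cmod z \<le> R k then bw lam z else 0)" for k z
  \<comment> \<open>Sending the coordinate to 0 beyond the cut-off is harmless because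
    \<open>tb\<close> vanishes there, and it provides the global bound |tg| \<le> R k required by
    \<open>parseval\<close>.\<close>
  define tg where "tg k z = (if cmod z \<le> R k then z else 0)" for k z
  have [measurable]: "tb k \<in> borel_measurable borel" "tg k \<in> borel_measurable borel" for k
    unfolding tb_def tg_def by measurable
  have tb_nn: "0 \<le> tb k z" for k z using bw_nonneg[OF lam] by (simp add: tb_def)
  have tb_le: "tb k z \<le> bw lam z" for k z using bw_nonneg[OF lam] by (simp add: tb_def)
  have tb_mono: "tb k z \<le> tb l z" if "k \<le> l" for k l z
    using bw_nonneg[OF lam] Rinc[OF that] by (auto simp: tb_def)
  have tb_int: "integrable lborel (tb k)" for k
    by (rule Bochner_Integration.integrable_bound[OF bw_integrable[OF lam]])
       (use tb_nn tb_le bw_nonneg[OF lam] in auto)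
  define tm where "tm k j = (LINT z|lborel. tb k z * cmod (tg k z) ^ (2 * j))" for k j
  have tm_eq: "tb k z * cmod (tg k z) ^ (2 * j) = tb k z * cmod z ^ (2 * j)" for k z j
    by (simp add: tb_def tg_def)
  have tbj: "norm (tb k z * cmod z ^ (2 * j)) \<le> bw lam z * cmod z ^ (2 * j)" for k z j
    using tb_nn tb_le by (simp add: mult_right_mono)
  have tm_lim: "(\<lambda>k. tm k j) \<longlonglongrightarrow> bmom lam j" for j
    unfolding tm_def bmom_def tm_eq
  proof (rule integral_dominated_convergence[OF _ _ bmom_integrable[OF lam]])
    show "AE z in lborel. (\<lambda>k. tb k z * cmod z ^ (2 * j)) \<longlonglongrightarrow> bw lam z * cmod z ^ (2 * j)"
    proof (intro AE_I2)
      fix z :: complex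
      have "(\<lambda>k. tb k z) \<longlonglongrightarrow> bw lam z"
      proof (cases "cmod z < 1")
        case True
        then obtain K where K: "cmod z \<le> R K" using Rex by blast
        have "tb k z = bw lam z" if "k \<ge> K" for k using K Rinc[OF that] by (simp add: tb_def)
        then show ?thesis by (intro tendsto_eventually eventually_sequentiallyI[of K]) 
      next
        case False
        then have "tb k z = bw lam z" for k by (simp add: tb_def bw_def)
        then show ?thesis by simp
      qed
      then show "(\<lambda>k. tb k z * cmod z ^ (2 * j)) \<longlonglongrightarrow> bw lam z * cmod z ^ (2 * j)"
        by (intro tendsto_mult tendsto_const)
    qed
    show "AE z in lborel. norm (tb k z * cmod z ^ (2 * j)) \<le> bw lam z * cmod z ^ (2 * j)" for k
      using tbj by (intro AE_I2)
  qed measurable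
  have tm_int: "integrable lborel (\<lambda>z. tb k z * cmod z ^ (2 * j))" for k j
    by (rule Bochner_Integration.integrable_bound[OF bmom_integrable[OF lam, of j]])
       (use tbj bw_nonneg[OF lam] in auto)
  have tm_le: "tm k j \<le> bmom lam j" for k j
    unfolding tm_def bmom_def tm_eq
    by (rule integral_mono[OF tm_int bmom_integrable[OF lam]]) (rule mult_right_mono[OF tb_le], simp)
  have tm_nn: "0 \<le> tm k j" for k j
    unfolding tm_def tm_eq by (rule Bochner_Integration.integral_nonneg) (use tb_nn in simp)
  define G where "G z = ennreal ((\<Prod>i\<in>UNIV. bw lam (z $ i)) * (cmod (f z))\<^sup>2)" for z :: "complex^'n"
  define F where "F k z = ennreal ((\<Prod>i\<in>UNIV. tb k (z $ i)) * (cmod (f z))\<^sup>2)" for k and z :: "complex^'n"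
  define c where "c = (lam - 1) / pi"
  have c: "0 \<le> c" using lam by (simp add: c_def)
  have Fm: "F k \<in> borel_measurable borel" for k
    unfolding F_def using component_prod_measurable[of "tb k"] f by measurable
  note Hm = bergman_integrand_measurable[OF f, of lam]
  have "bergman_nrm2 lam f = (\<integral>\<^sup>+ z. ennreal (c ^ CARD('n)) * (indicator polydisc z *
           ennreal ((cmod (f z))\<^sup>2 * (\<Prod>i\<in>UNIV. (1 - (cmod (z$i))\<^sup>2) powr (lam - 2)))) \<partial>lborel)"
    using lam nn_integral_cmult[OF Hm] by (simp add: bergman_nrm2_def c_def)
  also have "\<dots> = (\<integral>\<^sup>+ z. G z \<partial>lborel)"
  proof (rule nn_integral_cong)
    fix z :: "complex^'n"
    show "ennreal (c ^ CARD('n)) * (indicator polydisc z *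
           ennreal ((cmod (f z))\<^sup>2 * (\<Prod>i\<in>UNIV. (1 - (cmod (z$i))\<^sup>2) powr (lam - 2)))) = G z"
    proof (cases "z \<in> polydisc")
      case True
      then have "bw lam (z $ i) = c * (1 - (cmod (z$i))\<^sup>2) powr (lam - 2)" for i by (simp add: polydisc_def bw_def c_def)
      then show ?thesis using True c by (simp add: G_def prod.distrib mult.commute mult.left_commute flip: ennreal_mult')
    next
      case False
      then obtain i where "\<not> cmod (z $ i) < 1" by (auto simp: polydisc_def)
      then have p0: "(\<Prod>i\<in>UNIV. bw lam (z $ i)) = 0" by (intro prod_zero bexI[of _ i]) (auto simp: bw_def)
      show ?thesis unfolding G_def p0 using False by simp
    qed
  qed
  also have "\<dots> = (\<integral>\<^sup>+ z. (SUP k. F k z) \<partial>lborel)"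
  proof (rule nn_integral_cong)
    fix z :: "complex^'n"
    have le: "F k z \<le> G z" for k unfolding F_def G_def
      using tb_nn tb_le by (intro ennreal_leI mult_right_mono prod_mono) auto
    \<comment> \<open>There are finitely many coordinates, so one truncation level covers them all
      and the supremum is attained at each point.\<close>
    have "\<exists>k. F k z = G z"
    proof (cases "z \<in> polydisc")
      case True
      then have "\<forall>i. \<exists>k. cmod (z $ i) \<le> R k" using Rex by (simp add: polydisc_def)
      then obtain K where K: "\<And>i. cmod (z $ i) \<le> R (K i)" by metis
      have "cmod (z $ i) \<le> R (Max (range K))" for i by (rule order_trans[OF K Rinc]) (rule Max_ge, auto)
      then have "tb (Max (range K)) (z $ i) = bw lam (z $ i)" for i by (simp add: tb_def)
      then show ?thesis by (intro exI[of _ "Max (range K)"]) (simp add: F_def G_def)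
    next
      case False
      then obtain i where i: "\<not> cmod (z $ i) < 1" by (auto simp: polydisc_def)
      then have b0: "(\<Prod>i\<in>UNIV. bw lam (z $ i)) = 0" by (intro prod_zero bexI[of _ i]) (auto simp: bw_def)
      have t0: "(\<Prod>i\<in>UNIV. tb 0 (z $ i)) = 0" using i by (intro prod_zero bexI[of _ i]) (auto simp: bw_def tb_def)
      show ?thesis unfolding F_def G_def by (rule exI[of _ 0]) (simp only: b0 t0)
    qed
    then obtain k where k: "F k z = G z" by blast
    show "G z = (SUP k. F k z)"
    proof (rule antisym)
      show "G z \<le> (SUP k. F k z)" unfolding k[symmetric] by (rule SUP_upper) simp
      show "(SUP k. F k z) \<le> G z" using le by (rule SUP_least)
    qed
  qed
  also have "\<dots> = (SUP k. \<integral>\<^sup>+ z. F k z \<partial>lborel)"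
  proof (rule nn_integral_monotone_convergence_SUP)
    show "incseq F"
    proof (rule incseq_SucI, rule le_funI)
      fix k z show "F k z \<le> F (Suc k) z" unfolding F_def
        using tb_nn tb_mono[of k "Suc k"] by (intro ennreal_leI mult_right_mono prod_mono) auto
    qed
  qed (use Fm in simp)
  also have "\<dots> = (SUP k. SUP N. ennreal (\<Sum>\<alpha>\<in>exps N. (cmod (a \<alpha>))\<^sup>2 * (\<Prod>i\<in>UNIV. tm k (\<alpha> i))))"
  proof (rule SUP_cong[OF refl])
    fix k
    have rot: "cmod (w * z) = cmod z" if "cmod w = 1" for w z :: complex using that by (simp add: norm_mult)
    have bwrot: "bw lam (w * z) = bw lam z" if "cmod w = 1" for w z using rot[OF that] by (simp add: bw_def)
    have "(\<integral>\<^sup>+ z. F k z \<partial>lborel) = (\<integral>\<^sup>+x. F k (\<chi> i. x i) \<partial>Pi\<^sub>M UNIV (\<lambda>_. lborel))"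
      by (rule nn_integral_lborel_vec[OF Fm])
    also have "\<dots> = (\<integral>\<^sup>+x. ennreal ((\<Prod>i\<in>UNIV. tb k (x i)) * (cmod (f (\<chi> i. tg k (x i))))\<^sup>2) \<partial>Pi\<^sub>M UNIV (\<lambda>_. lborel))"
    proof (rule nn_integral_cong)
      fix x :: "'n \<Rightarrow> complex"
      show "F k (\<chi> i. x i) = ennreal ((\<Prod>i\<in>UNIV. tb k (x i)) * (cmod (f (\<chi> i. tg k (x i))))\<^sup>2)"
      proof (cases "\<forall>i. cmod (x i) \<le> R k")
        case True
        then have "tg k (x i) = x i" for i by (simp add: tg_def)
        then show ?thesis by (simp add: F_def)
      next
        case False
        then obtain i where i: "\<not> cmod (x i) \<le> R k" by auto
        then have p0: "(\<Prod>i\<in>UNIV. tb k (x i)) = 0" by (intro prod_zero bexI[of _ i]) (auto simp: tb_def)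
        show ?thesis unfolding F_def vec_lambda_beta p0 by simp
      qed
    qed
    also have "\<dots> = (SUP N. ennreal (\<Sum>\<alpha>\<in>exps N. (cmod (a \<alpha>))\<^sup>2 * (\<Prod>i\<in>UNIV. tm k (\<alpha> i))))"
      unfolding tm_def
    proof (rule parseval[OF a R tb_int tb_nn])
      show "cmod (tg k t) \<le> R k" for t using R[of k] by (simp add: tg_def)
      show "(LINT t|lborel. complex_of_real (tb k t) * (tg k t ^ j * cnj (tg k t) ^ l)) = 0" if "j \<noteq> l" for j l
        by (rule radial_orthogonal[OF _ _ _ _ that]) (use rot bwrot in \<open>simp_all add: tb_def tg_def\<close>)
    qed measurable
    finally show "(\<integral>\<^sup>+ z. F k z \<partial>lborel) = (SUP N. ennreal (\<Sum>\<alpha>\<in>exps N. (cmod (a \<alpha>))\<^sup>2 * (\<Prod>i\<in>UNIV. tm k (\<alpha> i))))" .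
  qed
  also have "\<dots> = (SUP N. SUP k. ennreal (\<Sum>\<alpha>\<in>exps N. (cmod (a \<alpha>))\<^sup>2 * (\<Prod>i\<in>UNIV. tm k (\<alpha> i))))"
    by (rule SUP_commute)
  also have "\<dots> = (SUP N. ennreal (\<Sum>\<alpha>\<in>exps N. (cmod (a \<alpha>))\<^sup>2 * (\<Prod>i\<in>UNIV. bmom lam (\<alpha> i))))"
  proof (rule SUP_cong[OF refl], rule ennreal_SUP_eq_limit)
    fix N
    show "(\<lambda>k. \<Sum>\<alpha>\<in>exps N. (cmod (a \<alpha>))\<^sup>2 * (\<Prod>i\<in>UNIV. tm k (\<alpha> i))) \<longlonglongrightarrow> (\<Sum>\<alpha>\<in>exps N. (cmod (a \<alpha>))\<^sup>2 * (\<Prod>i\<in>UNIV. bmom lam (\<alpha> i)))"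
      by (intro tendsto_sum tendsto_mult tendsto_const tendsto_prod tm_lim)
    show "(\<Sum>\<alpha>\<in>exps N. (cmod (a \<alpha>))\<^sup>2 * (\<Prod>i\<in>UNIV. tm k (\<alpha> i))) \<le> (\<Sum>\<alpha>\<in>exps N. (cmod (a \<alpha>))\<^sup>2 * (\<Prod>i\<in>UNIV. bmom lam (\<alpha> i)))" for k
      by (intro sum_mono mult_left_mono prod_mono conjI tm_nn tm_le) simp
  qed
  finally show ?thesis .
qed

section \<open>Norms as weighted sums over coefficients, for Hardy and Bergman spaces alike\<close>

definition wseq :: "real \<Rightarrow> nat \<Rightarrow> real" where
  "wseq lam k = (if lam = 1 then 1 else bmom lam k)"

lemma wseq_pos: "1 \<le> lam \<Longrightarrow> 0 < wseq lam k"
  by (simp add: wseq_def bmom_pos)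

lemma wseq_Suc_le: "1 \<le> lam \<Longrightarrow> wseq lam (Suc k) \<le> wseq lam k"
  by (simp add: wseq_def bmom_Suc_le)

lemma wseq_ratio: "1 \<le> lam \<Longrightarrow> (\<lambda>k. wseq lam (Suc k) / wseq lam k) \<longlonglongrightarrow> 1"
  using bmom_ratio[of lam] by (cases "lam = 1") (auto simp: wseq_def)

lemma norm_formula:
  fixes f :: "complex^'n::finite \<Rightarrow> complex"
  assumes "1 \<le> lam" "f \<in> borel_measurable borel" "taylor_on 1 f a"
  shows "bergman_nrm2 lam f = (SUP N. ennreal (\<Sum>\<alpha>\<in>exps N. (cmod (a \<alpha>))\<^sup>2 * (\<Prod>i\<in>UNIV. wseq lam (\<alpha> i))))"
proof (cases "lam = 1")
  case True
  then show ?thesis using hardy_norm[OF assms(2,3)] by (simp add: wseq_def)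
next
  case False
  then show ?thesis using bergman_norm[OF _ assms(2,3), of lam] assms(1) by (simp add: wseq_def)
qed

lemma energy_eq_infsum:
  fixes F :: "('n::finite \<Rightarrow> nat) \<Rightarrow> real"
  assumes nn: "\<And>\<alpha>. 0 \<le> F \<alpha>" and s: "F summable_on UNIV"
  shows "(SUP N. ennreal (\<Sum>\<alpha>\<in>exps N. F \<alpha>)) = ennreal (infsum F UNIV)"
proof (rule ennreal_SUP_eq_limit)
  show "(\<lambda>N. \<Sum>\<alpha>\<in>exps N. F \<alpha>) \<longlonglongrightarrow> infsum F UNIV" using s by (intro has_sum_exps has_sum_infsum)
  show "(\<Sum>\<alpha>\<in>exps N. F \<alpha>) \<le> infsum F UNIV" for N using s nn by (intro finite_sum_le_infsum) auto
qed

lemma energy_finite_iff: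
  fixes F :: "('n::finite \<Rightarrow> nat) \<Rightarrow> real"
  assumes nn: "\<And>\<alpha>. 0 \<le> F \<alpha>"
  shows "(SUP N. ennreal (\<Sum>\<alpha>\<in>exps N. F \<alpha>)) < \<infinity> \<longleftrightarrow> F summable_on UNIV"
proof
  assume fin: "(SUP N. ennreal (\<Sum>\<alpha>\<in>exps N. F \<alpha>)) < \<infinity>"
  show "F summable_on UNIV"
  proof (rule exps_bounded_summable[OF nn])
    fix N
    have "ennreal (\<Sum>\<alpha>\<in>exps N. F \<alpha>) \<le> (SUP N. ennreal (\<Sum>\<alpha>\<in>exps N. F \<alpha>))" by (rule SUP_upper) simp
    from enn2real_mono[OF this] fin
    show "(\<Sum>\<alpha>\<in>exps N. F \<alpha>) \<le> enn2real (SUP N. ennreal (\<Sum>\<alpha>\<in>exps N. F \<alpha>))"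
      using nn by (simp add: sum_nonneg)
  qed
qed (simp add: energy_eq_infsum[OF nn])

definition coef :: "(complex^'n::finite \<Rightarrow> complex) \<Rightarrow> ('n \<Rightarrow> nat) \<Rightarrow> complex" where
  "coef f = (THE a. taylor_on 1 f a)"

lemma coef_eq: "taylor_on 1 f a \<Longrightarrow> coef f = a"
  unfolding coef_def by (rule the_equality) (assumption, rule taylor_unique[OF _ _ zero_less_one])

text \<open>\<open>A_space\<close> without the norm condition: a common domain on which
  coefficients, multipliers and projections can be treated for all weights at once.\<close>

definition dfun :: "(complex^'n::finite \<Rightarrow> complex) set" where
  "dfun = {f. holo_on f polydisc \<and> (\<forall>z. z \<notin> polydisc \<longrightarrow> f z = 0)}"

lemma taylor_coef: "f \<in> dfun \<Longrightarrow> taylor_on 1 f (coef f)"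
  using taylor_exists[of f] coef_eq by (auto simp: dfun_def)

definition wpow :: "real \<Rightarrow> ('n::finite \<Rightarrow> nat) \<Rightarrow> real" where
  "wpow lam \<alpha> = (\<Prod>i\<in>UNIV. wseq lam (\<alpha> i))"

lemma wpow_pos: "1 \<le> lam \<Longrightarrow> 0 < wpow lam \<alpha>"
  unfolding wpow_def by (intro prod_pos) (simp add: wseq_pos)

lemma dfun_norm:
  assumes "1 \<le> lam" "f \<in> dfun"
  shows "bergman_nrm2 lam f = (SUP N. ennreal (\<Sum>\<alpha>\<in>exps N. (cmod (coef f \<alpha>))\<^sup>2 * wpow lam \<alpha>))"
  using norm_formula[OF assms(1) _ taylor_coef[OF assms(2)]] holo_measurable[of f] assms(2)
  by (auto simp: dfun_def wpow_def)

lemma A_space_iff: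
  assumes "1 \<le> lam"
  shows "f \<in> A_space lam \<longleftrightarrow> f \<in> dfun \<and> (\<lambda>\<alpha>. (cmod (coef f \<alpha>))\<^sup>2 * wpow lam \<alpha>) summable_on UNIV"
proof -
  have nn: "0 \<le> (cmod (coef f \<alpha>))\<^sup>2 * wpow lam \<alpha>" for \<alpha> using wpow_pos[OF assms, of \<alpha>] by simp
  have "f \<in> A_space lam \<longleftrightarrow> f \<in> dfun \<and> bergman_nrm2 lam f < \<infinity>" by (auto simp: A_space_def dfun_def)
  moreover have "bergman_nrm2 lam f < \<infinity> \<longleftrightarrow> (\<lambda>\<alpha>. (cmod (coef f \<alpha>))\<^sup>2 * wpow lam \<alpha>) summable_on UNIV" if "f \<in> dfun"
    unfolding dfun_norm[OF assms that] by (rule energy_finite_iff[OF nn])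
  ultimately show ?thesis by blast
qed

lemma bnorm_sq:
  assumes "1 \<le> lam" "f \<in> A_space lam"
  shows "(bnorm lam f)\<^sup>2 = infsum (\<lambda>\<alpha>. (cmod (coef f \<alpha>))\<^sup>2 * wpow lam \<alpha>) UNIV"
proof -
  have nn: "0 \<le> (cmod (coef f \<alpha>))\<^sup>2 * wpow lam \<alpha>" for \<alpha> using wpow_pos[OF assms(1), of \<alpha>] by simp
  have f: "f \<in> dfun" "(\<lambda>\<alpha>. (cmod (coef f \<alpha>))\<^sup>2 * wpow lam \<alpha>) summable_on UNIV"
    using assms A_space_iff by auto
  have "bergman_nrm2 lam f = ennreal (infsum (\<lambda>\<alpha>. (cmod (coef f \<alpha>))\<^sup>2 * wpow lam \<alpha>) UNIV)"
    unfolding dfun_norm[OF assms(1) f(1)] by (rule energy_eq_infsum[OF nn f(2)])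
  moreover have "0 \<le> infsum (\<lambda>\<alpha>. (cmod (coef f \<alpha>))\<^sup>2 * wpow lam \<alpha>) UNIV" using nn by (intro infsum_nonneg)
  ultimately show ?thesis by (simp add: bnorm_def)
qed

section \<open>Operations on holomorphic functions and their coefficients\<close>

lemma holo_onI:
  assumes "\<And>z. z \<in> S \<Longrightarrow> (f has_derivative (\<lambda>h. \<Sum>i\<in>UNIV. c z i * h$i)) (at z)"
  shows "holo_on f S"
  unfolding holo_on_def
proof
  fix z assume "z \<in> S"
  from assms[OF this] show "\<exists>c :: complex^'a. (f has_derivative (\<lambda>h. \<Sum>i\<in>UNIV. c$i * h$i)) (at z)"
    by (intro exI[of _ "\<chi> i. c z i"]) simp
qed

lemma holo_onE:
  assumes "holo_on f S"
  obtains c where "\<And>z. z \<in> S \<Longrightarrow> (f has_derivative (\<lambda>h. \<Sum>i\<in>UNIV. c z i * h$i)) (at z)"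
proof -
  have "\<forall>z\<in>S. \<exists>c :: complex^'a. (f has_derivative (\<lambda>h. \<Sum>i\<in>UNIV. c$i * h$i)) (at z)"
    using assms by (simp add: holo_on_def)
  then obtain c :: "complex^'a \<Rightarrow> complex^'a" where "\<forall>z\<in>S. (f has_derivative (\<lambda>h. \<Sum>i\<in>UNIV. c z $ i * h$i)) (at z)"
    by (rule bchoice[THEN exE])
  then show ?thesis using that[of "\<lambda>z i. c z $ i"] by blast
qed

lemma holo_const: "holo_on (\<lambda>_. c) S"
proof (rule holo_onI[where c = "\<lambda>_ _. 0"])
  show "((\<lambda>_. c) has_derivative (\<lambda>h. \<Sum>i\<in>UNIV. 0 * h $ i)) (at z)" for z :: "complex^'a" by simp
qed

lemma holo_nth: "holo_on (\<lambda>z. z $ j) S"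
proof (rule holo_onI[where c = "\<lambda>_ i. if i = j then 1 else 0"])
  fix z :: "complex^'a"
  have "((\<lambda>z. z $ j) has_derivative (\<lambda>h. h $ j)) (at z)"
    by (rule bounded_linear_imp_has_derivative) (rule bounded_linear_vec_nth)
  moreover have "(\<lambda>h :: complex^'a. \<Sum>i\<in>UNIV. (if i = j then 1 else 0) * h $ i) = (\<lambda>h. h $ j)"
    by (simp add: if_distrib[where f = "\<lambda>x. x * _"] cong: if_cong)
  ultimately show "((\<lambda>z. z $ j) has_derivative (\<lambda>h. \<Sum>i\<in>UNIV. (if i = j then 1 else 0) * h $ i)) (at z)" by simp
qed

lemma holo_add:
  assumes "holo_on f S" "holo_on g S" shows "holo_on (\<lambda>z. f z + g z) S"
proof -
  from assms(1) obtain a where a: "\<And>z. z \<in> S \<Longrightarrow> (f has_derivative (\<lambda>h. \<Sum>i\<in>UNIV. a z i * h$i)) (at z)"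
    by (rule holo_onE) blast
  from assms(2) obtain b where b: "\<And>z. z \<in> S \<Longrightarrow> (g has_derivative (\<lambda>h. \<Sum>i\<in>UNIV. b z i * h$i)) (at z)"
    by (rule holo_onE) blast
  show ?thesis
  proof (rule holo_onI[where c = "\<lambda>z i. a z i + b z i"])
    fix z assume "z \<in> S"
    from has_derivative_add[OF a[OF this] b[OF this]]
    show "((\<lambda>z. f z + g z) has_derivative (\<lambda>h. \<Sum>i\<in>UNIV. (a z i + b z i) * h$i)) (at z)"
      by (simp add: sum.distrib distrib_right)
  qed
qed

lemma holo_mult:
  assumes "holo_on f S" "holo_on g S" shows "holo_on (\<lambda>z. f z * g z) S"
proof -
  from assms(1) obtain a where a: "\<And>z. z \<in> S \<Longrightarrow> (f has_derivative (\<lambda>h. \<Sum>i\<in>UNIV. a z i * h$i)) (at z)"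
    by (rule holo_onE) blast
  from assms(2) obtain b where b: "\<And>z. z \<in> S \<Longrightarrow> (g has_derivative (\<lambda>h. \<Sum>i\<in>UNIV. b z i * h$i)) (at z)"
    by (rule holo_onE) blast
  show ?thesis
  proof (rule holo_onI[where c = "\<lambda>z i. f z * b z i + a z i * g z"])
    fix z assume "z \<in> S"
    from has_derivative_mult[OF a[OF this] b[OF this]]
    have "((\<lambda>z. f z * g z) has_derivative (\<lambda>h. f z * (\<Sum>i\<in>UNIV. b z i * h$i) + (\<Sum>i\<in>UNIV. a z i * h$i) * g z)) (at z)" .
    moreover have "(\<lambda>h. f z * (\<Sum>i\<in>UNIV. b z i * h$i) + (\<Sum>i\<in>UNIV. a z i * h$i) * g z) = (\<lambda>h. \<Sum>i\<in>UNIV. (f z * b z i + a z i * g z) * h$i)"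
      by (rule ext) (simp add: sum_distrib_left sum_distrib_right sum.distrib distrib_right distrib_left ac_simps)
    ultimately show "((\<lambda>z. f z * g z) has_derivative (\<lambda>h. \<Sum>i\<in>UNIV. (f z * b z i + a z i * g z) * h$i)) (at z)" by simp
  qed
qed

lemma holo_sum: "(\<And>j. j \<in> J \<Longrightarrow> holo_on (f j) S) \<Longrightarrow> holo_on (\<lambda>z. \<Sum>j\<in>J. f j z) S"
  by (induction J rule: infinite_finite_induct) (auto intro: holo_const holo_add)

lemma holo_prod: "(\<And>j. j \<in> J \<Longrightarrow> holo_on (f j) S) \<Longrightarrow> holo_on (\<lambda>z. \<Prod>j\<in>J. f j z) S"
  by (induction J rule: infinite_finite_induct) (auto intro: holo_const holo_mult)

lemma holo_power: "holo_on f S \<Longrightarrow> holo_on (\<lambda>z. f z ^ k) S"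
  by (induction k) (auto intro: holo_const holo_mult)

lemma holo_zpow: "holo_on (zpow \<alpha>) S"
  unfolding zpow_def by (intro holo_prod holo_power holo_nth)

lemma holo_esym: "holo_on (esym k) S"
  unfolding esym_def by (intro holo_sum holo_prod holo_nth)

lemma act_polydisc: "\<sigma> \<in> Perms \<Longrightarrow> act \<sigma> z \<in> polydisc \<longleftrightarrow> z \<in> polydisc"
proof -
  assume s: "\<sigma> \<in> Perms"
  have "(\<forall>i. cmod (z $ inv \<sigma> i) < 1) \<longleftrightarrow> (\<forall>i. cmod (z $ i) < 1)"
  proof (intro iffI allI)
    fix i assume "\<forall>i. cmod (z $ inv \<sigma> i) < 1"
    then have "cmod (z $ inv \<sigma> (\<sigma> i)) < 1" by (rule spec)
    then show "cmod (z $ i) < 1" using s by (simp add: permutes_inverses)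
  qed simp
  then show ?thesis by (simp add: polydisc_def)
qed

lemma sum_act: "\<sigma> \<in> Perms \<Longrightarrow> (\<Sum>i\<in>UNIV. c i * act \<sigma> h $ i) = (\<Sum>j\<in>UNIV. c (\<sigma> j) * h $ j)"
  by (rule sum.reindex_bij_witness[of _ \<sigma> "inv \<sigma>"]) (auto simp: permutes_inverses)

lemma holo_act:
  assumes f: "holo_on f polydisc" and s: "\<sigma> \<in> Perms"
  shows "holo_on (\<lambda>z. f (act \<sigma> z)) polydisc"
proof -
  from f obtain a where a: "\<And>z. z \<in> polydisc \<Longrightarrow> (f has_derivative (\<lambda>h. \<Sum>i\<in>UNIV. a z i * h$i)) (at z)"
    by (rule holo_onE) blast
  show ?thesis
  proof (rule holo_onI[where c = "\<lambda>z j. a (act \<sigma> z) (\<sigma> j)"])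
    fix z :: "complex^'a" assume z: "z \<in> polydisc"
    have "linear (act \<sigma> :: complex^'a \<Rightarrow> _)" by (rule linearI) (auto simp: vec_eq_iff)
    then have l: "bounded_linear (act \<sigma> :: complex^'a \<Rightarrow> _)" by (simp add: linear_conv_bounded_linear)
    have "((\<lambda>z. f (act \<sigma> z)) has_derivative (\<lambda>h. \<Sum>i\<in>UNIV. a (act \<sigma> z) i * act \<sigma> h $ i)) (at z)"
      by (rule has_derivative_compose[OF bounded_linear_imp_has_derivative[OF l] a]) (simp only: act_polydisc[OF s] z)
    then show "((\<lambda>z. f (act \<sigma> z)) has_derivative (\<lambda>h. \<Sum>j\<in>UNIV. a (act \<sigma> z) (\<sigma> j) * h$j)) (at z)"
      unfolding sum_act[OF s] .
  qed
qed

lemma dfunD: "f \<in> dfun \<Longrightarrow> holo_on f polydisc" "f \<in> dfun \<Longrightarrow> z \<notin> polydisc \<Longrightarrow> f z = 0"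
  by (auto simp: dfun_def)

lemma dfunI: "holo_on f polydisc \<Longrightarrow> (\<And>z. z \<notin> polydisc \<Longrightarrow> f z = 0) \<Longrightarrow> f \<in> dfun"
  by (auto simp: dfun_def)

lemma dfun_add: "f \<in> dfun \<Longrightarrow> g \<in> dfun \<Longrightarrow> (\<lambda>z. f z + g z) \<in> dfun"
  by (intro dfunI holo_add) (auto simp: dfunD)

lemma dfun_mult: "holo_on h polydisc \<Longrightarrow> f \<in> dfun \<Longrightarrow> (\<lambda>z. h z * f z) \<in> dfun"
  by (intro dfunI holo_mult) (auto simp: dfunD)

lemma dfun_sum: "(\<And>j. j \<in> J \<Longrightarrow> f j \<in> dfun) \<Longrightarrow> (\<lambda>z. \<Sum>j\<in>J. f j z) \<in> dfun"
  by (intro dfunI holo_sum) (auto simp: dfunD)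

lemma dfun_act: "f \<in> dfun \<Longrightarrow> \<sigma> \<in> Perms \<Longrightarrow> (\<lambda>z. f (act \<sigma> z)) \<in> dfun"
  by (intro dfunI holo_act) (simp_all only: dfunD act_polydisc not_False_eq_True)

text \<open>Elements of the function spaces vanish outside the polydisc, hence the cut-off.\<close>
definition zcut :: "('n \<Rightarrow> nat) \<Rightarrow> complex^'n::finite \<Rightarrow> complex" where
  "zcut \<alpha> z = (if z \<in> polydisc then zpow \<alpha> z else 0)"

lemma dfun_zcut: "zcut \<alpha> \<in> dfun"
proof (rule dfunI)
  have "holo_on (zpow \<alpha>) polydisc" by (rule holo_zpow)
  then show "holo_on (zcut \<alpha>) polydisc"
    unfolding holo_on_def
  proof (intro ballI)
    fix z :: "complex^'a" assume z: "z \<in> polydisc" and "\<forall>z\<in>polydisc. \<exists>c::complex^'a. (zpow \<alpha> has_derivative (\<lambda>h. \<Sum>i\<in>UNIV. c$i * h$i)) (at z)"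
    then obtain c :: "complex^'a" where "(zpow \<alpha> has_derivative (\<lambda>h. \<Sum>i\<in>UNIV. c$i * h$i)) (at z)" by blast
    then have "(zcut \<alpha> has_derivative (\<lambda>h. \<Sum>i\<in>UNIV. c$i * h$i)) (at z)"
      by (rule has_derivative_transform_within_open[OF _ open_polydisc z]) (simp add: zcut_def)
    then show "\<exists>c::complex^'a. (zcut \<alpha> has_derivative (\<lambda>h. \<Sum>i\<in>UNIV. c$i * h$i)) (at z)" by blast
  qed
qed (simp add: zcut_def)

lemma has_sum_UNIV_support:
  assumes "(g has_sum s) S" "\<And>x. x \<notin> S \<Longrightarrow> g x = 0" shows "(g has_sum s) UNIV"
  using has_sum_cong_neutral[of UNIV S g g s] assms by simp

lemma taylor_polydisc: "taylor_on 1 f a \<longleftrightarrow> (\<forall>z\<in>polydisc. ((\<lambda>\<alpha>. a \<alpha> * zpow \<alpha> z) has_sum f z) UNIV)"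
  by (simp add: taylor_on_def polydisc_def)

lemma dfun_has_sum: "f \<in> dfun \<Longrightarrow> z \<in> polydisc \<Longrightarrow> ((\<lambda>\<alpha>. coef f \<alpha> * zpow \<alpha> z) has_sum f z) UNIV"
  using taylor_coef[of f] by (simp add: taylor_polydisc)

lemma coef_inject:
  assumes "f \<in> dfun" "g \<in> dfun" "coef f = coef g" shows "f = g"
proof
  fix z
  show "f z = g z"
  proof (cases "z \<in> polydisc")
    case True
    then show ?thesis using dfun_has_sum[OF assms(1) True] dfun_has_sum[OF assms(2) True] assms(3)
      by (simp add: has_sum_unique)
  next
    case False
    then show ?thesis using dfunD(2)[OF assms(1) False] dfunD(2)[OF assms(2) False] by simp
  qed
qed

lemma coef_add:
  assumes "f \<in> dfun" "g \<in> dfun" shows "coef (\<lambda>z. f z + g z) = (\<lambda>\<alpha>. coef f \<alpha> + coef g \<alpha>)"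
  by (rule coef_eq) (use has_sum_add[OF dfun_has_sum[OF assms(1)] dfun_has_sum[OF assms(2)]] in \<open>simp add: taylor_polydisc distrib_right\<close>)

lemma coef_cmult:
  assumes "f \<in> dfun" shows "coef (\<lambda>z. c * f z) = (\<lambda>\<alpha>. c * coef f \<alpha>)"
  by (rule coef_eq) (use has_sum_cmult_right[OF dfun_has_sum[OF assms], of _ c] in \<open>simp add: taylor_polydisc mult.assoc\<close>)

lemma dfun_cmult: "f \<in> dfun \<Longrightarrow> (\<lambda>z. c * f z) \<in> dfun"
  by (rule dfun_mult[OF holo_const])

lemma dfun_0: "(\<lambda>_. 0) \<in> dfun"
  by (rule dfunI) (simp_all add: holo_const)

lemma coef_0: "coef (\<lambda>_. 0) = (\<lambda>_. 0)"
  by (rule coef_eq) (simp add: taylor_polydisc)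

lemma coef_sum:
  assumes "\<And>j. j \<in> J \<Longrightarrow> f j \<in> dfun" shows "coef (\<lambda>z. \<Sum>j\<in>J. f j z) = (\<lambda>\<alpha>. \<Sum>j\<in>J. coef (f j) \<alpha>)"
  using assms
proof (induction J rule: infinite_finite_induct)
  case (insert j J)
  then have "coef (\<lambda>z. f j z + (\<Sum>j\<in>J. f j z)) = (\<lambda>\<alpha>. coef (f j) \<alpha> + coef (\<lambda>z. \<Sum>j\<in>J. f j z) \<alpha>)"
    by (intro coef_add dfun_sum) auto
  then show ?case using insert by simp
qed (simp_all add: coef_0)

lemma zpow_act: "\<sigma> \<in> Perms \<Longrightarrow> zpow \<alpha> (act \<sigma> z) = zpow (\<alpha> \<circ> \<sigma>) z"
  unfolding zpow_def by (rule prod.reindex_bij_witness[of _ \<sigma> "inv \<sigma>"]) (auto simp: permutes_inverses)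

lemma bij_comp_right: "\<sigma> \<in> Perms \<Longrightarrow> bij (\<lambda>\<alpha> :: 'n::finite \<Rightarrow> nat. \<alpha> \<circ> \<sigma>)"
  by (rule bij_betw_byWitness[where f' = "\<lambda>\<alpha>. \<alpha> \<circ> inv \<sigma>"]) (auto simp: comp_assoc permutes_inv_o)

lemma coef_act:
  assumes f: "f \<in> dfun" and s: "\<sigma> \<in> Perms" shows "coef (\<lambda>z. f (act \<sigma> z)) = (\<lambda>\<alpha>. coef f (\<alpha> \<circ> inv \<sigma>))"
proof (rule coef_eq, unfold taylor_polydisc, rule ballI)
  fix z :: "complex^'a" assume z: "z \<in> polydisc"
  have "((\<lambda>\<alpha>. coef f \<alpha> * zpow \<alpha> (act \<sigma> z)) has_sum f (act \<sigma> z)) UNIV"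
    by (rule dfun_has_sum[OF f]) (simp only: act_polydisc[OF s] z)
  moreover have "coef f \<alpha> * zpow \<alpha> (act \<sigma> z) = coef f (\<alpha> \<circ> \<sigma> \<circ> inv \<sigma>) * zpow (\<alpha> \<circ> \<sigma>) z" for \<alpha>
    using s by (simp add: zpow_act comp_assoc permutes_inv_o)
  ultimately have "((\<lambda>\<alpha>. coef f (\<alpha> \<circ> \<sigma> \<circ> inv \<sigma>) * zpow (\<alpha> \<circ> \<sigma>) z) has_sum f (act \<sigma> z)) UNIV" by simp
  then show "((\<lambda>\<alpha>. coef f (\<alpha> \<circ> inv \<sigma>) * zpow \<alpha> z) has_sum f (act \<sigma> z)) UNIV"
    using has_sum_reindex_bij_betw[OF bij_comp_right[OF s], of "\<lambda>\<alpha>. coef f (\<alpha> \<circ> inv \<sigma>) * zpow \<alpha> z"] by simp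
qed

lemma zpow_mult: "zpow \<alpha> z * zpow \<beta> z = zpow (\<lambda>i. \<alpha> i + \<beta> i) z"
  by (simp add: zpow_def power_add prod.distrib)

text \<open>The guard excludes exponents at which natural subtraction would truncate; the
  translation by \<open>\<beta>\<close> does not reach them.\<close>

lemma coef_zpow_mult:
  assumes f: "f \<in> dfun"
  shows "coef (\<lambda>z. zpow \<beta> z * f z) = (\<lambda>\<gamma>. if \<forall>i. \<beta> i \<le> \<gamma> i then coef f (\<lambda>i. \<gamma> i - \<beta> i) else 0)"
proof (rule coef_eq, unfold taylor_polydisc, rule ballI)
  fix z :: "complex^'a" assume z: "z \<in> polydisc"
  let ?h = "\<lambda>\<alpha> i. \<alpha> i + \<beta> i"
  let ?g = "\<lambda>\<gamma>. (if \<forall>i. \<beta> i \<le> \<gamma> i then coef f (\<lambda>i. \<gamma> i - \<beta> i) else 0) * zpow \<gamma> z"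
  have inj: "inj ?h" by (auto simp: inj_def fun_eq_iff)
  have "((\<lambda>\<alpha>. zpow \<beta> z * (coef f \<alpha> * zpow \<alpha> z)) has_sum (zpow \<beta> z * f z)) UNIV"
    by (rule has_sum_cmult_right[OF dfun_has_sum[OF f z]])
  moreover have "(\<lambda>\<alpha>. zpow \<beta> z * (coef f \<alpha> * zpow \<alpha> z)) = ?g \<circ> ?h"
  proof
    fix \<alpha>
    have "zpow \<beta> z * (coef f \<alpha> * zpow \<alpha> z) = coef f \<alpha> * zpow (?h \<alpha>) z"
      unfolding zpow_mult[symmetric] by (simp only: ac_simps)
    then show "zpow \<beta> z * (coef f \<alpha> * zpow \<alpha> z) = (?g \<circ> ?h) \<alpha>" by simp
  qed
  ultimately have "((?g \<circ> ?h) has_sum (zpow \<beta> z * f z)) UNIV" by (simp only:)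
  then have "(?g has_sum (zpow \<beta> z * f z)) (range ?h)" by (simp only: has_sum_reindex[OF inj])
  moreover have "?g \<gamma> = 0" if "\<gamma> \<notin> range ?h" for \<gamma>
  proof -
    have "\<not> (\<forall>i. \<beta> i \<le> \<gamma> i)"
    proof
      assume "\<forall>i. \<beta> i \<le> \<gamma> i"
      then have eq: "\<gamma> = ?h (\<lambda>i. \<gamma> i - \<beta> i)" by (simp add: fun_eq_iff)
      have "\<gamma> \<in> range ?h" by (rule ssubst[OF eq]) (rule rangeI)
      with that show False by (rule notE)
    qed
    then show ?thesis by (simp only: if_False mult_zero_left)
  qed
  ultimately show "(?g has_sum (zpow \<beta> z * f z)) UNIV"
    by (rule has_sum_UNIV_support)
qed

lemma coef_zcut: "coef (zcut \<alpha>) = (\<lambda>\<gamma>. if \<gamma> = \<alpha> then 1 else 0)"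
proof (rule coef_eq, unfold taylor_polydisc, rule ballI)
  fix z :: "complex^'a" assume z: "z \<in> polydisc"
  let ?g = "\<lambda>\<gamma>. (if \<gamma> = \<alpha> then 1 else 0) * zpow \<gamma> z"
  have "(?g has_sum (\<Sum>\<gamma>\<in>{\<alpha>}. ?g \<gamma>)) {\<alpha>}" by (rule has_sum_finite) simp
  then have "(?g has_sum zcut \<alpha> z) {\<alpha>}" using z by (simp add: zcut_def)
  moreover have "?g \<gamma> = 0" if "\<gamma> \<notin> {\<alpha>}" for \<gamma> using that by simp
  ultimately show "(?g has_sum zcut \<alpha> z) UNIV"
    by (rule has_sum_UNIV_support)
qed

lemma dfun_P11: "f \<in> dfun \<Longrightarrow> P11 d \<rho> f \<in> dfun"
  unfolding P11_eq by (rule dfun_cmult, rule dfun_sum, rule dfun_cmult, rule dfun_act)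

lemma coef_P11:
  fixes f :: "complex^'n::finite \<Rightarrow> complex"
  assumes "f \<in> dfun"
  shows "coef (P11 d \<rho> f) = (\<lambda>\<gamma>. of_nat d / of_nat (fact CARD('n)) * (\<Sum>\<tau>\<in>Perms. \<rho> \<tau> 0 0 * coef f (\<gamma> \<circ> inv \<tau>)))"
proof -
  have "coef (P11 d \<rho> f) = (\<lambda>\<gamma>. of_nat d / of_nat (fact CARD('n)) * coef (\<lambda>z. \<Sum>\<tau>\<in>Perms. \<rho> \<tau> 0 0 * f (act \<tau> z)) \<gamma>)"
    unfolding P11_eq by (rule coef_cmult, rule dfun_sum, rule dfun_cmult, rule dfun_act[OF assms])
  also have "coef (\<lambda>z. \<Sum>\<tau>\<in>Perms. \<rho> \<tau> 0 0 * f (act \<tau> z)) = (\<lambda>\<gamma>. \<Sum>\<tau>\<in>Perms. coef (\<lambda>z. \<rho> \<tau> 0 0 * f (act \<tau> z)) \<gamma>)"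
    by (rule coef_sum, rule dfun_cmult, rule dfun_act[OF assms])
  also have "\<dots> = (\<lambda>\<gamma>. \<Sum>\<tau>\<in>Perms. \<rho> \<tau> 0 0 * coef f (\<gamma> \<circ> inv \<tau>))"
    by (intro ext sum.cong refl) (simp only: coef_cmult[OF dfun_act[OF assms]] coef_act[OF assms])
  finally show ?thesis .
qed

lemma P11_add: "P11 d \<rho> (\<lambda>z. f z + g z) = (\<lambda>z. P11 d \<rho> f z + P11 d \<rho> g z)"
  unfolding P11_eq by (auto simp: sum.distrib algebra_simps)

lemma P11_cmult: "P11 d \<rho> (\<lambda>z. c * f z) = (\<lambda>z. c * P11 d \<rho> f z)"
  unfolding P11_eq by (auto simp: sum_distrib_left ac_simps)

lemma P11_0: "P11 d \<rho> (\<lambda>_. 0) = (\<lambda>_. 0)"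
  unfolding P11_eq by simp

lemma P11_sum: "P11 d \<rho> (\<lambda>z. \<Sum>j\<in>J. f j z) = (\<lambda>z. \<Sum>j\<in>J. P11 d \<rho> (f j) z)"
  by (induction J rule: infinite_finite_induct) (simp_all add: P11_0 P11_add)

text \<open>A symmetric multiplier is constant along orbits and leaves the group sum as a factor.
  This is what makes the range of \<open>P11\<close> invariant under the tuple.\<close>

lemma P11_invariant_mult:
  assumes "\<And>\<tau> z. \<tau> \<in> Perms \<Longrightarrow> h (act \<tau> z) = h z"
  shows "P11 d \<rho> (\<lambda>z. h z * f z) = (\<lambda>z. h z * P11 d \<rho> f z)"
  unfolding P11_eq using assms by (auto simp: sum_distrib_left ac_simps intro!: sum.cong)

lemma esym_act: "\<tau> \<in> Perms \<Longrightarrow> esym k (act \<tau> z) = esym k z"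
  unfolding esym_def
proof (rule sum.reindex_bij_witness[of _ "\<lambda>S. \<tau> ` S" "\<lambda>S. inv \<tau> ` S"])
  assume t: "\<tau> \<in> Perms"
  then have i: "inj \<tau>" "inj (inv \<tau>)" using permutes_inj permutes_inj[OF permutes_inv] by auto
  fix S :: "'a set"
  show "\<tau> ` inv \<tau> ` S = S" "inv \<tau> ` \<tau> ` S = S" using t by (auto simp: image_image permutes_inverses)
  show "inv \<tau> ` S \<in> {S. card S = k}" if "S \<in> {S. card S = k}" using that i by (simp add: card_image inj_on_subset)
  show "\<tau> ` S \<in> {S. card S = k}" if "S \<in> {S. card S = k}" using that i by (simp add: card_image inj_on_subset)
  have "inj_on (inv \<tau>) S" using i inj_on_subset by blast
  then show "(\<Prod>i\<in>inv \<tau> ` S. z $ i) = (\<Prod>i\<in>S. act \<tau> z $ i)" by (simp add: prod.reindex)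
qed

lemma orbit_sum_act: "\<tau> \<in> Perms \<Longrightarrow> orbit_sum \<beta> (act \<tau> z) = orbit_sum \<beta> z"
proof -
  assume t: "\<tau> \<in> Perms"
  have "orbit_sum \<beta> (act \<tau> z) = (\<Sum>\<sigma>\<in>Perms. zpow (\<beta> \<circ> \<sigma>) (act \<tau> z))" by (simp add: orbit_sum_def zpow_def)
  also have "\<dots> = (\<Sum>\<sigma>\<in>Perms. zpow (\<beta> \<circ> (\<sigma> \<circ> \<tau>)) z)" using t by (simp add: zpow_act comp_assoc)
  also have "\<dots> = (\<Sum>\<sigma>\<in>Perms. zpow (\<beta> \<circ> \<sigma>) z)" by (rule sum.reindex_bij_betw[OF bij_betw_Perms_right[OF t]])
  finally show ?thesis by (simp add: orbit_sum_def zpow_def)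
qed

lemma zcut_act: "\<sigma> \<in> Perms \<Longrightarrow> zcut \<alpha> (act \<sigma> z) = zcut (\<alpha> \<circ> \<sigma>) z"
  unfolding zcut_def by (simp only: act_polydisc zpow_act)

text \<open>Supplies the right-hand side of \<open>comm\<close> in \<open>shift_matrix\<close>; the
  left-hand side comes from \<open>coef_orbit_sum_mult\<close>.\<close>

lemma orbit_sum_zcut: "orbit_sum \<beta> z * zcut \<alpha> z = (\<Sum>\<sigma>\<in>Perms. zcut (\<lambda>i. \<alpha> i + \<beta> (\<sigma> i)) z)"
proof -
  have "orbit_sum \<beta> z = (\<Sum>\<sigma>\<in>Perms. zpow (\<lambda>i. \<beta> (\<sigma> i)) z)" by (simp add: orbit_sum_def zpow_def)
  moreover have "zpow (\<lambda>i. \<beta> (\<sigma> i)) z * zcut \<alpha> z = zcut (\<lambda>i. \<alpha> i + \<beta> (\<sigma> i)) z" for \<sigma>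
    using zpow_mult[of \<alpha> z "\<lambda>i. \<beta> (\<sigma> i)"] by (simp add: zcut_def mult.commute)
  ultimately show ?thesis by (simp add: sum_distrib_right)
qed

lemma coef_orbit_sum_mult:
  assumes "f \<in> dfun"
  shows "coef (\<lambda>z. orbit_sum \<beta> z * f z) \<gamma> = (\<Sum>\<sigma>\<in>Perms. if \<forall>i. \<beta> (\<sigma> i) \<le> \<gamma> i then coef f (\<lambda>i. \<gamma> i - \<beta> (\<sigma> i)) else 0)"
proof -
  have e: "(\<lambda>z. orbit_sum \<beta> z * f z) = (\<lambda>z. \<Sum>\<sigma>\<in>Perms. zpow (\<lambda>i. \<beta> (\<sigma> i)) z * f z)"
    by (simp add: orbit_sum_def zpow_def sum_distrib_right)
  have "coef (\<lambda>z. \<Sum>\<sigma>\<in>Perms. zpow (\<lambda>i. \<beta> (\<sigma> i)) z * f z) = (\<lambda>\<gamma>. \<Sum>\<sigma>\<in>Perms. coef (\<lambda>z. zpow (\<lambda>i. \<beta> (\<sigma> i)) z * f z) \<gamma>)"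
    by (rule coef_sum, rule dfun_mult[OF holo_zpow assms])
  then show ?thesis by (simp only: e coef_zpow_mult[OF assms])
qed

section \<open>Weighted and Hardy norms of coefficients\<close>

definition l2 :: "(('n::finite \<Rightarrow> nat) \<Rightarrow> real) \<Rightarrow> (('n \<Rightarrow> nat) \<Rightarrow> complex) \<Rightarrow> bool" where
  "l2 w a \<longleftrightarrow> (\<lambda>\<alpha>. (cmod (a \<alpha>))\<^sup>2 * w \<alpha>) summable_on UNIV"

definition nsq :: "(('n::finite \<Rightarrow> nat) \<Rightarrow> real) \<Rightarrow> (('n \<Rightarrow> nat) \<Rightarrow> complex) \<Rightarrow> real" where
  "nsq w a = infsum (\<lambda>\<alpha>. (cmod (a \<alpha>))\<^sup>2 * w \<alpha>) UNIV"

lemma A_space_l2: "1 \<le> lam \<Longrightarrow> f \<in> A_space lam \<longleftrightarrow> f \<in> dfun \<and> l2 (wpow lam) (coef f)"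
  by (simp add: A_space_iff l2_def)

lemma bnorm_nsq: "1 \<le> lam \<Longrightarrow> f \<in> A_space lam \<Longrightarrow> (bnorm lam f)\<^sup>2 = nsq (wpow lam) (coef f)"
  by (simp add: bnorm_sq nsq_def)

lemma norm_sum_sq: "(cmod (x + y))\<^sup>2 \<le> 2 * (cmod x)\<^sup>2 + 2 * (cmod y)\<^sup>2"
proof -
  have "(cmod (x + y))\<^sup>2 \<le> (cmod x + cmod y)\<^sup>2" by (intro power_mono norm_triangle_ineq) simp
  also have "\<dots> \<le> 2 * (cmod x)\<^sup>2 + 2 * (cmod y)\<^sup>2" using sum_squares_bound[of "cmod x" "cmod y"] by (simp add: power2_sum)
  finally show ?thesis .
qed

lemma l2_add:
  assumes w: "\<And>\<alpha>. 0 \<le> w \<alpha>" and a: "l2 w a" and b: "l2 w b"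
  shows "l2 w (\<lambda>\<alpha>. a \<alpha> + b \<alpha>)"
  unfolding l2_def
proof (rule summable_on_comparison_test)
  show "(\<lambda>\<alpha>. 2 * ((cmod (a \<alpha>))\<^sup>2 * w \<alpha>) + 2 * ((cmod (b \<alpha>))\<^sup>2 * w \<alpha>)) summable_on UNIV"
    by (intro summable_on_add summable_on_cmult_right) (use a b in \<open>simp_all only: l2_def\<close>)
  show "(cmod (a \<alpha> + b \<alpha>))\<^sup>2 * w \<alpha> \<le> 2 * ((cmod (a \<alpha>))\<^sup>2 * w \<alpha>) + 2 * ((cmod (b \<alpha>))\<^sup>2 * w \<alpha>)" for \<alpha>
    using mult_right_mono[OF norm_sum_sq w[of \<alpha>]] by (simp add: algebra_simps)
qed (use w in simp)

lemma l2_cmult: "l2 w a \<Longrightarrow> l2 w (\<lambda>\<alpha>. c * a \<alpha>)"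
  unfolding l2_def using summable_on_cmult_right[of "\<lambda>\<alpha>. (cmod (a \<alpha>))\<^sup>2 * w \<alpha>" UNIV "(cmod c)\<^sup>2"]
  by (simp add: norm_mult power_mult_distrib mult.assoc)

lemma l2_perm:
  assumes "\<sigma> \<in> Perms" "\<And>\<alpha>. w (\<alpha> \<circ> \<sigma>) = w \<alpha>" "l2 w a"
  shows "l2 w (\<lambda>\<alpha>. a (\<alpha> \<circ> \<sigma>))"
  using summable_on_reindex_bij_betw[OF bij_comp_right[OF assms(1)], of "\<lambda>\<alpha>. (cmod (a \<alpha>))\<^sup>2 * w \<alpha>"] assms(2,3)
  by (simp add: l2_def)

lemma wpow_perm: "\<sigma> \<in> Perms \<Longrightarrow> wpow lam (\<alpha> \<circ> \<sigma>) = wpow lam \<alpha>"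
  unfolding wpow_def using prod.reindex_bij_betw[OF Perms_bij, of \<sigma> "\<lambda>i. wseq lam (\<alpha> i)"] by simp

context
  fixes lam :: real
  assumes lam: "1 \<le> lam"
begin

lemma wpow_nonneg: "0 \<le> wpow lam \<alpha>"
  using wpow_pos[OF lam, of \<alpha>] by simp

lemma A_dfun: "f \<in> A_space lam \<Longrightarrow> f \<in> dfun"
  using A_space_l2[OF lam] by blast

lemma A_l2: "f \<in> A_space lam \<Longrightarrow> l2 (wpow lam) (coef f)"
  using A_space_l2[OF lam] by blast

lemma A_I: "f \<in> dfun \<Longrightarrow> l2 (wpow lam) (coef f) \<Longrightarrow> f \<in> A_space lam"
  using A_space_l2[OF lam] by blast

lemma A_add: "f \<in> A_space lam \<Longrightarrow> g \<in> A_space lam \<Longrightarrow> (\<lambda>z. f z + g z) \<in> A_space lam"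
  by (rule A_I) (simp_all add: A_dfun A_l2 dfun_add coef_add l2_add wpow_nonneg)

lemma A_cmult: "f \<in> A_space lam \<Longrightarrow> (\<lambda>z. c * f z) \<in> A_space lam"
  by (rule A_I) (simp_all add: A_dfun A_l2 dfun_cmult coef_cmult l2_cmult)

lemma A_0: "(\<lambda>_. 0) \<in> A_space lam"
  by (rule A_I) (simp_all add: dfun_0 coef_0 l2_def)

lemma A_sum: "(\<And>j. j \<in> J \<Longrightarrow> f j \<in> A_space lam) \<Longrightarrow> (\<lambda>z. \<Sum>j\<in>J. f j z) \<in> A_space lam"
  by (induction J rule: infinite_finite_induct) (simp_all add: A_0 A_add)

lemma A_act:
  assumes "f \<in> A_space lam" "\<sigma> \<in> Perms" shows "(\<lambda>z. f (act \<sigma> z)) \<in> A_space lam"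
proof (rule A_I)
  show "(\<lambda>z. f (act \<sigma> z)) \<in> dfun" using assms by (intro dfun_act A_dfun)
  have "l2 (wpow lam) (\<lambda>\<alpha>. coef f (\<alpha> \<circ> inv \<sigma>))"
    by (rule l2_perm[OF Perms_inv[OF assms(2)] wpow_perm[OF Perms_inv[OF assms(2)]] A_l2[OF assms(1)]])
  then show "l2 (wpow lam) (coef (\<lambda>z. f (act \<sigma> z)))" by (simp only: coef_act[OF A_dfun[OF assms(1)] assms(2)])
qed

lemma A_P11: "f \<in> A_space lam \<Longrightarrow> P11 d \<rho> f \<in> A_space lam"
  unfolding P11_eq by (rule A_cmult, rule A_sum, rule A_cmult, rule A_act)

lemma A_zcut: "zcut \<alpha> \<in> A_space lam"
proof (rule A_I[OF dfun_zcut])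
  have "(\<lambda>\<gamma>. (cmod (coef (zcut \<alpha>) \<gamma>))\<^sup>2 * wpow lam \<gamma>) summable_on {\<alpha>}" by simp
  then show "l2 (wpow lam) (coef (zcut \<alpha>))"
    unfolding l2_def by (rule summable_on_cong_neutral[THEN iffD1, rotated -1]) (auto simp: coef_zcut)
qed

end

text \<open>The supremum of a multiplier cannot be seen in its coefficients, so the estimate is made
  on the integrals that define the norm, once for each case of the definition.\<close>

lemma nrm2_mult_le:
  fixes f :: "complex^'n::finite \<Rightarrow> complex"
  assumes f: "f \<in> dfun" and C: "0 \<le> C" and h: "\<And>z. z \<in> polydisc \<Longrightarrow> cmod (h z) \<le> C"
  shows "bergman_nrm2 lam (\<lambda>z. h z * f z) \<le> ennreal (C\<^sup>2) * bergman_nrm2 lam f"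
proof -
  have fm [measurable]: "f \<in> borel_measurable borel" using holo_measurable[of f] f by (auto simp: dfun_def)
  have sq: "ennreal ((cmod (h z * f z))\<^sup>2 * x) \<le> ennreal (C\<^sup>2) * ennreal ((cmod (f z))\<^sup>2 * x)"
    if "z \<in> polydisc" "0 \<le> x" for z x
  proof -
    have "(cmod (h z))\<^sup>2 * ((cmod (f z))\<^sup>2 * x) \<le> C\<^sup>2 * ((cmod (f z))\<^sup>2 * x)"
      using h[OF that(1)] that(2) by (intro mult_right_mono power_mono) auto
    then show ?thesis using that(2) by (simp add: norm_mult power_mult_distrib mult.assoc flip: ennreal_mult)
  qed
  show ?thesis
  proof (cases "lam = 1")
    case True
    define I where "I f r = ennreal (1 / (2*pi) ^ CARD('n)) * (\<integral>\<^sup>+ \<theta>. indicator (cbox (0::real^'n) (\<chi> i. 2*pi)) \<theta> *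
              ennreal ((cmod (f (\<chi> i. complex_of_real r * cis (\<theta>$i))))\<^sup>2) \<partial>lborel)" for f :: "complex^'n \<Rightarrow> complex" and r
    have I: "I (\<lambda>z. h z * f z) r \<le> ennreal (C\<^sup>2) * I f r" if r: "r \<in> {0..<1}" for r
    proof -
      note fm' = torus_integrand_measurable[OF fm, of r]
      have m1: "(\<lambda>\<theta>. indicator (cbox (0::real^'n) (\<chi> i. 2*pi)) \<theta> *
              ennreal ((cmod (f (\<chi> i. complex_of_real r * cis (\<theta>$i))))\<^sup>2)) \<in> borel_measurable lborel"
        using fm' by measurable
      have pd: "(\<chi> i. complex_of_real r * cis (\<theta>$i)) \<in> polydisc" for \<theta> :: "real^'n"
        using r by (simp add: polydisc_def norm_mult)
      have "(\<integral>\<^sup>+ \<theta>. indicator (cbox (0::real^'n) (\<chi> i. 2*pi)) \<theta> *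
              ennreal ((cmod (h (\<chi> i. complex_of_real r * cis (\<theta>$i)) * f (\<chi> i. complex_of_real r * cis (\<theta>$i))))\<^sup>2) \<partial>lborel)
         \<le> (\<integral>\<^sup>+ \<theta>. ennreal (C\<^sup>2) * (indicator (cbox (0::real^'n) (\<chi> i. 2*pi)) \<theta> *
              ennreal ((cmod (f (\<chi> i. complex_of_real r * cis (\<theta>$i))))\<^sup>2)) \<partial>lborel)"
        by (rule nn_integral_mono) (use sq[OF pd, of 1] in \<open>auto simp: indicator_def\<close>)
      also have "\<dots> = ennreal (C\<^sup>2) * (\<integral>\<^sup>+ \<theta>. indicator (cbox (0::real^'n) (\<chi> i. 2*pi)) \<theta> *
              ennreal ((cmod (f (\<chi> i. complex_of_real r * cis (\<theta>$i))))\<^sup>2) \<partial>lborel)"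
        by (rule nn_integral_cmult[OF m1])
      finally show ?thesis unfolding I_def by (subst mult.left_commute) (rule mult_left_mono, simp_all)
    qed
    have "bergman_nrm2 lam (\<lambda>z. h z * f z) = (SUP r\<in>{0..<1}. I (\<lambda>z. h z * f z) r)"
      unfolding bergman_nrm2_def I_def if_P[OF True] ..
    also have "\<dots> \<le> ennreal (C\<^sup>2) * (SUP r\<in>{0..<1}. I f r)"
    proof (rule SUP_least)
      fix r :: real assume r: "r \<in> {0..<1}"
      have "I (\<lambda>z. h z * f z) r \<le> ennreal (C\<^sup>2) * I f r" by (rule I[OF r])
      also have "\<dots> \<le> ennreal (C\<^sup>2) * (SUP r\<in>{0..<1}. I f r)" by (rule mult_left_mono[OF SUP_upper[OF r]]) simp
      finally show "I (\<lambda>z. h z * f z) r \<le> ennreal (C\<^sup>2) * (SUP r\<in>{0..<1}. I f r)" .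
    qed
    also have "(SUP r\<in>{0..<1}. I f r) = bergman_nrm2 lam f" unfolding bergman_nrm2_def I_def if_P[OF True] ..
    finally show ?thesis .
  next
    case False
    let ?w = "\<lambda>z :: complex^'n. \<Prod>i\<in>UNIV. (1 - (cmod (z$i))\<^sup>2) powr (lam - 2)"
    note m1 = bergman_integrand_measurable[OF fm, of lam]
    have "(\<integral>\<^sup>+ z. indicator polydisc z * ennreal ((cmod (h z * f z))\<^sup>2 * ?w z) \<partial>lborel)
       \<le> (\<integral>\<^sup>+ z. ennreal (C\<^sup>2) * (indicator polydisc z * ennreal ((cmod (f z))\<^sup>2 * ?w z)) \<partial>lborel)"
    proof (rule nn_integral_mono)
      fix z :: "complex^'n"
      have "0 \<le> ?w z" by (intro prod_nonneg) auto
      note w0 = this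
      show "indicator polydisc z * ennreal ((cmod (h z * f z))\<^sup>2 * ?w z)
         \<le> ennreal (C\<^sup>2) * (indicator polydisc z * ennreal ((cmod (f z))\<^sup>2 * ?w z))"
      proof (cases "z \<in> polydisc")
        case True
        then have i: "indicator polydisc z = (1 :: ennreal)" by simp
        show ?thesis unfolding i mult_1_left by (rule sq[OF True w0])
      next
        case False
        then have i: "indicator polydisc z = (0 :: ennreal)" by simp
        show ?thesis unfolding i mult_zero_left by simp
      qed
    qed
    also have "\<dots> = ennreal (C\<^sup>2) * (\<integral>\<^sup>+ z. indicator polydisc z * ennreal ((cmod (f z))\<^sup>2 * ?w z) \<partial>lborel)"
      by (rule nn_integral_cmult[OF m1])
    finally show ?thesis unfolding bergman_nrm2_def if_not_P[OF False]
      by (subst mult.left_commute) (rule mult_left_mono, simp_all)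
  qed
qed

lemma A_mult:
  assumes f: "f \<in> A_space lam" and hh: "holo_on h polydisc" and C: "0 \<le> C" and h: "\<And>z. z \<in> polydisc \<Longrightarrow> cmod (h z) \<le> C"
  shows "(\<lambda>z. h z * f z) \<in> A_space lam" "bnorm lam (\<lambda>z. h z * f z) \<le> C * bnorm lam f"
proof -
  have fd: "f \<in> dfun" and fin: "bergman_nrm2 lam f < \<infinity>" using f by (auto simp: A_space_def dfun_def)
  have le: "bergman_nrm2 lam (\<lambda>z. h z * f z) \<le> ennreal (C\<^sup>2) * bergman_nrm2 lam f" by (rule nrm2_mult_le[OF fd C h])
  have fin2: "ennreal (C\<^sup>2) * bergman_nrm2 lam f < \<infinity>" using fin by (simp add: ennreal_mult_less_top)
  have "bergman_nrm2 lam (\<lambda>z. h z * f z) < \<infinity>" using le fin2 by (rule le_less_trans)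
  then show "(\<lambda>z. h z * f z) \<in> A_space lam" using dfun_mult[OF hh fd] by (auto simp: A_space_def dfun_def)
  have "enn2real (bergman_nrm2 lam (\<lambda>z. h z * f z)) \<le> C\<^sup>2 * enn2real (bergman_nrm2 lam f)"
    using enn2real_mono[OF le] fin2 by (simp add: enn2real_mult)
  then have "sqrt (enn2real (bergman_nrm2 lam (\<lambda>z. h z * f z))) \<le> sqrt (C\<^sup>2 * enn2real (bergman_nrm2 lam f))"
    by (rule real_sqrt_le_mono)
  then show "bnorm lam (\<lambda>z. h z * f z) \<le> C * bnorm lam f" using C by (simp add: bnorm_def real_sqrt_mult)
qed

text \<open>Each product has modulus at most 1; counting all subsets gives one bound for every
  \<open>k\<close>.\<close>

lemma esym_bound: "z \<in> cpolydisc \<Longrightarrow> cmod (esym k (z :: complex^'n::finite)) \<le> real (card (UNIV :: 'n set set))"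
proof -
  assume z: "z \<in> cpolydisc"
  have "cmod (esym k z) \<le> (\<Sum>S\<in>{S::'n set. card S = k}. 1)"
    unfolding esym_def
  proof (rule order_trans[OF norm_sum sum_mono])
    fix S :: "'n set"
    show "cmod (\<Prod>i\<in>S. z $ i) \<le> 1" unfolding prod_norm[symmetric]
      using z by (intro prod_le_1) (auto simp: cpolydisc_def)
  qed
  also have "\<dots> = real (card {S::'n set. card S = k})" by simp
  also have "\<dots> \<le> real (card (UNIV :: 'n set set))" by (rule of_nat_mono, rule card_mono) auto
  finally show ?thesis .
qed

lemma polydisc_subset: "z \<in> polydisc \<Longrightarrow> z \<in> cpolydisc"
  by (auto simp: polydisc_def cpolydisc_def less_imp_le)

lemma A_esym:
  assumes "f \<in> A_space lam" shows "mult_tuple k f \<in> A_space lam"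
  unfolding mult_tuple_def
  by (rule A_mult(1)[OF assms holo_esym _ esym_bound[OF polydisc_subset]]) simp

text \<open>Multiplying by powers of the last elementary symmetric function shifts all weights; since
  consecutive weights have ratio tending to \<open>1\<close>, the weighted norms recover the Hardy norm in the limit.\<close>
lemma hardy_from_shifts:
  fixes a b :: "('n::finite \<Rightarrow> nat) \<Rightarrow> complex"
  assumes lam: "1 \<le> lam"
    and b: "\<And>m. l2 (\<lambda>\<alpha>. wpow lam (\<lambda>i. \<alpha> i + m)) b"
    and eq: "\<And>m. nsq (\<lambda>\<alpha>. wpow lam (\<lambda>i. \<alpha> i + m)) b = nsq (\<lambda>\<alpha>. wpow lam (\<lambda>i. \<alpha> i + m)) a"
    and a: "l2 (\<lambda>_. 1) a"
  shows "l2 (\<lambda>_. 1) b" "nsq (\<lambda>_. 1) b \<le> nsq (\<lambda>_. 1) a"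
proof -
  let ?w = "\<lambda>m \<alpha>. wpow lam (\<lambda>i. \<alpha> i + m)"
  \<comment> \<open>Normalising by the weight of the constant exponent \<open>m\<close> makes the
    shifted weights at most 1, by monotonicity, and convergent to 1, by the ratio limit.\<close>
  define W where "W m = wpow lam (\<lambda>_::'n. m)" for m
  have Wp: "0 < W m" for m unfolding W_def by (rule wpow_pos[OF lam])
  have wp: "0 < ?w m \<alpha>" for m :: nat and \<alpha> :: "'n \<Rightarrow> nat" by (rule wpow_pos[OF lam])
  have sdec: "wseq lam (k + m) \<le> wseq lam m" for k m
    by (induction k) (auto intro: order_trans[OF wseq_Suc_le[OF lam]])
  have wW: "?w m \<alpha> \<le> W m" for m :: nat and \<alpha> :: "'n \<Rightarrow> nat"
    unfolding W_def wpow_def using wseq_pos[OF lam] sdec by (intro prod_mono) (auto intro: less_imp_le)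
  have rat: "(\<lambda>m. wseq lam (k + m) / wseq lam m) \<longlonglongrightarrow> 1" for k
  proof (induction k)
    case 0
    have "wseq lam (0 + m) / wseq lam m = 1" for m using wseq_pos[OF lam, of m] by simp
    then show ?case by simp
  next
    case (Suc k)
    have "(\<lambda>m. wseq lam (Suc (m + k)) / wseq lam (m + k)) \<longlonglongrightarrow> 1"
      by (rule LIMSEQ_ignore_initial_segment[OF wseq_ratio[OF lam]])
    from tendsto_mult[OF this Suc.IH]
    have "(\<lambda>m. wseq lam (Suc (m + k)) / wseq lam (m + k) * (wseq lam (k + m) / wseq lam m)) \<longlonglongrightarrow> 1" by simp
    moreover have "wseq lam (Suc (m + k)) / wseq lam (m + k) * (wseq lam (k + m) / wseq lam m) = wseq lam (Suc k + m) / wseq lam m" for m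
      using wseq_pos[OF lam, of "m + k"] by (simp add: add.commute)
    ultimately show ?case by simp
  qed
  have ratw: "(\<lambda>m. ?w m \<alpha> / W m) \<longlonglongrightarrow> 1" for \<alpha> :: "'n \<Rightarrow> nat"
  proof -
    have "(\<lambda>m. \<Prod>i\<in>UNIV. wseq lam (\<alpha> i + m) / wseq lam m) \<longlonglongrightarrow> (\<Prod>i\<in>(UNIV::'n set). 1)"
      by (intro tendsto_prod rat)
    then show ?thesis by (simp add: wpow_def W_def prod_dividef)
  qed
  have nn: "0 \<le> (cmod (a \<alpha>))\<^sup>2 * 1" for \<alpha> by simp
  \<comment> \<open>On the side of \<open>a\<close> the normalised weights are at most 1, so its
    Hardy norm is an upper bound for every \<open>m\<close>; on the side of \<open>b\<close> the
    limit in \<open>m\<close> is taken inside a finite sum.\<close>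
  have fin: "(\<Sum>\<alpha>\<in>exps N. (cmod (b \<alpha>))\<^sup>2 * 1) \<le> nsq (\<lambda>_. 1) a" for N
  proof (rule LIMSEQ_le_const2)
    show "(\<lambda>m. \<Sum>\<alpha>\<in>exps N. (cmod (b \<alpha>))\<^sup>2 * (?w m \<alpha> / W m)) \<longlonglongrightarrow> (\<Sum>\<alpha>\<in>exps N. (cmod (b \<alpha>))\<^sup>2 * 1)"
      by (intro tendsto_sum tendsto_mult tendsto_const ratw)
    have "(\<Sum>\<alpha>\<in>exps N. (cmod (b \<alpha>))\<^sup>2 * (?w m \<alpha> / W m)) \<le> nsq (\<lambda>_. 1) a" for m
    proof -
      have sa: "(\<lambda>\<alpha>. (cmod (a \<alpha>))\<^sup>2 * 1 * W m) summable_on UNIV" using a unfolding l2_def by (rule summable_on_cmult_left)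
      have le: "(cmod (a \<alpha>))\<^sup>2 * ?w m \<alpha> \<le> (cmod (a \<alpha>))\<^sup>2 * 1 * W m" for \<alpha> using wW[of \<alpha> m] by (simp add: mult_left_mono)
      have sa': "(\<lambda>\<alpha>. (cmod (a \<alpha>))\<^sup>2 * ?w m \<alpha>) summable_on UNIV"
        by (rule summable_on_comparison_test[OF sa le]) (simp add: wp less_imp_le)
      have "(\<Sum>\<alpha>\<in>exps N. (cmod (b \<alpha>))\<^sup>2 * ?w m \<alpha>) \<le> nsq (?w m) b"
        unfolding nsq_def using b[of m, unfolded l2_def] by (rule finite_sum_le_infsum) (simp_all add: wp less_imp_le)
      also have "\<dots> = nsq (?w m) a" by (rule eq)
      also have "\<dots> \<le> infsum (\<lambda>\<alpha>. (cmod (a \<alpha>))\<^sup>2 * 1 * W m) UNIV"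
        unfolding nsq_def by (rule infsum_mono[OF sa' sa le])
      also have "\<dots> = nsq (\<lambda>_. 1) a * W m" unfolding nsq_def by (rule infsum_cmult_left') 
      finally have "(\<Sum>\<alpha>\<in>exps N. (cmod (b \<alpha>))\<^sup>2 * ?w m \<alpha>) / W m \<le> nsq (\<lambda>_. 1) a"
        using Wp[of m] by (simp add: pos_divide_le_eq)
      then show ?thesis by (simp add: sum_divide_distrib)
    qed
    then show "\<exists>M. \<forall>m\<ge>M. (\<Sum>\<alpha>\<in>exps N. (cmod (b \<alpha>))\<^sup>2 * (?w m \<alpha> / W m)) \<le> nsq (\<lambda>_. 1) a" by blast
  qed
  show l: "l2 (\<lambda>_. 1) b" unfolding l2_def by (rule exps_bounded_summable[OF _ fin]) simp
  have "(\<lambda>N. \<Sum>\<alpha>\<in>exps N. (cmod (b \<alpha>))\<^sup>2 * 1) \<longlonglongrightarrow> nsq (\<lambda>_. 1) b"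
    unfolding nsq_def by (rule has_sum_exps[OF has_sum_infsum[OF l[unfolded l2_def]]])
  then show "nsq (\<lambda>_. 1) b \<le> nsq (\<lambda>_. 1) a" by (rule LIMSEQ_le_const2) (use fin in blast)
qed

section \<open>The Hardy inner product on coefficients\<close>

definition ip :: "(('n::finite \<Rightarrow> nat) \<Rightarrow> complex) \<Rightarrow> (('n \<Rightarrow> nat) \<Rightarrow> complex) \<Rightarrow> complex" where
  "ip a b = infsum (\<lambda>\<alpha>. a \<alpha> * cnj (b \<alpha>)) UNIV"

abbreviation "ell2 \<equiv> l2 (\<lambda>_. 1)"

lemma ip_summable:
  assumes "ell2 a" "ell2 b" shows "(\<lambda>\<alpha>. a \<alpha> * cnj (b \<alpha>)) summable_on UNIV"
proof -
  have "(\<lambda>\<alpha>. norm (a \<alpha> * a \<alpha>)) summable_on UNIV" "(\<lambda>\<alpha>. norm (cnj (b \<alpha>) * cnj (b \<alpha>))) summable_on UNIV"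
    using assms by (simp_all add: l2_def norm_mult power2_eq_square)
  then have "(\<lambda>\<alpha>. norm (a \<alpha> * cnj (b \<alpha>))) summable_on UNIV" by (rule abs_summable_product)
  then show ?thesis by (rule abs_summable_summable)
qed

lemma ip_sym: "ip b a = cnj (ip a b)"
  unfolding ip_def by (simp add: mult.commute flip: infsum_cnj)

lemma ip_self: "ip a a = complex_of_real (nsq (\<lambda>_. 1) a)" if "ell2 a"
proof -
  have "((\<lambda>\<alpha>. (cmod (a \<alpha>))\<^sup>2 * 1) has_sum nsq (\<lambda>_. 1) a) UNIV" using that by (simp add: nsq_def l2_def)
  then have "((\<lambda>\<alpha>. complex_of_real ((cmod (a \<alpha>))\<^sup>2 * 1)) has_sum complex_of_real (nsq (\<lambda>_. 1) a)) UNIV"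
    by (rule has_sum_of_real)
  moreover have "complex_of_real ((cmod (a \<alpha>))\<^sup>2 * 1) = a \<alpha> * cnj (a \<alpha>)" for \<alpha>
    by (simp only: mult_1_right complex_norm_square)
  ultimately show ?thesis unfolding ip_def by (simp only: infsumI)
qed

lemma ip_add_left:
  assumes "ell2 a" "ell2 b" "ell2 c" shows "ip (\<lambda>\<alpha>. a \<alpha> + b \<alpha>) c = ip a c + ip b c"
  unfolding ip_def distrib_right by (rule infsum_add[OF ip_summable[OF assms(1,3)] ip_summable[OF assms(2,3)]])

lemma ip_cmult_left: "ip (\<lambda>\<alpha>. c * a \<alpha>) b = c * ip a b"
  unfolding ip_def mult.assoc by (rule infsum_cmult_right')

lemma ip_add_right:
  assumes "ell2 a" "ell2 b" "ell2 c" shows "ip c (\<lambda>\<alpha>. a \<alpha> + b \<alpha>) = ip c a + ip c b"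
  using ip_add_left[OF assms] by (simp add: ip_sym[of c])

lemma ip_cmult_right: "ip b (\<lambda>\<alpha>. c * a \<alpha>) = cnj c * ip b a"
  using ip_cmult_left[of c a b] by (simp add: ip_sym[of b])

lemma ell2_0: "ell2 (\<lambda>_. 0)"
  by (simp add: l2_def)

lemma ell2_add: "ell2 a \<Longrightarrow> ell2 b \<Longrightarrow> ell2 (\<lambda>\<alpha>. a \<alpha> + b \<alpha>)"
  by (rule l2_add) auto

lemma ell2_sum: "(\<And>j. j \<in> J \<Longrightarrow> ell2 (a j)) \<Longrightarrow> ell2 (\<lambda>\<alpha>. \<Sum>j\<in>J. a j \<alpha>)"
  by (induction J rule: infinite_finite_induct) (simp_all add: ell2_0 ell2_add)

lemma ip_0_left: "ip (\<lambda>_. 0) b = 0"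
  by (simp add: ip_def)

lemma ip_sum_left:
  assumes "\<And>j. j \<in> J \<Longrightarrow> ell2 (a j)" "ell2 b"
  shows "ip (\<lambda>\<alpha>. \<Sum>j\<in>J. a j \<alpha>) b = (\<Sum>j\<in>J. ip (a j) b)"
  using assms(1)
proof (induction J rule: infinite_finite_induct)
  case (insert j J)
  have "ip (\<lambda>\<alpha>. a j \<alpha> + (\<Sum>j\<in>J. a j \<alpha>)) b = ip (a j) b + ip (\<lambda>\<alpha>. \<Sum>j\<in>J. a j \<alpha>) b"
    using insert by (intro ip_add_left ell2_sum assms(2)) auto
  then show ?case using insert by simp
qed (simp_all add: ip_0_left)

lemma ip_sum_right:
  assumes "\<And>j. j \<in> J \<Longrightarrow> ell2 (a j)" "ell2 b"
  shows "ip b (\<lambda>\<alpha>. \<Sum>j\<in>J. a j \<alpha>) = (\<Sum>j\<in>J. ip b (a j))"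
  using ip_sum_left[of J a b, OF assms] by (simp add: ip_sym[of b])

lemma ip_delta: "ip a (\<lambda>\<gamma>. if \<gamma> = \<delta> then 1 else 0) = a \<delta>"
proof -
  have "((\<lambda>\<alpha>. a \<alpha> * cnj (if \<alpha> = \<delta> then 1 else 0)) has_sum a \<delta>) {\<delta>}"
    by (rule has_sum_finiteI) auto
  then have "((\<lambda>\<alpha>. a \<alpha> * cnj (if \<alpha> = \<delta> then 1 else 0)) has_sum a \<delta>) UNIV"
    by (rule has_sum_UNIV_support) auto
  then show ?thesis unfolding ip_def by (rule infsumI)
qed

lemma ip_perm:
  assumes s: "\<sigma> \<in> Perms" shows "ip (\<lambda>\<alpha>. a (\<alpha> \<circ> inv \<sigma>)) b = ip a (\<lambda>\<alpha>. b (\<alpha> \<circ> \<sigma>))"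
proof -
  have c: "\<alpha> \<circ> \<sigma> \<circ> inv \<sigma> = \<alpha>" for \<alpha> :: "'a \<Rightarrow> nat" using s by (simp add: comp_assoc permutes_inv_o)
  show ?thesis unfolding ip_def
    using infsum_reindex_bij_betw[OF bij_comp_right[OF s], of "\<lambda>\<alpha>. a (\<alpha> \<circ> inv \<sigma>) * cnj (b \<alpha>)"] by (simp only: c)
qed

lemma ell2_perm: "\<sigma> \<in> Perms \<Longrightarrow> ell2 a \<Longrightarrow> ell2 (\<lambda>\<alpha>. a (\<alpha> \<circ> \<sigma>))"
  by (rule l2_perm) auto

lemma ell2_P11: "f \<in> dfun \<Longrightarrow> ell2 (coef f) \<Longrightarrow> ell2 (coef (P11 d \<rho> f))"
  unfolding coef_P11 by (rule l2_cmult, rule ell2_sum, rule l2_cmult, rule ell2_perm[OF Perms_inv])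

text \<open>The adjoint of a coordinate permutation is its inverse, unitarity conjugates the matrix
  entry under inversion, and the sum runs over the whole group.\<close>

lemma P11_selfadjoint:
  fixes f g :: "complex^'n::finite \<Rightarrow> complex"
  assumes uni: "unitary_rep d \<rho>" and f: "f \<in> dfun" "ell2 (coef f)" and g: "g \<in> dfun" "ell2 (coef g)"
  shows "ip (coef (P11 d \<rho> f)) (coef g) = ip (coef f) (coef (P11 d \<rho> g))"
proof -
  define c :: complex where "c = of_nat d / of_nat (fact CARD('n))"
  have cc: "cnj c = c" by (simp add: c_def)
  have "ip (coef (P11 d \<rho> f)) (coef g) = c * ip (\<lambda>\<gamma>. \<Sum>\<tau>\<in>Perms. \<rho> \<tau> 0 0 * coef f (\<gamma> \<circ> inv \<tau>)) (coef g)"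
    unfolding coef_P11[OF f(1)] c_def by (rule ip_cmult_left)
  also have "\<dots> = c * (\<Sum>\<tau>\<in>Perms. ip (\<lambda>\<gamma>. \<rho> \<tau> 0 0 * coef f (\<gamma> \<circ> inv \<tau>)) (coef g))"
    by (subst ip_sum_left) (rule l2_cmult ell2_perm[OF Perms_inv] f g refl | assumption)+
  also have "\<dots> = c * (\<Sum>\<tau>\<in>Perms. ip (coef f) (\<lambda>\<gamma>. \<rho> (inv \<tau>) 0 0 * coef g (\<gamma> \<circ> \<tau>)))"
    by (intro arg_cong2[where f = "(*)"] refl sum.cong)
       (simp only: ip_cmult_left ip_cmult_right ip_perm unitary_rep_inv00[OF uni] complex_cnj_cnj)
  also have "(\<Sum>\<tau>\<in>Perms. ip (coef f) (\<lambda>\<gamma>. \<rho> (inv \<tau>) 0 0 * coef g (\<gamma> \<circ> \<tau>)))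
     = (\<Sum>\<tau>\<in>Perms. ip (coef f) (\<lambda>\<gamma>. \<rho> (inv (inv \<tau>)) 0 0 * coef g (\<gamma> \<circ> inv \<tau>)))"
    by (rule sum.reindex_bij_betw[OF bij_betw_Perms_inv, symmetric])
  also have "\<dots> = (\<Sum>\<tau>\<in>Perms. ip (coef f) (\<lambda>\<gamma>. \<rho> \<tau> 0 0 * coef g (\<gamma> \<circ> inv \<tau>)))"
    by (rule sum.cong[OF refl]) (simp add: permutes_inv_inv)
  also have "\<dots> = ip (coef f) (\<lambda>\<gamma>. \<Sum>\<tau>\<in>Perms. \<rho> \<tau> 0 0 * coef g (\<gamma> \<circ> inv \<tau>))"
    by (rule ip_sum_right[symmetric]) (rule l2_cmult ell2_perm[OF Perms_inv] f g | assumption)+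
  also have "c * \<dots> = ip (coef f) (\<lambda>\<gamma>. c * (\<Sum>\<tau>\<in>Perms. \<rho> \<tau> 0 0 * coef g (\<gamma> \<circ> inv \<tau>)))"
    by (simp only: ip_cmult_right cc)
  finally show ?thesis by (simp only: coef_P11[OF g(1)] c_def)
qed

lemma nsq_add:
  assumes "ell2 a" "ell2 b"
  shows "complex_of_real (nsq (\<lambda>_. 1) (\<lambda>\<alpha>. a \<alpha> + b \<alpha>)) = complex_of_real (nsq (\<lambda>_. 1) a) + complex_of_real (nsq (\<lambda>_. 1) b) + complex_of_real (2 * Re (ip a b))"
proof -
  have "complex_of_real (nsq (\<lambda>_. 1) (\<lambda>\<alpha>. a \<alpha> + b \<alpha>)) = ip (\<lambda>\<alpha>. a \<alpha> + b \<alpha>) (\<lambda>\<alpha>. a \<alpha> + b \<alpha>)"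
    by (rule ip_self[symmetric, OF ell2_add[OF assms]])
  also have "\<dots> = ip a a + ip a b + (ip b a + ip b b)"
    using assms by (simp only: ip_add_left ip_add_right ell2_add)
  also have "\<dots> = ip a a + ip b b + (ip a b + cnj (ip a b))" by (simp add: ip_sym[of b a])
  also have "ip a b + cnj (ip a b) = complex_of_real (2 * Re (ip a b))" by (rule complex_add_cnj)
  finally show ?thesis by (simp only: ip_self assms)
qed

text \<open>Polarisation: c = 1 recovers the real part of the pairing and c = i the imaginary
  part.\<close>

lemma ip_polarize:
  assumes l: "ell2 a" "ell2 b" "ell2 a'" "ell2 b'"
    and 1: "nsq (\<lambda>_. 1) a' = nsq (\<lambda>_. 1) a" "nsq (\<lambda>_. 1) b' = nsq (\<lambda>_. 1) b"
    and 2: "\<And>c. nsq (\<lambda>_. 1) (\<lambda>\<alpha>. a' \<alpha> + c * b' \<alpha>) = nsq (\<lambda>_. 1) (\<lambda>\<alpha>. a \<alpha> + c * b \<alpha>)"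
  shows "ip a' b' = ip a b"
proof -
  have n: "nsq (\<lambda>_. 1) (\<lambda>\<alpha>. c * x \<alpha>) = (cmod c)\<^sup>2 * nsq (\<lambda>_. 1) x" for c x
    unfolding nsq_def by (simp add: norm_mult power_mult_distrib infsum_cmult_right')
  have re: "Re (ip a' (\<lambda>\<alpha>. c * b' \<alpha>)) = Re (ip a (\<lambda>\<alpha>. c * b \<alpha>))" for c
  proof -
    have "complex_of_real (2 * Re (ip a' (\<lambda>\<alpha>. c * b' \<alpha>))) = complex_of_real (2 * Re (ip a (\<lambda>\<alpha>. c * b \<alpha>)))"
      using nsq_add[OF l(3) l2_cmult[OF l(4), of c]] nsq_add[OF l(1) l2_cmult[OF l(2), of c]] unfolding 1 2 n by simp
    then show ?thesis by (simp only: of_real_eq_iff)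
  qed
  have "Re (ip a' b') = Re (ip a b)" using re[of 1] by simp
  moreover have "Im (ip a' b') = Im (ip a b)" using re[of \<i>] by (simp add: ip_cmult_right)
  ultimately show ?thesis by (simp add: complex_eq_iff)
qed

section \<open>Intertwiners\<close>

text \<open>The data common to a unitary equivalence and its inverse. The inverse is again an
  instance with the two representations exchanged, so each result is available in both
  directions.\<close>

locale intertwiner =
  fixes lam :: real and d d' :: nat and \<rho> \<rho>' :: "('n::finite \<Rightarrow> 'n) \<Rightarrow> nat \<Rightarrow> nat \<Rightarrow> complex"
    and U :: "(complex^'n \<Rightarrow> complex) \<Rightarrow> complex^'n \<Rightarrow> complex"
  assumes lam: "1 \<le> lam"
    and unitary: "unitary_rep d \<rho>" "unitary_rep d' \<rho>'"
    and lin: "lin_op_on (P11 d \<rho> ` A_space lam) U"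
    and maps: "f \<in> P11 d \<rho> ` A_space lam \<Longrightarrow> U f \<in> P11 d' \<rho>' ` A_space lam"
    and isometric: "f \<in> P11 d \<rho> ` A_space lam \<Longrightarrow> bnorm lam (U f) = bnorm lam f"
    and intertwines: "k \<in> {1..CARD('n)} \<Longrightarrow> f \<in> P11 d \<rho> ` A_space lam \<Longrightarrow> U (mult_tuple k f) = mult_tuple k (U f)"
begin

abbreviation "P \<equiv> P11 d \<rho>"
abbreviation "P' \<equiv> P11 d' \<rho>'"
abbreviation "H \<equiv> P ` A_space lam"
abbreviation "H' \<equiv> P' ` A_space lam"

lemma H_A: "f \<in> H \<Longrightarrow> f \<in> A_space lam"
  using A_P11[OF lam] by blast

lemma H'_A: "f \<in> H' \<Longrightarrow> f \<in> A_space lam"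
  using A_P11[OF lam] by blast

lemma P_H: "f \<in> A_space lam \<Longrightarrow> P f \<in> H"
  by (rule imageI)

lemma H_add:
  assumes "f \<in> H" "g \<in> H" shows "(\<lambda>z. f z + g z) \<in> H"
proof -
  obtain x y where "x \<in> A_space lam" "y \<in> A_space lam" "f = P x" "g = P y" using assms by blast
  then show ?thesis using P_H[OF A_add[OF lam]] by (simp only: P11_add[symmetric])
qed

lemma H_cmult:
  assumes "f \<in> H" shows "(\<lambda>z. c * f z) \<in> H"
proof -
  obtain x where "x \<in> A_space lam" "f = P x" using assms by blast
  then show ?thesis using P_H[OF A_cmult[OF lam]] by (simp only: P11_cmult[symmetric])
qed

lemma H_0: "(\<lambda>_. 0) \<in> H"
  using P_H[OF A_0[OF lam]] by (simp only: P11_0)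

lemma H_esym:
  assumes "f \<in> H" shows "mult_tuple k f \<in> H"
proof -
  obtain x where x: "x \<in> A_space lam" "f = P x" using assms by blast
  have "mult_tuple k f = P (mult_tuple k x)"
    unfolding x(2) mult_tuple_def by (rule P11_invariant_mult[symmetric, OF esym_act])
  then show ?thesis using P_H[OF A_esym[OF x(1)]] by (simp only:)
qed

lemma U_add: "f \<in> H \<Longrightarrow> g \<in> H \<Longrightarrow> U (\<lambda>z. f z + g z) = (\<lambda>z. U f z + U g z)"
  using lin unfolding lin_op_on_def by blast

lemma U_cmult: "f \<in> H \<Longrightarrow> U (\<lambda>z. c * f z) = (\<lambda>z. c * U f z)"
  using lin unfolding lin_op_on_def by blast

lemma U_0: "U (\<lambda>_. 0) = (\<lambda>_. 0)"
  using U_cmult[OF H_0, of 0] by simp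

text \<open>The multipliers that preserve \<open>H\<close> and commute with \<open>U\<close> form an
  algebra containing the generators s_k, so \<open>symmetric_algebra\<close> puts all orbit sums
  into it.\<close>

lemma orbit_sum_intertwines:
  assumes f: "f \<in> H"
  shows "(\<lambda>z. orbit_sum \<beta> z * f z) \<in> H" "U (\<lambda>z. orbit_sum \<beta> z * f z) = (\<lambda>z. orbit_sum \<beta> z * U f z)"
proof -
  define R where "R = {h. \<forall>f\<in>H. (\<lambda>z. h z * f z) \<in> H \<and> U (\<lambda>z. h z * f z) = (\<lambda>z. h z * U f z)}"
  have "orbit_sum \<beta> \<in> R"
  proof (rule symmetric_algebra)
    show "(\<lambda>_. c) \<in> R" for c unfolding R_def using H_cmult U_cmult by blast
    show "(\<lambda>z. f z + g z) \<in> R" if "f \<in> R" "g \<in> R" for f g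
      unfolding R_def
    proof (intro CollectI ballI)
      fix x assume x: "x \<in> H"
      have 1: "(\<lambda>z. f z * x z) \<in> H" "U (\<lambda>z. f z * x z) = (\<lambda>z. f z * U x z)"
        and 2: "(\<lambda>z. g z * x z) \<in> H" "U (\<lambda>z. g z * x z) = (\<lambda>z. g z * U x z)"
        using that x by (auto simp: R_def)
      show "(\<lambda>z. (f z + g z) * x z) \<in> H \<and> U (\<lambda>z. (f z + g z) * x z) = (\<lambda>z. (f z + g z) * U x z)"
        using H_add[OF 1(1) 2(1)] U_add[OF 1(1) 2(1)] by (simp only: distrib_right 1(2) 2(2))
    qed
    show "(\<lambda>z. f z * g z) \<in> R" if "f \<in> R" "g \<in> R" for f g
      unfolding R_def
    proof (intro CollectI ballI)
      fix x assume x: "x \<in> H"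
      have 2: "(\<lambda>z. g z * x z) \<in> H" "U (\<lambda>z. g z * x z) = (\<lambda>z. g z * U x z)"
        using that x by (auto simp: R_def)
      have 1: "(\<lambda>z. f z * (g z * x z)) \<in> H" "U (\<lambda>z. f z * (g z * x z)) = (\<lambda>z. f z * U (\<lambda>z. g z * x z) z)"
      proof -
        from that(1) have "\<forall>y\<in>H. (\<lambda>z. f z * y z) \<in> H \<and> U (\<lambda>z. f z * y z) = (\<lambda>z. f z * U y z)"
          by (simp only: R_def mem_Collect_eq)
        from bspec[OF this 2(1)] show "(\<lambda>z. f z * (g z * x z)) \<in> H" "U (\<lambda>z. f z * (g z * x z)) = (\<lambda>z. f z * U (\<lambda>z. g z * x z) z)"
          by (rule conjunct1, rule conjunct2)
      qed
      show "(\<lambda>z. (f z * g z) * x z) \<in> H \<and> U (\<lambda>z. (f z * g z) * x z) = (\<lambda>z. (f z * g z) * U x z)"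
        using 1 by (simp only: mult.assoc 2(2))
    qed
    show "esym k \<in> R" if "k \<in> {1..CARD('n)}" for k
      unfolding R_def using H_esym intertwines[OF that] by (simp add: mult_tuple_def)
  qed
  then show "(\<lambda>z. orbit_sum \<beta> z * f z) \<in> H" "U (\<lambda>z. orbit_sum \<beta> z * f z) = (\<lambda>z. orbit_sum \<beta> z * U f z)"
    using f by (auto simp: R_def)
qed

lemma shift_intertwines:
  assumes f: "f \<in> H"
  shows "(\<lambda>z. zpow (\<lambda>_. m) z * f z) \<in> H \<and> U (\<lambda>z. zpow (\<lambda>_. m) z * f z) = (\<lambda>z. zpow (\<lambda>_. m) z * U f z)"
proof -
  have N: "esym CARD('n) z = zpow (\<lambda>_. 1) z" for z :: "complex^'n"
  proof -
    have "{S::'n set. card S = CARD('n)} = {UNIV}" using card_subset_eq[of "UNIV :: 'n set"] by auto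
    then show ?thesis by (simp add: esym_def zpow_def)
  qed
  have cn: "CARD('n) \<in> {1..CARD('n)}" by (simp add: Suc_le_eq card_gt_0_iff)
  show ?thesis
  proof (induction m)
    case 0
    have "zpow (\<lambda>_. 0) z = 1" for z :: "complex^'n" by (simp add: zpow_def)
    then show ?case using f by simp
  next
    case (Suc m)
    have e: "zpow (\<lambda>_. Suc m) z * x = esym CARD('n) z * (zpow (\<lambda>_. m) z * x)" for z :: "complex^'n" and x
      unfolding N mult.assoc[symmetric] zpow_mult by simp
    have "U (\<lambda>z. zpow (\<lambda>_. Suc m) z * f z) = U (mult_tuple CARD('n) (\<lambda>z. zpow (\<lambda>_. m) z * f z))"
      by (simp only: e mult_tuple_def)
    also have "\<dots> = mult_tuple CARD('n) (U (\<lambda>z. zpow (\<lambda>_. m) z * f z))"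
      using Suc by (intro intertwines[OF cn]) blast
    also have "\<dots> = (\<lambda>z. zpow (\<lambda>_. Suc m) z * U f z)"
      using Suc by (simp only: e mult_tuple_def)
    finally show ?case using H_esym[of "\<lambda>z. zpow (\<lambda>_. m) z * f z" "CARD('n)"] Suc
      by (simp only: e mult_tuple_def simp_thms)
  qed
qed

text \<open>Translating exponents by \<open>m\<close> turns the norm of the shifted function into a
  norm of \<open>f\<close> for the translated weight, as \<open>hardy_from_shifts\<close>
  requires.\<close>

lemma shifted_norm:
  fixes f :: "complex^'n \<Rightarrow> complex"
  assumes f: "f \<in> dfun" and sf: "(\<lambda>z. zpow (\<lambda>_. m) z * f z) \<in> A_space lam"
  shows "l2 (\<lambda>\<alpha>. wpow lam (\<lambda>i. \<alpha> i + m)) (coef f)"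
    "(bnorm lam (\<lambda>z. zpow (\<lambda>_. m) z * f z))\<^sup>2 = nsq (\<lambda>\<alpha>. wpow lam (\<lambda>i. \<alpha> i + m)) (coef f)"
proof -
  let ?h = "\<lambda>\<alpha> :: 'n \<Rightarrow> nat. \<lambda>i. \<alpha> i + m"
  let ?F = "\<lambda>\<gamma>. (cmod (coef (\<lambda>z. zpow (\<lambda>_. m) z * f z) \<gamma>))\<^sup>2 * wpow lam \<gamma>"
  have inj: "inj ?h" by (auto simp: inj_def fun_eq_iff)
  have Fh: "?F \<circ> ?h = (\<lambda>\<alpha>. (cmod (coef f \<alpha>))\<^sup>2 * wpow lam (?h \<alpha>))"
    by (rule ext) (simp add: coef_zpow_mult[OF f])
  have z: "?F \<gamma> = 0" if "\<gamma> \<notin> range ?h" for \<gamma>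
  proof -
    have "\<not> (\<forall>i. m \<le> \<gamma> i)"
    proof
      assume "\<forall>i. m \<le> \<gamma> i"
      then have eq: "\<gamma> = ?h (\<lambda>i. \<gamma> i - m)" by (simp add: fun_eq_iff)
      have "\<gamma> \<in> range ?h" by (rule ssubst[OF eq]) (rule rangeI)
      with that show False by (rule notE)
    qed
    then show ?thesis by (simp only: coef_zpow_mult[OF f] if_False norm_zero power_zero_numeral mult_zero_left)
  qed
  have "(?F has_sum nsq (wpow lam) (coef (\<lambda>z. zpow (\<lambda>_. m) z * f z))) UNIV"
    using A_l2[OF lam sf] by (simp only: nsq_def l2_def has_sum_infsum)
  then have "(?F has_sum nsq (wpow lam) (coef (\<lambda>z. zpow (\<lambda>_. m) z * f z))) (range ?h)"
    using has_sum_cong_neutral[of UNIV "range ?h" ?F ?F] z by simp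
  then have hs: "((\<lambda>\<alpha>. (cmod (coef f \<alpha>))\<^sup>2 * wpow lam (?h \<alpha>)) has_sum nsq (wpow lam) (coef (\<lambda>z. zpow (\<lambda>_. m) z * f z))) UNIV"
    by (simp only: has_sum_reindex[OF inj] Fh)
  then show "l2 (\<lambda>\<alpha>. wpow lam (\<lambda>i. \<alpha> i + m)) (coef f)" unfolding l2_def by (rule has_sum_imp_summable)
  show "(bnorm lam (\<lambda>z. zpow (\<lambda>_. m) z * f z))\<^sup>2 = nsq (\<lambda>\<alpha>. wpow lam (\<lambda>i. \<alpha> i + m)) (coef f)"
    unfolding bnorm_nsq[OF lam sf] nsq_def[of "\<lambda>\<alpha>. wpow lam (?h \<alpha>)"] by (rule infsumI[OF hs, symmetric])
qed

text \<open>\<open>hardy_from_shifts\<close> is applied twice, with the roles of \<open>f\<close>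
  and \<open>U f\<close> exchanged; the first application supplies the square summability that the
  second one assumes.\<close>

lemma U_hardy:
  assumes f: "f \<in> H" and l: "ell2 (coef f)"
  shows "ell2 (coef (U f))" "nsq (\<lambda>_. 1) (coef (U f)) = nsq (\<lambda>_. 1) (coef f)"
proof -
  have s: "(\<lambda>z. zpow (\<lambda>_. m) z * f z) \<in> H" "U (\<lambda>z. zpow (\<lambda>_. m) z * f z) = (\<lambda>z. zpow (\<lambda>_. m) z * U f z)" for m
    using shift_intertwines[OF f] by blast+
  have a: "(\<lambda>z. zpow (\<lambda>_. m) z * f z) \<in> A_space lam" for m by (rule H_A[OF s(1)])
  have b: "(\<lambda>z. zpow (\<lambda>_. m) z * U f z) \<in> A_space lam" for m using H'_A[OF maps[OF s(1)[of m]]] by (simp only: s(2))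
  have fd: "f \<in> dfun" "U f \<in> dfun" using A_dfun[OF lam H_A[OF f]] A_dfun[OF lam H'_A[OF maps[OF f]]] .
  have eq: "nsq (\<lambda>\<alpha>. wpow lam (\<lambda>i. \<alpha> i + m)) (coef (U f)) = nsq (\<lambda>\<alpha>. wpow lam (\<lambda>i. \<alpha> i + m)) (coef f)" for m
    using isometric[OF s(1)[of m]] unfolding shifted_norm(2)[OF fd(1) a, symmetric] shifted_norm(2)[OF fd(2) b, symmetric] by (simp only: s(2))
  note A = shifted_norm(1)[OF fd(1) a] and B = shifted_norm(1)[OF fd(2) b]
  note h = hardy_from_shifts[OF lam B eq l]
  show "ell2 (coef (U f))" by (rule h(1))
  show "nsq (\<lambda>_. 1) (coef (U f)) = nsq (\<lambda>_. 1) (coef f)"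
    using h(2) hardy_from_shifts(2)[OF lam A eq[symmetric] h(1)] by (rule antisym)
qed

lemma U_dfun: "f \<in> H \<Longrightarrow> U f \<in> dfun"
  using A_dfun[OF lam H'_A[OF maps]] .

lemma H_dfun: "f \<in> H \<Longrightarrow> f \<in> dfun"
  using A_dfun[OF lam H_A] .

lemma U_ip:
  assumes f: "f \<in> H" "ell2 (coef f)" and g: "g \<in> H" "ell2 (coef g)"
  shows "ip (coef (U f)) (coef (U g)) = ip (coef f) (coef g)"
proof (rule ip_polarize)
  show "nsq (\<lambda>_. 1) (\<lambda>\<alpha>. coef (U f) \<alpha> + c * coef (U g) \<alpha>) = nsq (\<lambda>_. 1) (\<lambda>\<alpha>. coef f \<alpha> + c * coef g \<alpha>)" for c
  proof -
    let ?h = "\<lambda>z. f z + c * g z"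
    have hH: "?h \<in> H" by (rule H_add[OF f(1) H_cmult[OF g(1)]])
    have ch: "coef ?h = (\<lambda>\<alpha>. coef f \<alpha> + c * coef g \<alpha>)"
      by (simp only: coef_add[OF H_dfun[OF f(1)] dfun_cmult[OF H_dfun[OF g(1)]]] coef_cmult[OF H_dfun[OF g(1)]])
    have "U ?h = (\<lambda>z. U f z + c * U g z)" by (simp only: U_add[OF f(1) H_cmult[OF g(1)]] U_cmult[OF g(1)])
    then have cU: "coef (U ?h) = (\<lambda>\<alpha>. coef (U f) \<alpha> + c * coef (U g) \<alpha>)"
      by (simp only: coef_add[OF U_dfun[OF f(1)] dfun_cmult[OF U_dfun[OF g(1)]]] coef_cmult[OF U_dfun[OF g(1)]])
    have "ell2 (coef ?h)" unfolding ch by (rule ell2_add[OF f(2) l2_cmult[OF g(2)]])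
    from U_hardy(2)[OF hH this] show ?thesis by (simp only: ch cU)
  qed
qed (simp_all only: f g U_hardy)

text \<open>Extends \<open>U\<close> to the whole space, so that monomials become admissible
  arguments. The outer projection gives the adjoint the same shape, with the inverse of
  \<open>U\<close> between the projections.\<close>

definition T :: "(complex^'n \<Rightarrow> complex) \<Rightarrow> complex^'n \<Rightarrow> complex" where
  "T f = P' (U (P f))"

definition vmat :: "('n \<Rightarrow> nat) \<Rightarrow> ('n \<Rightarrow> nat) \<Rightarrow> complex" where
  "vmat \<gamma> \<alpha> = coef (T (zcut \<alpha>)) \<gamma>"

lemma ell2_zcut: "ell2 (coef (zcut \<alpha> :: complex^'n \<Rightarrow> complex))"
proof -
  have "(\<lambda>\<gamma>. (cmod (coef (zcut \<alpha> :: complex^'n \<Rightarrow> complex) \<gamma>))\<^sup>2 * 1) summable_on {\<alpha>}" by simp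
  then have "((\<lambda>\<gamma>. (cmod (coef (zcut \<alpha> :: complex^'n \<Rightarrow> complex) \<gamma>))\<^sup>2 * 1) has_sum infsum (\<lambda>\<gamma>. (cmod (coef (zcut \<alpha> :: complex^'n \<Rightarrow> complex) \<gamma>))\<^sup>2 * 1) {\<alpha>}) {\<alpha>}"
    by (rule has_sum_infsum)
  then have "((\<lambda>\<gamma>. (cmod (coef (zcut \<alpha> :: complex^'n \<Rightarrow> complex) \<gamma>))\<^sup>2 * 1) has_sum infsum (\<lambda>\<gamma>. (cmod (coef (zcut \<alpha> :: complex^'n \<Rightarrow> complex) \<gamma>))\<^sup>2 * 1) {\<alpha>}) UNIV"
    by (rule has_sum_UNIV_support) (simp add: coef_zcut)
  then show ?thesis unfolding l2_def by (rule has_sum_imp_summable)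
qed

lemma T_add: "f \<in> A_space lam \<Longrightarrow> g \<in> A_space lam \<Longrightarrow> T (\<lambda>z. f z + g z) = (\<lambda>z. T f z + T g z)"
  unfolding T_def by (simp only: P11_add U_add[OF P_H P_H])

lemma T_cmult: "f \<in> A_space lam \<Longrightarrow> T (\<lambda>z. c * f z) = (\<lambda>z. c * T f z)"
  unfolding T_def by (simp only: P11_cmult U_cmult[OF P_H])

lemma T_0: "T (\<lambda>_. 0) = (\<lambda>_. 0)"
  unfolding T_def by (simp only: P11_0 U_0)

lemma T_sum: "(\<And>j. j \<in> J \<Longrightarrow> f j \<in> A_space lam) \<Longrightarrow> T (\<lambda>z. \<Sum>j\<in>J. f j z) = (\<lambda>z. \<Sum>j\<in>J. T (f j) z)"
proof (induction J rule: infinite_finite_induct)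
  case (insert j J)
  have "T (\<lambda>z. f j z + (\<Sum>j\<in>J. f j z)) = (\<lambda>z. T (f j) z + T (\<lambda>z. \<Sum>j\<in>J. f j z) z)"
    by (rule T_add) (use insert in \<open>auto intro: A_sum[OF lam]\<close>)
  then show ?case using insert by simp
qed (simp_all add: T_0)

lemma T_dfun: "f \<in> A_space lam \<Longrightarrow> T f \<in> dfun"
  unfolding T_def by (rule dfun_P11[OF U_dfun[OF P_H]])

lemma T_orbit_sum:
  assumes f: "f \<in> A_space lam" shows "T (\<lambda>z. orbit_sum \<beta> z * f z) = (\<lambda>z. orbit_sum \<beta> z * T f z)"
proof -
  have 1: "P (\<lambda>z. orbit_sum \<beta> z * f z) = (\<lambda>z. orbit_sum \<beta> z * P f z)"
    by (rule P11_invariant_mult) (rule orbit_sum_act)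
  have 2: "P' (\<lambda>z. orbit_sum \<beta> z * U (P f) z) = (\<lambda>z. orbit_sum \<beta> z * P' (U (P f)) z)"
    by (rule P11_invariant_mult) (rule orbit_sum_act)
  show ?thesis unfolding T_def 1 orbit_sum_intertwines(2)[OF P_H[OF f]] 2 ..
qed

text \<open>The two sides compute the coefficient of z^\<gamma> in \<open>T\<close> applied to an
  orbit sum times z^\<alpha>, with the orbit sum outside or inside \<open>T\<close>.\<close>

lemma vmat_comm:
  "(\<Sum>\<sigma>\<in>Perms. if \<forall>i. \<beta> (\<sigma> i) \<le> \<gamma> i then vmat (\<lambda>i. \<gamma> i - \<beta> (\<sigma> i)) \<alpha> else 0)
     = (\<Sum>\<sigma>\<in>Perms. vmat \<gamma> (\<lambda>i. \<alpha> i + \<beta> (\<sigma> i)))"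
proof -
  have "(\<Sum>\<sigma>\<in>Perms. if \<forall>i. \<beta> (\<sigma> i) \<le> \<gamma> i then vmat (\<lambda>i. \<gamma> i - \<beta> (\<sigma> i)) \<alpha> else 0)
     = coef (\<lambda>z. orbit_sum \<beta> z * T (zcut \<alpha>) z) \<gamma>"
    unfolding vmat_def by (rule coef_orbit_sum_mult[OF T_dfun[OF A_zcut[OF lam]], symmetric])
  also have "\<dots> = coef (T (\<lambda>z. orbit_sum \<beta> z * zcut \<alpha> z)) \<gamma>" by (simp only: T_orbit_sum[OF A_zcut[OF lam]])
  also have "\<dots> = coef (T (\<lambda>z. \<Sum>\<sigma>\<in>Perms. zcut (\<lambda>i. \<alpha> i + \<beta> (\<sigma> i)) z)) \<gamma>" by (simp only: orbit_sum_zcut)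
  also have "\<dots> = coef (\<lambda>z. \<Sum>\<sigma>\<in>Perms. T (zcut (\<lambda>i. \<alpha> i + \<beta> (\<sigma> i))) z) \<gamma>" by (simp only: T_sum[OF A_zcut[OF lam]])
  also have "\<dots> = (\<Sum>\<sigma>\<in>Perms. vmat \<gamma> (\<lambda>i. \<alpha> i + \<beta> (\<sigma> i)))"
    unfolding vmat_def by (simp only: coef_sum[OF T_dfun[OF A_zcut[OF lam]]])
  finally show ?thesis .
qed

lemma P_zcut: "P (zcut \<alpha>) \<in> H" "ell2 (coef (P (zcut \<alpha>)))"
  by (rule P_H[OF A_zcut[OF lam]], rule ell2_P11[OF dfun_zcut ell2_zcut])

lemma ell2_T_zcut: "ell2 (coef (T (zcut \<alpha>)))"
  unfolding T_def by (rule ell2_P11[OF U_dfun[OF P_zcut(1)] U_hardy(1)[OF P_zcut]])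

text \<open>A Chebyshev count: if the squares in a column sum to s, at most s / e^2 of its entries
  exceed e.\<close>

lemma vmat_decay:
  assumes "0 < e" shows "finite {\<gamma>. e < cmod (vmat \<gamma> \<alpha>)}"
proof -
  have "(\<lambda>\<gamma>. (cmod (vmat \<gamma> \<alpha>))\<^sup>2 * 1) summable_on UNIV" using ell2_T_zcut unfolding l2_def vmat_def .
  then obtain s where hs: "((\<lambda>\<gamma>. (cmod (vmat \<gamma> \<alpha>))\<^sup>2 * 1) has_sum s) UNIV" unfolding summable_on_def by blast
  have le: "(\<Sum>\<gamma>\<in>F. (cmod (vmat \<gamma> \<alpha>))\<^sup>2 * 1) \<le> s" if "finite F" for F
    by (rule finite_sum_le_has_sum[OF hs that]) auto
  have card: "real (card F) \<le> s / e\<^sup>2" if F: "finite F" "F \<subseteq> {\<gamma>. e < cmod (vmat \<gamma> \<alpha>)}" for F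
  proof -
    have "real (card F) * e\<^sup>2 = (\<Sum>\<gamma>\<in>F. e\<^sup>2)" by simp
    also have "\<dots> \<le> (\<Sum>\<gamma>\<in>F. (cmod (vmat \<gamma> \<alpha>))\<^sup>2 * 1)"
      using F(2) assms by (intro sum_mono) (auto intro!: power_mono)
    also have "\<dots> \<le> s" by (rule le[OF F(1)])
    finally show ?thesis using assms by (simp add: pos_le_divide_eq)
  qed
  show ?thesis
  proof (rule ccontr)
    assume "infinite {\<gamma>. e < cmod (vmat \<gamma> \<alpha>)}"
    then obtain F where F: "finite F" "F \<subseteq> {\<gamma>. e < cmod (vmat \<gamma> \<alpha>)}" "card F = Suc (nat \<lceil>s / e\<^sup>2\<rceil>)"
      using infinite_arbitrarily_large by blast
    from card[OF F(1,2)] F(3) show False by linarith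
  qed
qed

lemma vmat_shift_matrix: "shift_matrix vmat"
  by unfold_locales (rule vmat_comm, rule vmat_decay)

text \<open>With \<open>P'\<close> moved to the second argument the entry pairs a vector in the
  range of \<open>U\<close> with an element of \<open>H'\<close>, a form to which the inverse of
  \<open>U\<close> can be applied.\<close>

lemma vmat_ip: "vmat \<gamma> \<alpha> = ip (coef (U (P (zcut \<alpha>)))) (coef (P' (zcut \<gamma>)))"
proof -
  have "vmat \<gamma> \<alpha> = ip (coef (T (zcut \<alpha>))) (coef (zcut \<gamma> :: complex^'n \<Rightarrow> complex))"
    unfolding vmat_def coef_zcut by (rule ip_delta[symmetric])
  also have "\<dots> = ip (coef (U (P (zcut \<alpha>)))) (coef (P' (zcut \<gamma>)))"
    unfolding T_def by (rule P11_selfadjoint[OF unitary(2) U_dfun[OF P_zcut(1)] U_hardy(1)[OF P_zcut] dfun_zcut ell2_zcut])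
  finally show ?thesis .
qed

end

section \<open>The spectral set estimate\<close>

lemma mult_tuple_power: "(mult_tuple k ^^ m) f = (\<lambda>z. esym k z ^ m * f z)"
  by (induction m) (simp_all add: mult_tuple_def mult.assoc)

lemma op_monom_mult_tuple:
  "op_monom CARD('n) mult_tuple \<alpha> f = (\<lambda>z :: complex^'n::finite. (\<Prod>k=1..CARD('n). symm_map z k ^ \<alpha> k) * f z)"
proof -
  have "foldr (\<lambda>k g. (mult_tuple k ^^ \<alpha> k) \<circ> g) ks id f = (\<lambda>z :: complex^'n. (\<Prod>k\<leftarrow>ks. esym k z ^ \<alpha> k) * f z)" for ks
    by (induction ks) (simp_all add: mult_tuple_power mult.assoc)
  moreover have "(\<Prod>k\<leftarrow>[1..<CARD('n) + 1]. esym k z ^ \<alpha> k) = (\<Prod>k=1..CARD('n). symm_map z k ^ \<alpha> k)" for z :: "complex^'n"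
  proof -
    have "(\<Prod>k\<leftarrow>[1..<CARD('n) + 1]. esym k z ^ \<alpha> k) = (\<Prod>k\<in>set [1..<CARD('n) + 1]. esym k z ^ \<alpha> k)"
      by (rule prod.distinct_set_conv_list[symmetric]) simp
    also have "\<dots> = (\<Prod>k=1..CARD('n). symm_map z k ^ \<alpha> k)"
      by (rule prod.cong) (auto simp: symm_map_def)
    finally show ?thesis .
  qed
  ultimately show ?thesis unfolding op_monom_def by (simp only:)
qed

lemma op_poly_mult_tuple:
  "op_poly CARD('n) mult_tuple c f = (\<lambda>z :: complex^'n::finite. mpoly_eval CARD('n) c (symm_map z) * f z)"
  unfolding op_poly_def mpoly_eval_def op_monom_mult_tuple by (simp add: sum_distrib_right mult.assoc)

lemma P11_gamma_contraction:
  fixes \<rho> :: "('n::finite \<Rightarrow> 'n) \<Rightarrow> nat \<Rightarrow> nat \<Rightarrow> complex"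
  assumes lam: "1 \<le> lam"
  shows "gamma_contraction CARD('n) (gamma_set TYPE('n)) (P11 d \<rho> ` A_space lam) (bnorm lam) mult_tuple"
  unfolding gamma_contraction_def
proof (intro conjI ballI)
  show "lin_op_on (P11 d \<rho> ` A_space lam) (mult_tuple k)" for k
    by (simp add: lin_op_on_def mult_tuple_def algebra_simps)
  show "mult_tuple k f \<in> P11 d \<rho> ` A_space lam" if "f \<in> P11 d \<rho> ` A_space lam" for k and f :: "complex^'n \<Rightarrow> complex"
  proof -
    obtain x where x: "x \<in> A_space lam" "f = P11 d \<rho> x" using \<open>f \<in> _\<close> by blast
    have "mult_tuple k f = P11 d \<rho> (mult_tuple k x)"
      unfolding x(2) mult_tuple_def by (rule P11_invariant_mult[symmetric, OF esym_act])
    then show ?thesis using A_esym[OF x(1)] by blast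
  qed
  show "mult_tuple j (mult_tuple k f) = mult_tuple k (mult_tuple j f)" for j k and f :: "complex^'n \<Rightarrow> complex"
    by (simp add: mult_tuple_def mult.left_commute)
  fix c and f :: "complex^'n \<Rightarrow> complex"
  assume c: "c \<in> mpolys CARD('n)" and f: "f \<in> P11 d \<rho> ` A_space lam"
  let ?n = "CARD('n)"
  let ?h = "\<lambda>z :: complex^'n. mpoly_eval ?n c (symm_map z)"
  define C where "C = (SUP w\<in>gamma_set TYPE('n). cmod (mpoly_eval ?n c w))"
  have fA: "f \<in> A_space lam" using f A_P11[OF lam] by blast
  \<comment> \<open>A real supremum bounds its members only if the set is bounded; here the s_k are
    bounded on the closed polydisc and the polynomial has finitely many terms.\<close>
  have bd: "bdd_above ((\<lambda>w. cmod (mpoly_eval ?n c w)) ` gamma_set TYPE('n))"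
  proof (rule bdd_aboveI2)
    fix w assume "w \<in> gamma_set TYPE('n)"
    then obtain z :: "complex^'n" where z: "z \<in> cpolydisc" "w = symm_map z" by (auto simp: gamma_set_def)
    have wk: "cmod (w k) \<le> real (card (UNIV :: 'n set set))" for k
      using esym_bound[OF z(1)] by (simp add: z(2) symm_map_def del: UNIV_Times_UNIV)
    show "cmod (mpoly_eval ?n c w) \<le> (\<Sum>\<alpha>\<in>{\<alpha>. c \<alpha> \<noteq> 0}. cmod (c \<alpha>) * (\<Prod>k=1..?n. real (card (UNIV :: 'n set set)) ^ \<alpha> k))"
      unfolding mpoly_eval_def
    proof (rule order_trans[OF norm_sum sum_mono])
      fix \<alpha> :: "nat \<Rightarrow> nat"
      have "cmod (\<Prod>k=1..?n. w k ^ \<alpha> k) \<le> (\<Prod>k=1..?n. real (card (UNIV :: 'n set set)) ^ \<alpha> k)"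
        unfolding prod_norm[symmetric] norm_power by (intro prod_mono conjI power_mono wk) auto
      then show "cmod (c \<alpha> * (\<Prod>k=1..?n. w k ^ \<alpha> k)) \<le> cmod (c \<alpha>) * (\<Prod>k=1..?n. real (card (UNIV :: 'n set set)) ^ \<alpha> k)"
        unfolding norm_mult by (rule mult_left_mono) simp
    qed
  qed
  have hC: "cmod (?h z) \<le> C" if "z \<in> cpolydisc" for z
    unfolding C_def by (rule cSUP_upper[OF _ bd]) (simp add: gamma_set_def that)
  have "0 \<in> (cpolydisc :: (complex^'n) set)" by (simp add: cpolydisc_def)
  from order_trans[OF norm_ge_zero hC[OF this]] have C0: "0 \<le> C" .
  have hholo: "holo_on ?h polydisc"
  proof -
    have "holo_on (\<lambda>z :: complex^'n. symm_map z k) polydisc" for k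
      unfolding symm_map_def by (cases "k \<in> {1..?n}") (simp_all only: if_True if_False holo_const holo_esym)
    then show ?thesis unfolding mpoly_eval_def by (intro holo_sum holo_mult[OF holo_const] holo_prod holo_power)
  qed
  show "bnorm lam (op_poly ?n mult_tuple c f) \<le> (SUP w\<in>gamma_set TYPE('n). cmod (mpoly_eval ?n c w)) * bnorm lam f"
    unfolding op_poly_mult_tuple C_def[symmetric]
    by (rule A_mult(2)[OF fA hholo C0 hC[OF polydisc_subset]])
qed

section \<open>The adjoint of the compressed intertwiner and the contradiction\<close>

lemma shift_matrix_cnj:
  assumes "shift_matrix v" shows "shift_matrix (\<lambda>\<gamma> \<alpha>. cnj (v \<gamma> \<alpha>))"
proof -
  interpret shift_matrix v by fact
  show ?thesis
  proof
    fix \<beta> \<gamma> \<alpha> :: "'a \<Rightarrow> nat"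
    have "cnj (\<Sum>\<sigma>\<in>Perms. if \<forall>i. \<beta> (\<sigma> i) \<le> \<gamma> i then v (\<lambda>i. \<gamma> i - \<beta> (\<sigma> i)) \<alpha> else 0) = cnj (\<Sum>\<sigma>\<in>Perms. v \<gamma> (\<lambda>i. \<alpha> i + \<beta> (\<sigma> i)))"
      by (simp only: comm)
    then show "(\<Sum>\<sigma>\<in>Perms. if \<forall>i. \<beta> (\<sigma> i) \<le> \<gamma> i then cnj (v (\<lambda>i. \<gamma> i - \<beta> (\<sigma> i)) \<alpha>) else 0) = (\<Sum>\<sigma>\<in>Perms. cnj (v \<gamma> (\<lambda>i. \<alpha> i + \<beta> (\<sigma> i))))"
      by (simp only: cnj_sum if_distrib[of cnj] complex_cnj_zero)
  qed (simp add: dec)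
qed

lemma (in intertwiner) inverse_intertwiner:
  assumes bij: "bij_betw U H H'"
  shows "intertwiner lam d' d \<rho>' \<rho> (inv_into H U)"
proof -
  have UU: "U (inv_into H U g) = g" "inv_into H U g \<in> H" if "g \<in> H'" for g
    using that bij by (simp_all add: bij_betw_inv_into_right bij_betw_apply[OF bij_betw_inv_into[OF bij]])
  have eqI: "inv_into H U g = f" if "f \<in> H" "U f = g" for f g
    using that bij by (metis bij_betw_inv_into_left)
  show ?thesis
  proof
    show "1 \<le> lam" "unitary_rep d' \<rho>'" "unitary_rep d \<rho>" by (fact lam unitary)+
    show "lin_op_on H' (inv_into H U)"
      unfolding lin_op_on_def
    proof (intro conjI ballI allI)
      fix f g assume fg: "f \<in> H'" "g \<in> H'"
      show "inv_into H U (\<lambda>x. f x + g x) = (\<lambda>y. inv_into H U f y + inv_into H U g y)"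
        by (rule eqI[OF H_add[OF UU(2)[OF fg(1)] UU(2)[OF fg(2)]]])
           (simp only: U_add[OF UU(2)[OF fg(1)] UU(2)[OF fg(2)]] UU(1)[OF fg(1)] UU(1)[OF fg(2)])
    next
      fix a f assume f: "f \<in> H'"
      show "inv_into H U (\<lambda>x. a * f x) = (\<lambda>y. a * inv_into H U f y)"
        by (rule eqI[OF H_cmult[OF UU(2)[OF f]]]) (simp only: U_cmult[OF UU(2)[OF f]] UU(1)[OF f])
    qed
    fix f assume f: "f \<in> H'"
    show "inv_into H U f \<in> H" by (rule UU(2)[OF f])
    show "bnorm lam (inv_into H U f) = bnorm lam f"
      using isometric[OF UU(2)[OF f]] by (simp only: UU(1)[OF f])
    fix k assume k: "k \<in> {1..CARD('n)}"
    show "inv_into H U (mult_tuple k f) = mult_tuple k (inv_into H U f)"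
      by (rule eqI[OF H_esym[OF UU(2)[OF f]]]) (simp only: intertwines[OF k UU(2)[OF f]] UU(1)[OF f])
  qed
qed

text \<open>In the Hardy inner product the adjoint of P' U P is P U^-1 P', because the projections
  are self-adjoint and \<open>U\<close> preserves the pairing. The transposed entries are therefore
  conjugates of those of the inverse intertwiner, which satisfies the same relations.\<close>

lemma (in intertwiner) orbit_matrix_vmat:
  assumes bij: "bij_betw U H H'"
  shows "orbit_matrix vmat"
proof -
  interpret J: intertwiner lam d' d \<rho>' \<rho> "inv_into H U" by (rule inverse_intertwiner[OF bij])
  have flip: "cnj (J.vmat \<alpha> \<gamma>) = vmat \<gamma> \<alpha>" for \<alpha> \<gamma>
  proof -
    have UU: "U (inv_into H U (P' (zcut \<gamma>))) = P' (zcut \<gamma>)"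
      using bij J.P_zcut(1) by (rule bij_betw_inv_into_right)
    have "J.vmat \<alpha> \<gamma> = ip (coef (inv_into H U (P' (zcut \<gamma>)))) (coef (P (zcut \<alpha>)))" by (rule J.vmat_ip)
    also have "\<dots> = ip (coef (U (inv_into H U (P' (zcut \<gamma>))))) (coef (U (P (zcut \<alpha>))))"
      by (rule U_ip[symmetric, OF J.maps[OF J.P_zcut(1)] J.U_hardy(1)[OF J.P_zcut] P_zcut])
    finally show ?thesis unfolding UU vmat_ip by (simp only: ip_sym[symmetric])
  qed
  have "shift_matrix (\<lambda>\<alpha> \<gamma>. cnj (J.vmat \<alpha> \<gamma>))" by (rule shift_matrix_cnj[OF J.vmat_shift_matrix])
  then have "shift_matrix (\<lambda>\<alpha> \<gamma>. vmat \<gamma> \<alpha>)" unfolding flip .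
  with vmat_shift_matrix show ?thesis by (rule orbit_matrix.intro)
qed

text \<open>On the span of an orbit of monomials with distinct exponents the compressed intertwiner \<open>T\<close> is a
  combination of coordinate permutations, and these are annihilated between the two isotypic parts.\<close>
lemma (in intertwiner) no_unitary:
  assumes bij: "bij_betw U H H'"
    and irr: "irreducible_rep d \<rho>" "irreducible_rep d' \<rho>'" and ne: "\<not> rep_equiv d \<rho> d' \<rho>'"
  shows False
proof -
  interpret V: orbit_matrix vmat by (rule orbit_matrix_vmat[OF bij])
  obtain \<alpha> :: "'n \<Rightarrow> nat" where inj: "inj \<alpha>"
    using finite_imp_inj_to_nat_seg[of "UNIV::'n set"] by auto
  define c where "c \<sigma> = vmat (\<alpha> \<circ> \<sigma>) \<alpha>" for \<sigma>
  define k :: complex where "k = of_nat d / of_nat (fact CARD('n))"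
  \<comment> \<open>The coefficients \<open>c \<sigma>\<close> are the same for every member
    \<open>\<alpha> \<circ> \<tau>\<close> of the orbit, by \<open>coeff_const\<close>; this is what
    makes \<open>T\<close> a combination of coordinate permutations on the whole span.\<close>
  have Tz: "T (zcut (\<alpha> \<circ> \<tau>)) = (\<lambda>z. \<Sum>\<sigma>\<in>Perms. c \<sigma> * zcut (\<alpha> \<circ> \<tau>) (act \<sigma> z))" if t: "\<tau> \<in> Perms" for \<tau>
  proof (rule coef_inject)
    have d: "(\<lambda>z. c \<sigma> * zcut (\<alpha> \<circ> \<tau>) (act \<sigma> z)) \<in> dfun" if "\<sigma> \<in> Perms" for \<sigma>
      by (rule dfun_cmult[OF dfun_act[OF dfun_zcut that]])
    show "T (zcut (\<alpha> \<circ> \<tau>)) \<in> dfun" by (rule T_dfun[OF A_zcut[OF lam]])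
    show "(\<lambda>z. \<Sum>\<sigma>\<in>Perms. c \<sigma> * zcut (\<alpha> \<circ> \<tau>) (act \<sigma> z)) \<in> dfun" by (rule dfun_sum[OF d])
    have injt: "inj (\<alpha> \<circ> \<tau>)" using inj t by (simp add: inj_compose permutes_inj)
    have "coef (\<lambda>z. \<Sum>\<sigma>\<in>Perms. c \<sigma> * zcut (\<alpha> \<circ> \<tau>) (act \<sigma> z)) \<gamma> = vmat \<gamma> (\<alpha> \<circ> \<tau>)" for \<gamma>
    proof -
      have "coef (\<lambda>z. \<Sum>\<sigma>\<in>Perms. c \<sigma> * zcut (\<alpha> \<circ> \<tau>) (act \<sigma> z)) \<gamma> = (\<Sum>\<sigma>\<in>Perms. coef (\<lambda>z. c \<sigma> * zcut (\<alpha> \<circ> \<tau>) (act \<sigma> z)) \<gamma>)"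
        by (simp only: coef_sum[OF d])
      also have "\<dots> = (\<Sum>\<sigma>\<in>Perms. if \<gamma> = \<alpha> \<circ> \<tau> \<circ> \<sigma> then c \<sigma> else 0)"
      proof (rule sum.cong[OF refl])
        fix \<sigma> :: "'n \<Rightarrow> 'n" assume s: "\<sigma> \<in> Perms"
        have "(\<lambda>z. c \<sigma> * zcut (\<alpha> \<circ> \<tau>) (act \<sigma> z)) = (\<lambda>z. c \<sigma> * zcut (\<alpha> \<circ> \<tau> \<circ> \<sigma>) z)"
          by (simp only: zcut_act[OF s])
        then show "coef (\<lambda>z. c \<sigma> * zcut (\<alpha> \<circ> \<tau>) (act \<sigma> z)) \<gamma> = (if \<gamma> = \<alpha> \<circ> \<tau> \<circ> \<sigma> then c \<sigma> else 0)"
          by (simp add: coef_cmult[OF dfun_zcut] coef_zcut)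
      qed
      also have "\<dots> = vmat \<gamma> (\<alpha> \<circ> \<tau>)"
      proof (cases "\<exists>\<sigma>\<in>Perms. \<gamma> = \<alpha> \<circ> \<tau> \<circ> \<sigma>")
        case True
        then obtain \<sigma>0 where s0: "\<sigma>0 \<in> Perms" "\<gamma> = \<alpha> \<circ> \<tau> \<circ> \<sigma>0" by blast
        \<comment> \<open>Because the exponents are distinct, at most one permutation produces
          \<open>\<gamma>\<close>.\<close>
        have "\<gamma> = \<alpha> \<circ> \<tau> \<circ> \<sigma> \<longleftrightarrow> \<sigma> = \<sigma>0" for \<sigma>
          using injt unfolding s0(2) by (metis fun.inj_map_strong comp_def injD ext)
        then have "(\<Sum>\<sigma>\<in>Perms. if \<gamma> = \<alpha> \<circ> \<tau> \<circ> \<sigma> then c \<sigma> else 0) = c \<sigma>0" using s0(1) by simp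
        also have "\<dots> = vmat \<gamma> (\<alpha> \<circ> \<tau>)" unfolding c_def s0(2) by (rule V.coeff_const[OF inj t s0(1), symmetric])
        finally show ?thesis .
      next
        case False
        then have "vmat \<gamma> (\<alpha> \<circ> \<tau>) = 0" using V.support[of \<gamma> "\<alpha> \<circ> \<tau>"] by blast
        moreover have "(\<Sum>\<sigma>\<in>Perms. if \<gamma> = \<alpha> \<circ> \<tau> \<circ> \<sigma> then c \<sigma> else 0) = 0" using False by (intro sum.neutral) auto
        ultimately show ?thesis by simp
      qed
      finally show ?thesis .
    qed
    then show "coef (T (zcut (\<alpha> \<circ> \<tau>))) = coef (\<lambda>z. \<Sum>\<sigma>\<in>Perms. c \<sigma> * zcut (\<alpha> \<circ> \<tau>) (act \<sigma> z))"
      by (simp add: vmat_def fun_eq_iff)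
  qed
  have Pz: "P (zcut \<alpha>) = (\<lambda>z. k * (\<Sum>\<tau>\<in>Perms. \<rho> \<tau> 0 0 * zcut (\<alpha> \<circ> \<tau>) z))"
    unfolding P11_eq k_def by (intro ext arg_cong2[where f = "(*)"] refl sum.cong) (rule zcut_act)
  have A: "zcut \<beta> \<in> A_space lam" for \<beta> :: "'n \<Rightarrow> nat" by (rule A_zcut[OF lam])
  have "T (P (zcut \<alpha>)) = (\<lambda>z. k * (\<Sum>\<tau>\<in>Perms. \<rho> \<tau> 0 0 * T (zcut (\<alpha> \<circ> \<tau>)) z))"
    unfolding Pz by (simp only: T_cmult[OF A_sum[OF lam A_cmult[OF lam A]]] T_sum[OF A_cmult[OF lam A]] T_cmult[OF A])
  also have "\<dots> = (\<lambda>z. k * (\<Sum>\<tau>\<in>Perms. \<rho> \<tau> 0 0 * (\<Sum>\<sigma>\<in>Perms. c \<sigma> * zcut (\<alpha> \<circ> \<tau>) (act \<sigma> z))))"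
    by (intro ext arg_cong2[where f = "(*)"] refl sum.cong) (simp only: Tz)
  also have "\<dots> = (\<lambda>z. \<Sum>\<sigma>\<in>Perms. c \<sigma> * P (zcut \<alpha>) (act \<sigma> z))"
  proof
    fix z
    have "k * (\<Sum>\<tau>\<in>Perms. \<rho> \<tau> 0 0 * (\<Sum>\<sigma>\<in>Perms. c \<sigma> * zcut (\<alpha> \<circ> \<tau>) (act \<sigma> z)))
        = (\<Sum>\<tau>\<in>Perms. \<Sum>\<sigma>\<in>Perms. c \<sigma> * (k * (\<rho> \<tau> 0 0 * zcut (\<alpha> \<circ> \<tau>) (act \<sigma> z))))"
      by (simp only: sum_distrib_left ac_simps)
    also have "\<dots> = (\<Sum>\<sigma>\<in>Perms. \<Sum>\<tau>\<in>Perms. c \<sigma> * (k * (\<rho> \<tau> 0 0 * zcut (\<alpha> \<circ> \<tau>) (act \<sigma> z))))"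
      by (rule sum.swap)
    also have "\<dots> = (\<Sum>\<sigma>\<in>Perms. c \<sigma> * P (zcut \<alpha>) (act \<sigma> z))"
      unfolding Pz by (simp only: sum_distrib_left)
    finally show "k * (\<Sum>\<tau>\<in>Perms. \<rho> \<tau> 0 0 * (\<Sum>\<sigma>\<in>Perms. c \<sigma> * zcut (\<alpha> \<circ> \<tau>) (act \<sigma> z)))
        = (\<Sum>\<sigma>\<in>Perms. c \<sigma> * P (zcut \<alpha>) (act \<sigma> z))" .
  qed
  finally have TP: "T (P (zcut \<alpha>)) = (\<lambda>z. \<Sum>\<sigma>\<in>Perms. c \<sigma> * P (zcut \<alpha>) (act \<sigma> z))" .
  \<comment> \<open>Each summand is \<open>P\<close>, then a coordinate permutation, then the
    inequivalent projection \<open>P'\<close>, so \<open>P11_cross\<close> makes it vanish.\<close>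
  have "P' (T (P (zcut \<alpha>))) = (\<lambda>z. \<Sum>\<sigma>\<in>Perms. c \<sigma> * P' (\<lambda>z. P (zcut \<alpha>) (act \<sigma> z)) z)"
    unfolding TP by (simp only: P11_sum P11_cmult)
  also have "\<dots> = (\<lambda>_. 0)"
  proof
    fix z
    show "(\<Sum>\<sigma>\<in>Perms. c \<sigma> * P' (\<lambda>z. P (zcut \<alpha>) (act \<sigma> z)) z) = 0"
      by (intro sum.neutral ballI) (simp only: P11_cross[OF irr ne] mult_zero_right)
  qed
  finally have "P' (P' (U (P (P (zcut \<alpha>))))) z = 0" for z unfolding T_def by (rule fun_cong)
  \<comment> \<open>The projections are now peeled off from outside. One \<open>P'\<close> is
    removed as a repeated factor; the remaining vector is in the range of \<open>P'\<close> composed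
    with \<open>U\<close>, so a second removal reaches the image under \<open>U\<close>. Injectivity
    of \<open>U\<close> then passes to P (P z^\<alpha>), and a last removal gives P z^\<alpha> =
    0.\<close>
  then have PU0: "P' (U (P (P (zcut \<alpha>)))) z = 0" for z by (rule P11_square_zero[OF unitary(2)])
  have PP: "P (P (zcut \<alpha>)) \<in> H" by (rule P_H[OF H_A[OF P_zcut(1)]])
  obtain h where h: "U (P (P (zcut \<alpha>))) = P' h" using maps[OF PP] by blast
  have "P' h z = 0" for z by (rule P11_square_zero[OF unitary(2)]) (rule PU0[unfolded h])
  then have "U (P (P (zcut \<alpha>))) = U (\<lambda>_. 0)" unfolding U_0 h by (rule ext)
  then have "P (P (zcut \<alpha>)) = (\<lambda>_. 0)" using bij_betw_imp_inj_on[OF bij] PP H_0 by (meson inj_onD)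
  then have "P (P (zcut \<alpha>)) z = 0" for z by (rule fun_cong)
  then have "P (zcut \<alpha>) z = 0" for z by (rule P11_square_zero[OF unitary(1)])
  then have "P (zcut \<alpha>) = (\<lambda>_. 0)" by (rule ext)
  then have "coef (P (zcut \<alpha>)) \<alpha> = 0" by (simp only: coef_0)
  \<comment> \<open>Distinct exponents have trivial stabiliser, so only the identity contributes to
    the coefficient of z^\<alpha>, and its matrix entry is 1: the coefficient is d / n!, which is
    not zero.\<close>
  then have "k * (\<Sum>\<tau>\<in>Perms. \<rho> \<tau> 0 0 * (if \<alpha> \<circ> inv \<tau> = \<alpha> then 1 else 0)) = 0"
    by (simp only: coef_P11[OF dfun_zcut] coef_zcut k_def)
  moreover have "(\<Sum>\<tau>\<in>Perms. \<rho> \<tau> 0 0 * (if \<alpha> \<circ> inv \<tau> = \<alpha> then 1 else 0)) = (\<Sum>\<tau>\<in>Perms. if \<tau> = id then \<rho> \<tau> 0 0 else 0)"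
  proof (rule sum.cong[OF refl])
    fix \<tau> :: "'n \<Rightarrow> 'n" assume t: "\<tau> \<in> Perms"
    have "\<alpha> \<circ> inv \<tau> = \<alpha> \<longleftrightarrow> \<tau> = id"
    proof
      assume e: "\<alpha> \<circ> inv \<tau> = \<alpha>"
      have "inv \<tau> i = i" for i using fun_cong[OF e, of i] inj by (simp add: inj_eq)
      then have "inv \<tau> = id" by auto
      then show "\<tau> = id" using t by (metis mem_Collect_eq permutes_inv_inv inv_id)
    qed simp
    then show "\<rho> \<tau> 0 0 * (if \<alpha> \<circ> inv \<tau> = \<alpha> then 1 else 0) = (if \<tau> = id then \<rho> \<tau> 0 0 else 0)" by simp
  qed
  moreover have "(\<Sum>\<tau>\<in>Perms. if \<tau> = id then \<rho> \<tau> 0 0 else 0) = \<rho> id 0 0" by simp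
  moreover have "\<rho> id 0 0 = 1" "k \<noteq> 0"
    using unitary(1) by (auto simp: unitary_rep_def is_rep_def k_def)
  ultimately show False by simp
qed

theorem theorem4p18:
  fixes lam :: real
    and deg :: "nat list \<Rightarrow> nat"
    and \<pi> :: "nat list \<Rightarrow> ('n::finite \<Rightarrow> 'n) \<Rightarrow> nat \<Rightarrow> nat \<Rightarrow> complex"
  assumes n_gt: "CARD('n) > 1"
    and lam_ge: "lam \<ge> 1"
    and irr: "\<forall>p\<in>partitions CARD('n). unitary_rep (deg p) (\<pi> p) \<and> irreducible_rep (deg p) (\<pi> p)"
    and ineq: "\<forall>p\<in>partitions CARD('n). \<forall>q\<in>partitions CARD('n).
                 p \<noteq> q \<longrightarrow> \<not> rep_equiv (deg p) (\<pi> p) (deg q) (\<pi> q)"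
    and exh: "\<forall>d (\<rho> :: ('n \<Rightarrow> 'n) \<Rightarrow> nat \<Rightarrow> nat \<Rightarrow> complex). irreducible_rep d \<rho> \<longrightarrow>
                 (\<exists>p\<in>partitions CARD('n). rep_equiv d \<rho> (deg p) (\<pi> p))"
  shows "(\<forall>p\<in>partitions CARD('n).
            gamma_contraction CARD('n) (gamma_set TYPE('n))
              (P11 (deg p) (\<pi> p) ` A_space lam) (bnorm lam) mult_tuple)
       \<and> (\<forall>p\<in>partitions CARD('n). \<forall>q\<in>partitions CARD('n). p \<noteq> q \<longrightarrow>
            \<not> unitarily_equiv CARD('n)
                (P11 (deg p) (\<pi> p) ` A_space lam) (bnorm lam) mult_tuple
                (P11 (deg q) (\<pi> q) ` A_space lam) (bnorm lam) mult_tuple)"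
proof (intro conjI ballI impI)
  show "gamma_contraction CARD('n) (gamma_set TYPE('n)) (P11 (deg p) (\<pi> p) ` A_space lam) (bnorm lam) mult_tuple" for p
    by (rule P11_gamma_contraction[OF lam_ge])
next
  fix p q assume p: "p \<in> partitions CARD('n)" and q: "q \<in> partitions CARD('n)" and pq: "p \<noteq> q"
  let ?H = "P11 (deg p) (\<pi> p) ` A_space lam" and ?H' = "P11 (deg q) (\<pi> q) ` A_space lam"
  show "\<not> unitarily_equiv CARD('n) ?H (bnorm lam) mult_tuple ?H' (bnorm lam) mult_tuple"
  proof
    assume "unitarily_equiv CARD('n) ?H (bnorm lam) mult_tuple ?H' (bnorm lam) mult_tuple"
    then obtain U where U: "bij_betw U ?H ?H'" "lin_op_on ?H U" "\<forall>f\<in>?H. bnorm lam (U f) = bnorm lam f"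
      "\<forall>k\<in>{1..CARD('n)}. \<forall>f\<in>?H. U (mult_tuple k f) = mult_tuple k (U f)"
      unfolding unitarily_equiv_def by blast
    interpret intertwiner lam "deg p" "deg q" "\<pi> p" "\<pi> q" U
    proof
      show "1 \<le> lam" by (rule lam_ge)
      show "unitary_rep (deg p) (\<pi> p)" "unitary_rep (deg q) (\<pi> q)" using irr p q by auto
      show "U f \<in> ?H'" if "f \<in> ?H" for f using bij_betw_apply[OF U(1) that] .
    qed (use U in blast)+
    show False by (rule no_unitary[OF U(1)]) (use irr ineq p q pq in auto)
  qed
qed

end
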